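(* Let $f:D\to G$ be a proper holomorphic mapping between domains in $\mathbb C^n$. Let $L$ be a domain relatively compact in $G$, and put $K=f^{-1}(L)$. Then $$f(\partial_s K)=\partial_s L\quad\text{and}\quad f(\partial_b K)=\partial_b L.$$
   Context: For a bounded open set $\Omega\subset\mathbb C^n$, the Shilov boundary $\partial_s \Omega$ is the smallest closed subset $S$ of $\overline \Omega$ such that $\max_{\overline \Omega}|h|=\max_{S}|h|$ for every $h\in\mathcal O(\Omega)\cap\mathcal C(\overline \Omega)$. The Bergman boundary $\partial_b\Omega$ is the smallest closed subset $S$ of $\overline\Omega$ such that $\max_{\overline\Omega}|h|=\max_S|h|$ for every $h\in\mathcal O(\overline\Omega)$, i.e. for every $h$ holomorphic in some open neighborhood of $\overline\Omega$. *)

theory Defs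
  imports "HOL-Analysis.Analysis"
begin

definition domain_Cn :: "(complex ^ 'n) set \<Rightarrow> bool" where
  "domain_Cn D \<longleftrightarrow> open D \<and> connected D \<and> D \<noteq> {}"

text \<open>
  Holomorphic functions of several variables: complex differentiable at each point, i.e.
  Frechet differentiable with a \<open>\<complex>\<close>-linear derivative. Only meant for open sets \<open>U\<close>.
\<close>

definition holomorphic_Cn :: "(complex ^ 'n \<Rightarrow> complex) \<Rightarrow> (complex ^ 'n) set \<Rightarrow> bool" where
  "holomorphic_Cn h U \<longleftrightarrow>
     (\<forall>z\<in>U. \<exists>h'. (h has_derivative h') (at z) \<and> (\<forall>c v. h' (c *s v) = c * h' v))"

definition holomorphic_map_Cn ::
    "(complex ^ 'n \<Rightarrow> complex ^ 'm) \<Rightarrow> (complex ^ 'n) set \<Rightarrow> bool" where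
  "holomorphic_map_Cn f U \<longleftrightarrow> (\<forall>i. holomorphic_Cn (\<lambda>z. f z $ i) U)"

definition proper_holomorphic_map ::
    "(complex ^ 'n \<Rightarrow> complex ^ 'm) \<Rightarrow> (complex ^ 'n) set \<Rightarrow> (complex ^ 'm) set \<Rightarrow> bool" where
  "proper_holomorphic_map f D G \<longleftrightarrow>
     holomorphic_map_Cn f D \<and> f ` D \<subseteq> G \<and>
     (\<forall>C. compact C \<and> C \<subseteq> G \<longrightarrow> compact (D \<inter> f -` C))"

text \<open>
  The smallest closed \<open>S \<subseteq> X\<close> on which every \<open>h \<in> A\<close> has the same maximum modulus as on \<open>X\<close>;
  \<open>LEAST\<close> is with respect to inclusion. It is applied to compact \<open>X\<close> and to functions continuous
  on \<open>X\<close>, so that the suprema over nonempty sets are maxima. For \<open>X \<noteq> {}\<close> the set \<open>S = {}\<close>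
  never qualifies when \<open>A\<close> contains the constants, since the one value \<open>Sup {}\<close> cannot equal
  the supremum of every constant function.
\<close>

definition max_modulus_boundary ::
    "(complex ^ 'n \<Rightarrow> complex) set \<Rightarrow> (complex ^ 'n) set \<Rightarrow> (complex ^ 'n) set" where
  "max_modulus_boundary A X =
     (LEAST S. closed S \<and> S \<subseteq> X \<and>
        (\<forall>h\<in>A. (SUP z\<in>X. norm (h z)) = (SUP z\<in>S. norm (h z))))"

definition shilov_boundary :: "(complex ^ 'n) set \<Rightarrow> (complex ^ 'n) set" where
  "shilov_boundary \<Omega> =
     max_modulus_boundary {h. holomorphic_Cn h \<Omega> \<and> continuous_on (closure \<Omega>) h} (closure \<Omega>)"

definition bergman_boundary :: "(complex ^ 'n) set \<Rightarrow> (complex ^ 'n) set" where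
  "bergman_boundary \<Omega> =
     max_modulus_boundary {h. \<exists>U. open U \<and> closure \<Omega> \<subseteq> U \<and> holomorphic_Cn h U} (closure \<Omega>)"

end

theory Submission
  imports Defs "HOL-Complex_Analysis.Complex_Analysis"
begin

text \<open>
  Composition with \<open>f\<close> maps the algebra of \<open>L\<close> into that of \<open>K\<close>, which gives \<open>\<partial>L \<subseteq> f(\<partial>K)\<close>. For the
  other inclusion one pushes functions forward by summing over fibres: if \<open>\<bar>h\<bar> \<le> R\<close> on
  \<open>f\<^sup>-\<^sup>1(\<partial>L)\<close>, then the pushforward of \<open>h\<^sup>m\<close> is bounded by \<open>C R\<^sup>m\<close> on \<open>\<partial>L\<close>, hence on \<open>L\<close>, and power
  sums of size \<open>O(R\<^sup>m)\<close> for all \<open>m\<close> force \<open>\<bar>h\<bar> \<le> R\<close> on the fibres.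

  The pushforward is constructed without the theory of analytic sets. For a bump function \<open>q\<close> put
  \<open>S(\<rho>, w) = \<integral> h \<bar>det f'\<bar>\<^sup>2 q(\<rho> - \<bar>f - w\<bar>\<^sup>2)\<close>. By Stokes' theorem (the Jacobian determinant is a null
  Lagrangian) \<open>S\<close> is holomorphic in \<open>w\<close> and a pure power of \<open>\<rho>\<close>; the limit \<open>\<rho> \<rightarrow> 0\<close> shows that it is a
  weighted sum of the values of \<open>h\<close> over the fibre. The total weight is locally constant because
  it is holomorphic and real. This replaces the topological degree: it yields surjectivity of \<open>f\<close>,
  a constant number of points in regular fibres, and finiteness of all fibres. By Sard's theorem
  regular values are dense.
\<close>

section \<open>Holomorphic functions of several variables\<close>

unbundle no fps_syntax


text \<open>For a branched cover the sum T of \<open>h\<close> over the fibre is holomorphic, and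
  substituting u = f(z), with real Jacobian |det f'|^2, turns S(\<rho>, w) into the integral of T
  against the radial kernel q(\<rho> - |u - w|^2). For q the squared positive part the mean value
  property gives a constant times \<rho>^(n+2) T(w): n from the volume in C^n, 2 from the square.
  The proof runs this backwards: Stokes supplies holomorphy and homogeneity while nothing is known
  about the fibres, and T is defined through S. The obstacle is that in the Shilov case
  \<open>h\<close> lives only on the closure of \<open>K\<close>, so no integral over a
  neighbourhood of a boundary fibre is available. There the push-forward must be a finite sum with
  weights fixed by \<open>f\<close> alone. Hence critical fibres too have to be shown finite, and
  conservation of weights yields continuity up to the boundary. All powers are pushed forward
  because a single fibre sum may be small by cancellation; the growth of all power sums excludes
  this.\<close>

definition pd :: "'n::finite \<Rightarrow> (complex ^ 'n \<Rightarrow> complex) \<Rightarrow> complex ^ 'n \<Rightarrow> complex" where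
  "pd j h z = frechet_derivative h (at z) (axis j 1)"

lemma norm_scal_axis [simp]: "norm (t *s axis j (1::complex)) = norm t"
proof -
  have "t *s axis j (1::complex) = axis j t"
    by (auto simp: vec_eq_iff axis_def)
  moreover have "norm (axis j t) = norm t"
    by (simp add: norm_vec_def L2_set_def axis_def if_distrib[of norm] if_distrib[of "\<lambda>x. x ^ 2"] cong: if_cong)
  ultimately show ?thesis by simp
qed

lemma bounded_linear_scal: "bounded_linear (\<lambda>t. t *s (v :: complex ^ 'n))"
proof (rule bounded_linearI')
  show "(x + y) *s v = x *s v + y *s v" for x y
    by (simp add: vec_eq_iff algebra_simps)
  show "(r *\<^sub>R x) *s v = r *\<^sub>R (x *s v)" for r x
    by (simp add: vec_eq_iff)
qed

lemma bounded_linear_cform: "bounded_linear (\<lambda>v :: complex ^ 'n. \<Sum>j\<in>UNIV. c j * v $ j)"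
  by (intro bounded_linear_sum bounded_linear_mult_right[THEN bounded_linear_compose]
      bounded_linear_vec_nth)

lemma holomorphic_Cn_D:
  assumes "holomorphic_Cn h U" "z \<in> U"
  shows "(h has_derivative (\<lambda>v. \<Sum>j\<in>UNIV. pd j h z * v $ j)) (at z)"
proof -
  obtain h' where h': "(h has_derivative h') (at z)" "\<And>c v. h' (c *s v) = c * h' v"
    using assms unfolding holomorphic_Cn_def by blast
  have lin: "linear h'" using has_derivative_linear[OF h'(1)] .
  have *: "h' (axis j 1) = pd j h z" for j
    using frechet_derivative_at[OF h'(1)] by (simp add: pd_def)
  have "h' v = (\<Sum>j\<in>UNIV. pd j h z * v $ j)" for v
  proof -
    have "h' v = h' (\<Sum>j\<in>UNIV. v $ j *s axis j 1)" by (simp add: basis_expansion)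
    also have "\<dots> = (\<Sum>j\<in>UNIV. h' (v $ j *s axis j 1))"
      using linear_sum[OF lin] by simp
    finally show ?thesis by (simp add: h'(2) * mult.commute)
  qed
  then have "h' = (\<lambda>v. \<Sum>j\<in>UNIV. pd j h z * v $ j)" by auto
  with h'(1) show ?thesis by simp
qed

lemma pd_eq:
  assumes "(h has_derivative (\<lambda>v. \<Sum>j\<in>UNIV. c j * v $ j)) (at z)"
  shows "pd j h z = c j"
proof -
  have "pd j h z = (\<Sum>k\<in>UNIV. c k * (axis j 1 :: complex ^ _) $ k)"
    unfolding pd_def by (rule fun_cong[OF frechet_derivative_at[OF assms], symmetric])
  also have "\<dots> = (\<Sum>k\<in>UNIV. if k = j then c k else 0)"
    by (intro sum.cong) (auto simp: axis_def)
  finally show ?thesis by simp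
qed

lemma holomorphic_CnI:
  assumes "\<And>z. z \<in> U \<Longrightarrow> (h has_derivative (\<lambda>v. \<Sum>j\<in>UNIV. c z j * v $ j)) (at z)"
  shows "holomorphic_Cn h U"
  unfolding holomorphic_Cn_def
proof (intro ballI exI conjI)
  show "(h has_derivative (\<lambda>v. \<Sum>j\<in>UNIV. c z j * v $ j)) (at z)" if "z \<in> U" for z
    using assms that .
qed (simp add: sum_distrib_left algebra_simps)

lemma pd_diff_const:
  assumes "holomorphic_Cn h U" "z \<in> U"
  shows "pd j (\<lambda>z. h z - c) z = pd j h z"
proof (rule pd_eq)
  show "((\<lambda>z. h z - c) has_derivative (\<lambda>v. \<Sum>j\<in>UNIV. pd j h z * v $ j)) (at z)"
    using has_derivative_diff[OF holomorphic_Cn_D[OF assms] has_derivative_const[of c]] by simp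
qed

lemma holomorphic_Cn_continuous_on: "holomorphic_Cn h U \<Longrightarrow> continuous_on U h"
  by (meson continuous_at_imp_continuous_on has_derivative_continuous holomorphic_Cn_D)

lemma holomorphic_Cn_subset: "holomorphic_Cn h U \<Longrightarrow> V \<subseteq> U \<Longrightarrow> holomorphic_Cn h V"
  by (auto simp: holomorphic_Cn_def)

lemma holomorphic_Cn_const [simp]: "holomorphic_Cn (\<lambda>z. c) U"
  by (rule holomorphic_CnI[where c = "\<lambda>_ _. 0"]) simp

lemma holomorphic_Cn_coord: "holomorphic_Cn (\<lambda>z. z $ i) U"
proof (rule holomorphic_CnI[where c = "\<lambda>_ j. if j = i then 1 else 0"])
  have "((\<lambda>z. z $ i) has_derivative (\<lambda>v. v $ i)) (at z)" for z :: "complex ^ 'a"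
    by (rule bounded_linear_imp_has_derivative) (rule bounded_linear_vec_nth)
  moreover have "(\<Sum>j\<in>UNIV. (if j = i then 1 else 0) * v $ j) = v $ i" for v :: "complex ^ 'a"
    by (simp add: if_distrib[of "\<lambda>x. x * _"] cong: if_cong)
  ultimately show "((\<lambda>z. z $ i) has_derivative (\<lambda>v. \<Sum>j\<in>UNIV. (if j = i then 1 else 0) * v $ j)) (at z)"
    for z :: "complex ^ 'a" by simp
qed

lemma holomorphic_Cn_add:
  assumes "holomorphic_Cn g U" "holomorphic_Cn h U"
  shows "holomorphic_Cn (\<lambda>z. g z + h z) U"
proof (rule holomorphic_CnI)
  fix z assume "z \<in> U"
  from has_derivative_add[OF assms[THEN holomorphic_Cn_D, OF this]]
  show "((\<lambda>z. g z + h z) has_derivative (\<lambda>v. \<Sum>j\<in>UNIV. (pd j g z + pd j h z) * v $ j)) (at z)"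
    by (simp add: sum.distrib distrib_right)
qed

lemma has_derivative_mult_Cn:
  assumes "holomorphic_Cn g U" "holomorphic_Cn h U" "z \<in> U"
  shows "((\<lambda>z. g z * h z) has_derivative
     (\<lambda>v. \<Sum>j\<in>UNIV. (g z * pd j h z + pd j g z * h z) * v $ j)) (at z)"
  using has_derivative_mult[OF assms(1,2)[THEN holomorphic_Cn_D, OF assms(3)]]
  by (simp add: sum.distrib algebra_simps sum_distrib_left sum_distrib_right)

lemma holomorphic_Cn_mult:
  assumes "holomorphic_Cn g U" "holomorphic_Cn h U"
  shows "holomorphic_Cn (\<lambda>z. g z * h z) U"
  by (rule holomorphic_CnI, rule has_derivative_mult_Cn[OF assms])

lemma holomorphic_Cn_power: "holomorphic_Cn h U \<Longrightarrow> holomorphic_Cn (\<lambda>z. h z ^ m) U"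
  by (induction m) (auto intro: holomorphic_Cn_mult)

lemma holomorphic_Cn_uminus: "holomorphic_Cn h U \<Longrightarrow> holomorphic_Cn (\<lambda>z. - h z) U"
  using holomorphic_Cn_mult[OF holomorphic_Cn_const[of "-1"], of h U] by simp

lemma holomorphic_Cn_diff:
  "holomorphic_Cn g U \<Longrightarrow> holomorphic_Cn h U \<Longrightarrow> holomorphic_Cn (\<lambda>z. g z - h z) U"
  using holomorphic_Cn_add[OF _ holomorphic_Cn_uminus, of g U h] by simp

lemma holomorphic_Cn_sum:
  "(\<And>i. i \<in> I \<Longrightarrow> holomorphic_Cn (h i) U) \<Longrightarrow> holomorphic_Cn (\<lambda>z. \<Sum>i\<in>I. h i z) U"
  by (induction I rule: infinite_finite_induct) (auto intro: holomorphic_Cn_add)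

lemma holomorphic_Cn_prod:
  "(\<And>i. i \<in> I \<Longrightarrow> holomorphic_Cn (h i) U) \<Longrightarrow> holomorphic_Cn (\<lambda>z. \<Prod>i\<in>I. h i z) U"
  by (induction I rule: infinite_finite_induct) (auto intro: holomorphic_Cn_mult)

lemma holomorphic_Cn_cong:
  assumes "open U" "\<And>z. z \<in> U \<Longrightarrow> g z = h z" "holomorphic_Cn g U"
  shows "holomorphic_Cn h U"
proof (rule holomorphic_CnI)
  fix z assume "z \<in> U"
  show "(h has_derivative (\<lambda>v. \<Sum>j\<in>UNIV. pd j g z * v $ j)) (at z)"
    by (rule has_derivative_transform_within_open[OF holomorphic_Cn_D[OF assms(3) \<open>z \<in> U\<close>]
        \<open>open U\<close> \<open>z \<in> U\<close>]) (use assms(2) in auto)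
qed

lemma slice_has_field_derivative:
  assumes "holomorphic_Cn h U" "z + t *s v \<in> U"
  shows "((\<lambda>t. h (z + t *s v)) has_field_derivative (\<Sum>j\<in>UNIV. pd j h (z + t *s v) * v $ j)) (at t)"
proof -
  have "((\<lambda>t. z + t *s v) has_derivative (\<lambda>s. s *s v)) (at t)"
    by (auto intro!: derivative_eq_intros bounded_linear_imp_has_derivative bounded_linear_scal)
  from has_derivative_compose[OF this holomorphic_Cn_D[OF assms]]
  show ?thesis
    unfolding has_field_derivative_def
    by (rule has_derivative_eq_rhs) (simp add: fun_eq_iff sum_distrib_left sum_distrib_right mult_ac)
qed

lemma open_slice: "open U \<Longrightarrow> open {t. z + t *s (v :: complex ^ 'n) \<in> U}"
proof -
  assume "open U"
  have "continuous_on UNIV (\<lambda>t. z + t *s v)"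
    by (intro continuous_intros linear_continuous_on bounded_linear_scal)
  from open_vimage[OF \<open>open U\<close> this] show ?thesis by (simp add: vimage_def)
qed

lemma holomorphic_slice:
  assumes "holomorphic_Cn h U" "\<And>t. t \<in> A \<Longrightarrow> z + t *s v \<in> U"
  shows "(\<lambda>t. h (z + t *s v)) holomorphic_on A"
  unfolding holomorphic_on_def field_differentiable_def
  using slice_has_field_derivative[OF assms(1)] assms(2) has_field_derivative_at_within by blast

section \<open>Cauchy integrals and regularity of the partial derivatives\<close>

text \<open>The factor beside \<open>h\<close> when Cauchy's formula for the first derivative at 0,
  over the circle of radius \<open>r\<close>, is written as an integral over the parameter interval
  [0, 1].\<close>

definition cauchy_kernel :: "real \<Rightarrow> real \<Rightarrow> complex" where
  "cauchy_kernel r x = vector_derivative (circlepath 0 r) (at x) / (2 * pi * \<i> * (circlepath 0 r x)\<^sup>2)"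

lemma circlepath_nz: "r > 0 \<Longrightarrow> circlepath 0 r x \<noteq> 0"
  by (simp add: circlepath_def part_circlepath_def)

lemma norm_circlepath0: "r > 0 \<Longrightarrow> norm (circlepath 0 r x) = r"
  by (simp add: circlepath norm_mult)

lemma continuous_on_circlepath: "continuous_on A (circlepath z r)"
  unfolding circlepath by (intro continuous_intros)

lemma continuous_on_cauchy_kernel: "r > 0 \<Longrightarrow> continuous_on A (cauchy_kernel r)"
  unfolding cauchy_kernel_def vector_derivative_circlepath
  using circlepath_nz by (intro continuous_intros continuous_on_circlepath) auto

text \<open>\<open>holomorphic_Cn\<close> asks only for pointwise differentiability. Cauchy's
  formula on the slice in direction \<open>j\<close> writes the partial derivative as an integral of
  the continuous function \<open>h\<close>, and all further regularity is read off from this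
  integral.\<close>

lemma pd_has_integral:
  assumes h: "holomorphic_Cn h U" and U: "open U" and r: "r > 0" "cball z r \<subseteq> U"
  shows "((\<lambda>x. h (z + circlepath 0 r x *s axis j 1) * cauchy_kernel r x) has_integral pd j h z) (cbox 0 1)"
proof -
  define \<phi> where "\<phi> t = h (z + t *s axis j 1)" for t
  have in_U: "z + t *s axis j 1 \<in> U" if "t \<in> cball 0 r" for t
    using that r(2) by (auto simp: dist_norm intro!: subsetD[OF r(2)])
  have hol: "\<phi> holomorphic_on cball 0 r"
    unfolding \<phi>_def by (rule holomorphic_slice[OF h in_U])
  have "((\<lambda>u. \<phi> u / (u - 0)\<^sup>2) has_contour_integral (2 * pi * \<i>) * deriv \<phi> 0) (circlepath 0 r)"
    using Cauchy_has_contour_integral_higher_derivative_circlepath[of 0 r \<phi> 0 1] hol r(1)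
    by (simp add: holomorphic_on_imp_continuous_on holomorphic_on_subset[OF _ ball_subset_cball] power2_eq_square)
  then have *: "((\<lambda>x. \<phi> (circlepath 0 r x) / (circlepath 0 r x)\<^sup>2 * vector_derivative (circlepath 0 r) (at x))
     has_integral (2 * pi * \<i>) * deriv \<phi> 0) (cbox 0 1)"
    by (simp add: has_contour_integral)
  have "deriv \<phi> 0 = pd j h z"
  proof -
    have "z + 0 *s axis j 1 \<in> U" using in_U[of 0] r(1) by simp
    from slice_has_field_derivative[OF h this] have "deriv \<phi> 0 = (\<Sum>k\<in>UNIV. pd k h z * axis j 1 $ k)"
      unfolding \<phi>_def by (simp add: DERIV_imp_deriv)
    also have "\<dots> = (\<Sum>k\<in>UNIV. if k = j then pd k h z else 0)"
      by (intro sum.cong) (auto simp: axis_def)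
    finally show ?thesis by simp
  qed
  with has_integral_mult_right[OF *, of "1 / (2 * pi * \<i>)"] show ?thesis
    by (simp add: \<phi>_def cauchy_kernel_def field_simps)
qed

lemma continuous_on_shift_circle:
  assumes "continuous_on U g" "ball z0 r \<subseteq> W" "\<And>z x. z \<in> W \<Longrightarrow> z + circlepath 0 r x *s axis j 1 \<in> U"
    "r > 0"
  shows "continuous_on (W \<times> cbox 0 1)
    (\<lambda>(z, x). g (z + circlepath 0 r x *s axis j 1) * cauchy_kernel r x)"
proof -
  have 1: "continuous_on (W \<times> cbox 0 1) (\<lambda>p. fst p + circlepath 0 r (snd p) *s (axis j 1 :: complex ^ _))"
    by (intro continuous_on_add continuous_on_fst continuous_on_id
        bounded_linear.continuous_on[OF bounded_linear_scal]
        continuous_on_compose2[OF continuous_on_circlepath continuous_on_snd[OF continuous_on_id]]) auto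
  have 2: "continuous_on (W \<times> cbox 0 1) (\<lambda>p :: _ \<times> real. cauchy_kernel r (snd p))"
    by (rule continuous_on_compose2[OF continuous_on_cauchy_kernel[OF assms(4), of UNIV]
          continuous_on_snd[OF continuous_on_id]]) simp
  show ?thesis
    unfolding split_beta
    by (intro continuous_on_mult continuous_on_compose2[OF assms(1) 1] 2) (use assms(3) in auto)
qed

text \<open>The doubled radius leaves room for circles of radius \<open>r\<close> about every centre
  in \<open>ball z0 r\<close>, so one contour serves a whole neighbourhood.\<close>

lemma shift_circle_in:
  assumes "cball z0 (2 * r) \<subseteq> U" "r > 0" "z \<in> ball z0 r"
  shows "z + circlepath 0 r x *s axis j 1 \<in> U" "cball z r \<subseteq> U"
proof -
  have *: "cball z r \<subseteq> cball z0 (2 * r)"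
    using assms(3) by (simp add: cball_subset_cball_iff dist_commute)
  then show "cball z r \<subseteq> U" using assms(1) by blast
  moreover have "z + circlepath 0 r x *s axis j 1 \<in> cball z r"
    using assms(2) by (simp add: dist_norm norm_circlepath0)
  ultimately show "z + circlepath 0 r x *s axis j 1 \<in> U" by blast
qed

lemma obtain_double_cball:
  assumes "open U" "z \<in> U"
  obtains r where "r > 0" "cball z (2 * r) \<subseteq> (U :: 'a::metric_space set)"
proof -
  obtain e where "e > 0" "cball z e \<subseteq> U" using assms open_contains_cball[of U] by blast
  then show ?thesis using that[of "e / 2"] by simp
qed

lemma pd_continuous_on:
  assumes h: "holomorphic_Cn h U" and U: "open U"
  shows "continuous_on U (pd j h)"
proof (rule continuous_at_imp_continuous_on, rule ballI)
  fix z0 assume "z0 \<in> U"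
  then obtain r where r: "r > 0" "cball z0 (2 * r) \<subseteq> U" by (rule obtain_double_cball[OF U])
  let ?I = "\<lambda>z. integral (cbox 0 1) (\<lambda>x. h (z + circlepath 0 r x *s axis j 1) * cauchy_kernel r x)"
  have "continuous_on (ball z0 r) ?I"
    using continuous_on_shift_circle[OF holomorphic_Cn_continuous_on[OF h] order_refl shift_circle_in(1)[OF r(2,1)] r(1)]
    by (rule integral_continuous_on_param)
  moreover have "?I z = pd j h z" if "z \<in> ball z0 r" for z
    using pd_has_integral[OF h U r(1) shift_circle_in(2)[OF r(2,1) that]] by (rule integral_unique)
  ultimately have "continuous_on (ball z0 r) (pd j h)"
    by (rule continuous_on_eq)
  then show "isCont (pd j h) z0"
    using r(1) by (simp add: continuous_on_eq_continuous_at)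
qed

text \<open>Differentiation under the integral sign, possible because the first partials are already
  known to be continuous. The coefficients come out as Cauchy integrals of \<open>pd l h\<close>,
  which gives complex linearity at once and later identifies them as mixed partials.\<close>

lemma pd_derivative_integral:
  assumes h: "holomorphic_Cn h U" and U: "open U" and r: "r > 0" "cball z0 (2 * r) \<subseteq> U"
  shows "(pd j h has_derivative (\<lambda>v. \<Sum>l\<in>UNIV.
      integral (cbox 0 1) (\<lambda>x. pd l h (z0 + circlepath 0 r x *s axis j 1) * cauchy_kernel r x) * v $ l)) (at z0)"
proof -
  let ?B = "ball z0 r"
  let ?s = "\<lambda>z x. z + circlepath 0 r x *s (axis j 1 :: complex ^ _)"
  let ?I = "\<lambda>z. integral (cbox 0 1) (\<lambda>x. h (?s z x) * cauchy_kernel r x)"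
  define fx where "fx z x = Blinfun (\<lambda>v. \<Sum>l\<in>UNIV. (pd l h (?s z x) * cauchy_kernel r x) * v $ l)" for z x
  have fx: "blinfun_apply (fx z x) = (\<lambda>v. \<Sum>l\<in>UNIV. (pd l h (?s z x) * cauchy_kernel r x) * v $ l)" for z x
    unfolding fx_def by (rule bounded_linear_Blinfun_apply[OF bounded_linear_cform])
  have inU: "?s z x \<in> U" if "z \<in> ?B" for z x
    by (rule shift_circle_in(1)[OF r(2,1) that])
  have contp: "continuous_on (?B \<times> cbox 0 1) (\<lambda>(z, x). pd l h (?s z x) * cauchy_kernel r x)" for l
    by (rule continuous_on_shift_circle[OF pd_continuous_on[OF h U] order_refl inU r(1)])
  have conth: "continuous_on (?B \<times> cbox 0 1) (\<lambda>(z, x). h (?s z x) * cauchy_kernel r x)"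
    by (rule continuous_on_shift_circle[OF holomorphic_Cn_continuous_on[OF h] order_refl inU r(1)])
  have z0: "z0 \<in> ?B" using r(1) by simp
  have contp0: "continuous_on (cbox 0 1) (\<lambda>x. pd l h (?s z0 x) * cauchy_kernel r x)" for l
    using continuous_on_compose2[OF contp[of l], where f = "Pair z0" and s = "cbox 0 1"] z0
    by (simp add: image_subset_iff continuous_on_Pair)
  have intp: "(\<lambda>x. pd l h (?s z0 x) * cauchy_kernel r x) integrable_on cbox 0 1" for l
    by (rule integrable_continuous[OF contp0])
  have "(?I has_derivative integral (cbox 0 1) (fx z0)) (at z0 within ?B)"
  proof (rule leibniz_rule[where U = ?B])
    fix z x assume "z \<in> ?B" "x \<in> cbox 0 (1::real)"
    have "((\<lambda>z. ?s z x) has_derivative (\<lambda>v. v)) (at z)"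
      by (auto intro!: derivative_eq_intros)
    from has_derivative_mult_left[OF has_derivative_compose[OF this holomorphic_Cn_D[OF h inU[OF \<open>z \<in> ?B\<close>]]],
        of "cauchy_kernel r x"]
    show "((\<lambda>z. h (?s z x) * cauchy_kernel r x) has_derivative blinfun_apply (fx z x)) (at z within ?B)"
      unfolding fx by (simp add: sum_distrib_left sum_distrib_right mult_ac has_derivative_at_withinI)
  next
    fix z assume "z \<in> ?B"
    then show "(\<lambda>x. h (?s z x) * cauchy_kernel r x) integrable_on cbox 0 1"
      using continuous_on_compose2[OF conth, where f = "Pair z" and s = "cbox 0 1"]
      by (intro integrable_continuous) (simp add: image_subset_iff continuous_on_Pair)
  next
    show "continuous_on (?B \<times> cbox 0 1) (\<lambda>(z, x). fx z x)"
      unfolding split_beta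
  proof (rule continuous_on_blinfun_componentwise)
    fix i :: "complex ^ 'a"
    have "continuous_on (?B \<times> cbox 0 1) (\<lambda>p. pd l h (?s (fst p) (snd p)) * cauchy_kernel r (snd p))" for l
      using contp[of l] by (simp add: split_beta)
    then show "continuous_on (?B \<times> cbox 0 1) (\<lambda>p. blinfun_apply (fx (fst p) (snd p)) i)"
      unfolding fx by (intro continuous_on_sum continuous_on_mult_right) auto
  qed
  qed (use r z0 in auto)
  then have 1: "(?I has_derivative integral (cbox 0 1) (fx z0)) (at z0)"
    using z0 by (simp add: at_within_open[OF _ open_ball])
  have cfx: "continuous_on (cbox 0 1) (fx z0)"
    by (rule continuous_on_blinfun_componentwise)
      (auto simp only: fx intro!: continuous_on_sum continuous_on_mult_right contp0)
  have "blinfun_apply (integral (cbox 0 1) (fx z0)) v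
      = (\<Sum>l\<in>UNIV. integral (cbox 0 1) (\<lambda>x. pd l h (?s z0 x) * cauchy_kernel r x) * v $ l)" for v
  proof -
    have "blinfun_apply (integral (cbox 0 1) (fx z0)) v = integral (cbox 0 1) (\<lambda>x. fx z0 x v)"
      by (rule blinfun_apply_integral[OF integrable_continuous[OF cfx]])
    also have "\<dots> = (\<Sum>l\<in>UNIV. integral (cbox 0 1) (\<lambda>x. (pd l h (?s z0 x) * cauchy_kernel r x) * v $ l))"
      unfolding fx by (rule integral_sum[OF _ integrable_on_mult_left[OF intp]]) simp
    finally show ?thesis by (simp add: integral_mult_left)
  qed
  then have 2: "(?I has_derivative (\<lambda>v. \<Sum>l\<in>UNIV.
      integral (cbox 0 1) (\<lambda>x. pd l h (?s z0 x) * cauchy_kernel r x) * v $ l)) (at z0)"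
    using 1 by (metis (no_types, lifting) ext)
  show ?thesis
  proof (rule has_derivative_transform_within_open[OF 2 open_ball z0])
    show "?I z = pd j h z" if "z \<in> ?B" for z
      using pd_has_integral[OF h U r(1) shift_circle_in(2)[OF r(2,1) that]] by (rule integral_unique)
  qed
qed

lemma pd_holomorphic:
  assumes h: "holomorphic_Cn h U" and U: "open U"
  shows "holomorphic_Cn (pd j h) U"
  unfolding holomorphic_Cn_def
proof
  fix z assume "z \<in> U"
  then obtain r where r: "r > 0" "cball z (2 * r) \<subseteq> U" by (rule obtain_double_cball[OF U])
  from pd_derivative_integral[OF h U this]
  show "\<exists>h'. (pd j h has_derivative h') (at z) \<and> (\<forall>c v. h' (c *s v) = c * h' v)"
    by (intro exI conjI, assumption) (simp add: sum_distrib_left mult_ac)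
qed

text \<open>By the derivative formula the left side is the Cauchy integral of \<open>pd l h\<close>
  in direction \<open>j\<close>; Cauchy's formula for the holomorphic function \<open>pd l h\<close>
  evaluates it to the right side.\<close>

lemma pd_commute:
  assumes h: "holomorphic_Cn h U" and U: "open U" and "z \<in> U"
  shows "pd l (pd j h) z = pd j (pd l h) z"
proof -
  obtain r where r: "r > 0" "cball z (2 * r) \<subseteq> U" using \<open>z \<in> U\<close> by (rule obtain_double_cball[OF U])
  have "cball z r \<subseteq> U" using shift_circle_in(2)[OF r(2,1), of z] r(1) by simp
  from pd_eq[OF pd_derivative_integral[OF h U r], of l]
    integral_unique[OF pd_has_integral[OF pd_holomorphic[OF h U] U r(1) this]]
  show ?thesis by simp
qed


section \<open>Identity theorem and continuation across zero sets\<close>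

text \<open>On the complex line through both points \<open>g\<close> is a function of one variable,
  nonzero at parameter 1, so its zeros are countable. An open connected planar set stays connected
  after removing countably many points; this is how zero sets in several variables are
  bypassed.\<close>

lemma line_countable_zeros:
  assumes B: "open B" "convex B" and g: "holomorphic_Cn g B"
    and z: "z1 \<in> B" "z2 \<in> B" "g z2 \<noteq> 0"
  defines "A \<equiv> {t. z1 + t *s (z2 - z1) \<in> B}"
  shows "open A" "connected A" "countable {t \<in> A. g (z1 + t *s (z2 - z1)) = 0}"
proof -
  show "open A" unfolding A_def by (rule open_slice[OF B(1)])
  have "convex ((\<lambda>t. t *s (z2 - z1)) -` ((+) (- z1) ` B))"
    by (intro convex_linear_vimage convex_translation B bounded_linear.linear[OF bounded_linear_scal])
  also have "(\<lambda>t. t *s (z2 - z1)) -` ((+) (- z1) ` B) = A"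
    by (force simp: A_def image_iff algebra_simps)
  finally show "connected A" by (rule convex_connected)
  have hol: "(\<lambda>t. g (z1 + t *s (z2 - z1))) holomorphic_on A"
    by (rule holomorphic_slice[OF g]) (simp add: A_def)
  have fs: "fsigma A"
    unfolding fsigma_Union_compact
  proof (rule open_Union_compact_subsets[OF \<open>open A\<close>])
    fix C :: "nat \<Rightarrow> complex set"
    assume "\<And>n. compact (C n)" "\<Union>(range C) = A"
    then have "range C \<subseteq> Collect compact \<and> A = \<Union>(range C)" by auto
    then show "\<exists>F::nat \<Rightarrow> complex set. range F \<subseteq> Collect compact \<and> A = \<Union>(range F)"
      by (rule exI[of _ C])
  qed
  show "countable {t \<in> A. g (z1 + t *s (z2 - z1)) = 0}"
  proof (cases "(\<lambda>t. g (z1 + t *s (z2 - z1))) constant_on A")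
    case True
    have "1 \<in> A" using z by (simp add: A_def)
    moreover have "g (z1 + 1 *s (z2 - z1)) \<noteq> 0" using z by simp
    ultimately have "g (z1 + t *s (z2 - z1)) \<noteq> 0" if "t \<in> A" for t
      using True that unfolding constant_on_def by force
    then have "{t \<in> A. g (z1 + t *s (z2 - z1)) = 0} = {}" by blast
    then show ?thesis by (simp only: countable_empty)
  next
    case False
    then show ?thesis
      by (rule holomorphic_countable_zeros[OF hol \<open>open A\<close> \<open>connected A\<close> fs])
  qed
qed

text \<open>The interior \<open>Z\<close> of the zero set is relatively closed: a ball meeting
  \<open>Z\<close> lies in \<open>Z\<close>, because on the line from a point of \<open>Z\<close> to
  a point with nonzero value the zeros would contain a disc and yet be countable.\<close>

lemma identity_theorem_Cn:
  assumes D: "open D" "connected D" and g: "holomorphic_Cn g D"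
    and W: "open W" "W \<noteq> {}" "W \<subseteq> D" "\<And>z. z \<in> W \<Longrightarrow> g z = 0" and "z \<in> D"
  shows "g z = 0"
proof -
  define Z where "Z = interior {z \<in> D. g z = 0}"
  have step: "ball z0 r \<subseteq> Z" if r: "ball z0 r \<subseteq> D" "z1 \<in> Z" "z1 \<in> ball z0 r" for z0 z1 r
  proof -
    have "g z = 0" if z: "z \<in> ball z0 r" for z
    proof (rule ccontr)
      assume nz: "g z \<noteq> 0"
      let ?B = "ball z0 r" let ?l = "\<lambda>t. z1 + t *s (z - z1)"
      have g': "holomorphic_Cn g ?B" using g r(1) by (rule holomorphic_Cn_subset)
      note L = line_countable_zeros[OF open_ball convex_ball g' r(3) z nz]
      have "open (Z \<inter> ?B)" by (simp add: Z_def open_Int)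
      then have "open {t. ?l t \<in> Z \<inter> ?B}" by (rule open_slice)
      moreover have "0 \<in> {t. ?l t \<in> Z \<inter> ?B}" using r by simp
      ultimately obtain e where e: "e > 0" "ball 0 e \<subseteq> {t. ?l t \<in> Z \<inter> ?B}"
        by (rule openE)
      have "{t. ?l t \<in> Z \<inter> ?B} \<subseteq> {t \<in> {t. ?l t \<in> ?B}. g (?l t) = 0}"
        using interior_subset[of "{z \<in> D. g z = 0}"] by (auto simp: Z_def)
      with e(2) have "ball 0 e \<subseteq> {t \<in> {t. ?l t \<in> ?B}. g (?l t) = 0}" by (rule order_trans)
      from countable_subset[OF this L(3)] show False
        using uncountable_ball[OF e(1), of "0::complex"] by blast
    qed
    then show ?thesis
      unfolding Z_def by (intro interior_maximal) (use r(1) in auto)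
  qed
  have "Z \<noteq> {}"
  proof -
    have "W \<subseteq> Z" unfolding Z_def by (rule interior_maximal) (use W in auto)
    then show ?thesis using W by blast
  qed
  have "open (D - Z)"
    unfolding open_contains_ball
  proof
    fix z0 assume z0: "z0 \<in> D - Z"
    have "z0 \<in> D" using z0 by blast
    then obtain r where r: "r > 0" "ball z0 r \<subseteq> D" by (rule openE[OF D(1)])
    have "ball z0 r \<inter> Z = {}"
    proof (rule ccontr)
      assume "ball z0 r \<inter> Z \<noteq> {}"
      then obtain z1 where "z1 \<in> Z" "z1 \<in> ball z0 r" by blast
      from step[OF r(2) this] centre_in_ball[of z0 r] r(1) z0 show False by blast
    qed
    then have "ball z0 r \<subseteq> D - Z" using r(2) by blast
    then show "\<exists>e>0. ball z0 e \<subseteq> D - Z" using r(1) by blast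
  qed
  moreover have Z: "open Z" "Z \<subseteq> D" using interior_subset[of "{z \<in> D. g z = 0}"] by (auto simp: Z_def)
  ultimately have "Z \<inter> D = {} \<or> (D - Z) \<inter> D = {}"
    by (intro connectedD[OF D(2)]) auto
  then have "D - Z = {}" using \<open>Z \<noteq> {}\<close> Z(2) by blast
  then show ?thesis using \<open>z \<in> D\<close> interior_subset[of "{z \<in> D. g z = 0}"] by (auto simp: Z_def)
qed

lemma exists_nonzero_in_open:
  fixes D W :: "(complex ^ 'n) set"
  assumes D: "open D" "connected D" and g: "holomorphic_Cn g D" and nz: "z0 \<in> D" "g z0 \<noteq> 0"
    and W: "open W" "W \<noteq> {}" "W \<subseteq> D"
  shows "\<exists>z\<in>W. g z \<noteq> 0"
proof (rule ccontr)
  assume "\<not> ?thesis"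
  then have "\<And>z. z \<in> W \<Longrightarrow> g z = 0" by blast
  then have "g z0 = 0"
    using D g W nz(1) by (intro identity_theorem_Cn[of D g W z0])
  then show False using nz(2) by contradiction
qed

text \<open>The zero set of \<open>g\<close> does not disconnect \<open>D\<close>. Inside a ball two
  points off the zeros are joined along their complex line minus countably many parameters; the
  values found on balls are then glued over the connected set \<open>D\<close>.\<close>

lemma locally_const_off_zeros:
  assumes D: "open D" "connected D" and g: "holomorphic_Cn g D"
    and loc: "\<And>z. z \<in> D \<Longrightarrow> g z \<noteq> 0 \<Longrightarrow> \<exists>e>0. \<forall>y\<in>ball z e. c y = c z"
    and a: "a \<in> D" "g a \<noteq> 0" and b: "b \<in> D" "g b \<noteq> 0"
  shows "c a = c b"
proof -
  have on_ball: "c z1 = c z2"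
    if B: "ball z0 r \<subseteq> D" and z: "z1 \<in> ball z0 r" "z2 \<in> ball z0 r" "g z1 \<noteq> 0" "g z2 \<noteq> 0" for z0 r z1 z2
  proof -
    let ?B = "ball z0 r" let ?l = "\<lambda>t. z1 + t *s (z2 - z1)"
    have g': "holomorphic_Cn g ?B" using g B by (rule holomorphic_Cn_subset)
    note L = line_countable_zeros[OF open_ball convex_ball g' z(1,2,4)]
    let ?A = "{t. ?l t \<in> ?B} - {t \<in> {t. ?l t \<in> ?B}. g (?l t) = 0}"
    have "connected ?A"
      by (rule connected_open_diff_countable[OF _ L]) simp
    moreover have "0 \<in> ?A" "1 \<in> ?A" using z by simp_all
    moreover have "\<forall>t\<in>?A. \<forall>\<^sub>F s in at t within ?A. c (?l t) = c (?l s)"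
    proof
      fix t assume t: "t \<in> ?A"
      then have "?l t \<in> D" "g (?l t) \<noteq> 0" using B by blast+
      from loc[OF this] obtain e where e: "e > 0" "\<forall>y\<in>ball (?l t) e. c y = c (?l t)" by blast
      have "\<forall>\<^sub>F s in nhds t. s \<in> {s. ?l s \<in> ball (?l t) e}"
        by (rule eventually_nhds_in_open[OF open_slice[OF open_ball]]) (use e in simp)
      then show "\<forall>\<^sub>F s in at t within ?A. c (?l t) = c (?l s)"
        unfolding eventually_at_filter
      proof eventually_elim
        case (elim s)
        then have "c (?l s) = c (?l t)" using e(2) by blast
        then show ?case by simp
      qed
    qed
    ultimately have "c (?l 0) = c (?l 1)"
      by (rule connected_local_const[where f = "\<lambda>t. c (?l t)"])
    then show ?thesis by simp
  qed
  \<comment> \<open>\<open>R z v\<close> says that \<open>v\<close> is the value of \<open>c\<close>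
    near \<open>z\<close> off the zeros. Such a value exists by \<open>on_ball\<close> and is unique
    because the zeros have no interior, so it extends \<open>c\<close> to a locally constant
    function on all of \<open>D\<close>.\<close>
  define R where "R z v \<longleftrightarrow> (\<exists>e>0. ball z e \<subseteq> D \<and> (\<forall>y\<in>ball z e. g y \<noteq> 0 \<longrightarrow> c y = v))" for z v
  have ex_nz: "\<exists>y\<in>W. g y \<noteq> 0" if "open W" "W \<noteq> {}" "W \<subseteq> D" for W
    by (rule exists_nonzero_in_open[OF D g a that])
  have ex: "\<exists>v. R z v" if zD: "z \<in> D" for z
  proof -
    obtain e where e: "e > 0" "ball z e \<subseteq> D" by (rule openE[OF D(1) zD])
    then obtain y where "y \<in> ball z e" "g y \<noteq> 0" using ex_nz[of "ball z e"] by auto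
    then have "\<forall>y'\<in>ball z e. g y' \<noteq> 0 \<longrightarrow> c y' = c y" using on_ball[OF e(2)] by blast
    then show ?thesis unfolding R_def using e by blast
  qed
  have uniq: "v = v'" if R: "R z v" "R z v'" for z v v'
  proof -
    obtain e e' where e: "e > 0" "ball z e \<subseteq> D" "\<forall>y\<in>ball z e. g y \<noteq> 0 \<longrightarrow> c y = v"
      "e' > 0" "ball z e' \<subseteq> D" "\<forall>y\<in>ball z e'. g y \<noteq> 0 \<longrightarrow> c y = v'"
      using R unfolding R_def by blast
    have "z \<in> ball z e \<inter> ball z e'" using e by simp
    then have "ball z e \<inter> ball z e' \<noteq> {}" by blast
    moreover have "open (ball z e \<inter> ball z e')" "ball z e \<inter> ball z e' \<subseteq> D"
      using e by (auto intro: open_Int)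
    ultimately obtain y where "y \<in> ball z e \<inter> ball z e'" "g y \<noteq> 0"
      using ex_nz by meson
    then show ?thesis using e by auto
  qed
  define c' where "c' z = (THE v. R z v)" for z
  have c': "R z (c' z)" if "z \<in> D" for z
    unfolding c'_def by (rule theI') (use ex[OF that] uniq in blast)
  have c'_eq: "c' z = c z" if "z \<in> D" "g z \<noteq> 0" for z
    using c'[OF that(1)] that(2) unfolding R_def by (metis centre_in_ball)
  have "c' a = c' b"
  proof (rule connected_local_const[where f = c', OF D(2) a(1) b(1)], rule ballI)
    fix z assume z: "z \<in> D"
    obtain e where e: "e > 0" "ball z e \<subseteq> D" "\<forall>y\<in>ball z e. g y \<noteq> 0 \<longrightarrow> c y = c' z"
      using c'[OF z] unfolding R_def by blast
    have "c' z = c' y" if y: "y \<in> ball z e" for y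
    proof -
      obtain e' where "e' > 0" "ball y e' \<subseteq> ball z e" by (rule openE[OF open_ball y])
      then have "R y (c' z)" unfolding R_def using e by blast
      then show ?thesis using uniq c' y e(2) by blast
    qed
    then have "\<And>y. y \<in> ball z e \<Longrightarrow> y \<noteq> z \<longrightarrow> y \<in> D \<longrightarrow> c' z = c' y" by blast
    moreover have "\<forall>\<^sub>F y in nhds z. y \<in> ball z e" using e by (intro eventually_nhds_in_open) auto
    ultimately show "\<forall>\<^sub>F y in at z within D. c' z = c' y"
      unfolding eventually_at_filter by (rule eventually_mono[rotated])
  qed
  then show ?thesis using a b c'_eq by simp
qed

section \<open>The Jacobian determinant as a null Lagrangian\<close>

definition C1_on :: "(complex ^ 'n::finite \<Rightarrow> complex) \<Rightarrow> (complex ^ 'n) set \<Rightarrow> bool" where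
  "C1_on u U \<longleftrightarrow> (\<forall>z\<in>U. u differentiable (at z)) \<and>
     (\<forall>v. continuous_on U (\<lambda>z. frechet_derivative u (at z) v))"

text \<open>The Wirtinger derivative in the conjugate of the j-th coordinate;
  \<open>axis j 1\<close> and \<open>axis j \<i>\<close> are the real and imaginary directions of
  that coordinate.\<close>

definition dbar :: "'n::finite \<Rightarrow> (complex ^ 'n \<Rightarrow> complex) \<Rightarrow> complex ^ 'n \<Rightarrow> complex" where
  "dbar j u z = (frechet_derivative u (at z) (axis j 1) + \<i> * frechet_derivative u (at z) (axis j \<i>)) / 2"

lemma dbar_eq:
  assumes "(u has_derivative u') (at z)"
  shows "dbar j u z = (u' (axis j 1) + \<i> * u' (axis j \<i>)) / 2"
  using frechet_derivative_at[OF assms] by (simp add: dbar_def)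

lemma C1_onI:
  assumes "\<And>z. z \<in> U \<Longrightarrow> (u has_derivative D z) (at z)" "\<And>v. continuous_on U (\<lambda>z. D z v)"
  shows "C1_on u U"
  unfolding C1_on_def
proof (intro conjI ballI allI)
  show "u differentiable (at z)" if "z \<in> U" for z
    using assms(1)[OF that] by (rule differentiableI)
  show "continuous_on U (\<lambda>z. frechet_derivative u (at z) v)" for v
    using assms(2)[of v] by (rule continuous_on_eq)
      (use frechet_derivative_at[OF assms(1)] in simp)
qed

lemma C1_on_has_derivative:
  "C1_on u U \<Longrightarrow> z \<in> U \<Longrightarrow> (u has_derivative frechet_derivative u (at z)) (at z)"
  by (simp add: C1_on_def frechet_derivative_works[symmetric])

lemma C1_on_continuous_derivative:
  "C1_on u U \<Longrightarrow> continuous_on U (\<lambda>z. frechet_derivative u (at z) v)"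
  by (simp add: C1_on_def)

lemma C1_on_continuous: "C1_on u U \<Longrightarrow> continuous_on U u"
  by (meson C1_on_has_derivative continuous_at_imp_continuous_on has_derivative_continuous)

lemma C1_on_mult:
  assumes "C1_on u U" "C1_on v U" shows "C1_on (\<lambda>z. u z * v z) U"
proof (rule C1_onI)
  show "((\<lambda>z. u z * v z) has_derivative (\<lambda>h. u z * frechet_derivative v (at z) h
      + frechet_derivative u (at z) h * v z)) (at z)" if "z \<in> U" for z
    by (rule has_derivative_mult[OF assms[THEN C1_on_has_derivative, OF that]])
  show "continuous_on U (\<lambda>z. u z * frechet_derivative v (at z) h + frechet_derivative u (at z) h * v z)" for h
    by (intro continuous_intros assms C1_on_continuous C1_on_continuous_derivative)
qed

lemma dbar_mult:
  assumes "C1_on u U" "C1_on v U" "z \<in> U"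
  shows "dbar j (\<lambda>z. u z * v z) z = u z * dbar j v z + dbar j u z * v z"
  unfolding dbar_eq[OF has_derivative_mult[OF assms(1,2)[THEN C1_on_has_derivative, OF assms(3)]]]
  by (simp add: dbar_def field_simps)

lemma C1_on_add:
  assumes "C1_on u U" "C1_on v U" shows "C1_on (\<lambda>z. u z + v z) U"
proof (rule C1_onI)
  show "((\<lambda>z. u z + v z) has_derivative (\<lambda>h. frechet_derivative u (at z) h
      + frechet_derivative v (at z) h)) (at z)" if "z \<in> U" for z
    by (rule has_derivative_add[OF assms[THEN C1_on_has_derivative, OF that]])
  show "continuous_on U (\<lambda>z. frechet_derivative u (at z) h + frechet_derivative v (at z) h)" for h
    by (intro continuous_intros assms C1_on_continuous_derivative)
qed

lemma dbar_add:
  assumes "C1_on u U" "C1_on v U" "z \<in> U"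
  shows "dbar j (\<lambda>z. u z + v z) z = dbar j u z + dbar j v z"
  unfolding dbar_eq[OF has_derivative_add[OF assms(1,2)[THEN C1_on_has_derivative, OF assms(3)]]]
  by (simp add: dbar_def field_simps)

lemma C1_on_const: "C1_on (\<lambda>z. c) U"
  by (rule C1_onI[where D = "\<lambda>_ _. 0"]) auto

lemma dbar_const [simp]: "dbar j (\<lambda>z. c) z = 0"
  by (simp add: dbar_eq[of _ "\<lambda>_. 0"])

lemma C1_on_sum: "(\<And>i. i \<in> I \<Longrightarrow> C1_on (u i) U) \<Longrightarrow> C1_on (\<lambda>z. \<Sum>i\<in>I. u i z) U"
  by (induction I rule: infinite_finite_induct) (auto intro: C1_on_add C1_on_const)

lemma dbar_sum:
  "(\<And>i. i \<in> I \<Longrightarrow> C1_on (u i) U) \<Longrightarrow> z \<in> U \<Longrightarrow> dbar j (\<lambda>z. \<Sum>i\<in>I. u i z) z = (\<Sum>i\<in>I. dbar j (u i) z)"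
proof (induction I rule: infinite_finite_induct)
  case (insert i I)
  then have "C1_on (u i) U" "C1_on (\<lambda>z. \<Sum>i\<in>I. u i z) U" by (auto intro: C1_on_sum)
  from dbar_add[OF this \<open>z \<in> U\<close>] insert show ?case by simp
qed simp_all

lemma C1_on_prod: "(\<And>i. i \<in> I \<Longrightarrow> C1_on (u i) U) \<Longrightarrow> C1_on (\<lambda>z. \<Prod>i\<in>I. u i z) U"
  by (induction I rule: infinite_finite_induct) (auto intro: C1_on_mult C1_on_const)

lemma dbar_prod:
  assumes "\<And>i. i \<in> I \<Longrightarrow> C1_on (u i) U" "z \<in> U"
  shows "dbar j (\<lambda>z. \<Prod>i\<in>I. u i z) z = (\<Sum>i\<in>I. dbar j (u i) z * (\<Prod>l\<in>I - {i}. u l z))"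
  by (rule trans[OF dbar_eq[OF has_derivative_prod[OF C1_on_has_derivative[OF assms]]]])
    (simp_all add: dbar_def sum_distrib_left sum.distrib[symmetric] sum_divide_distrib algebra_simps)

lemma axis_form: "(\<Sum>l\<in>UNIV. c l * (axis j a :: complex ^ _) $ l) = c j * a"
proof -
  have "(\<Sum>l\<in>UNIV. c l * (axis j a :: complex ^ _) $ l) = (\<Sum>l\<in>UNIV. if l = j then c l * a else 0)"
    by (intro sum.cong) (auto simp: axis_def)
  then show ?thesis by simp
qed

lemma C1_on_holomorphic:
  assumes "holomorphic_Cn h U" "open U" shows "C1_on h U"
  by (rule C1_onI[OF holomorphic_Cn_D[OF assms(1)]])
    (auto intro!: continuous_intros pd_continuous_on[OF assms])

lemma C1_on_cnj_holomorphic: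
  assumes "holomorphic_Cn h U" "open U" shows "C1_on (\<lambda>z. cnj (h z)) U"
  by (rule C1_onI[OF has_derivative_cnj[OF holomorphic_Cn_D[OF assms(1)]]])
    (auto intro!: continuous_intros pd_continuous_on[OF assms])

lemma dbar_holomorphic:
  assumes "holomorphic_Cn h U" "z \<in> U" shows "dbar j h z = 0"
  unfolding dbar_eq[OF holomorphic_Cn_D[OF assms]] axis_form
  by (simp add: mult.left_commute[of \<i>])

lemma dbar_cnj_holomorphic:
  assumes "holomorphic_Cn h U" "z \<in> U" shows "dbar j (\<lambda>z. cnj (h z)) z = cnj (pd j h z)"
  unfolding dbar_eq[OF has_derivative_cnj[OF holomorphic_Cn_D[OF assms]]] axis_form
  by (simp add: mult.left_commute[of \<i>])

text \<open>The chain rule is applied to the real function \<open>p\<close>, while the calculus is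
  set up for complex values. As \<open>p\<close> is real, so are the values of its derivative
  (\<open>im\<close>), and passing through \<open>Re\<close> loses nothing.\<close>

lemma C1_on_real_compose:
  assumes p: "C1_on (\<lambda>z. complex_of_real (p z)) U" and e: "\<And>s. (e has_real_derivative e' s) (at s)"
    and e': "continuous_on UNIV e'"
  shows "C1_on (\<lambda>z. complex_of_real (e (p z))) U"
    and "z \<in> U \<Longrightarrow> dbar j (\<lambda>z. complex_of_real (e (p z))) z
      = complex_of_real (e' (p z)) * dbar j (\<lambda>z. complex_of_real (p z)) z"
proof -
  let ?D = "\<lambda>z. frechet_derivative (\<lambda>z. complex_of_real (p z)) (at z)"
  have D: "((\<lambda>z. complex_of_real (e (p z))) has_derivative (\<lambda>v. complex_of_real (e' (p z)) * ?D z v)) (at z)"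
    and im: "complex_of_real (Re (?D z v)) = ?D z v" if "z \<in> U" for z v
  proof -
    have 1: "(p has_derivative (\<lambda>v. Re (?D z v))) (at z)"
      using has_derivative_Re[OF C1_on_has_derivative[OF p that]] by simp
    have "((\<lambda>z. complex_of_real (p z)) has_derivative (\<lambda>v. complex_of_real (Re (?D z v)))) (at z)"
      by (rule has_derivative_of_real[OF 1])
    from frechet_derivative_at[OF this]
    have eq: "?D z = (\<lambda>v. complex_of_real (Re (?D z v)))" by simp
    show "complex_of_real (Re (?D z v)) = ?D z v" for v using fun_cong[OF eq, of v] by simp
    note im = this
    have "(e has_derivative (\<lambda>x. x * e' (p z))) (at (p z))"
      using e[of "p z"] by (simp add: has_field_derivative_def mult.commute[of _ "e' (p z)"])
    from has_derivative_of_real[OF has_derivative_compose[OF 1 this]]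
    have "((\<lambda>z. complex_of_real (e (p z))) has_derivative
        (\<lambda>v. complex_of_real (Re (?D z v) * e' (p z)))) (at z)" .
    then show "((\<lambda>z. complex_of_real (e (p z))) has_derivative (\<lambda>v. complex_of_real (e' (p z)) * ?D z v)) (at z)"
      by (simp add: im mult.commute)
  qed
  have cp: "continuous_on U p"
    using continuous_on_Re[OF C1_on_continuous[OF p]] by simp
  show "C1_on (\<lambda>z. complex_of_real (e (p z))) U"
    by (rule C1_onI[OF D])
      (auto intro!: continuous_intros C1_on_continuous_derivative[OF p] continuous_on_compose2[OF e' cp])
  show "dbar j (\<lambda>z. complex_of_real (e (p z))) z
      = complex_of_real (e' (p z)) * dbar j (\<lambda>z. complex_of_real (p z)) z" if "z \<in> U"
    unfolding dbar_eq[OF D[OF that]] by (simp add: dbar_def field_simps)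
qed

lemma C1_on_cong:
  assumes "open U" "\<And>z. z \<in> U \<Longrightarrow> u z = v z" "C1_on u U"
  shows "C1_on v U" and "z \<in> U \<Longrightarrow> dbar j v z = dbar j u z"
proof -
  have D: "(v has_derivative frechet_derivative u (at z)) (at z)" if "z \<in> U" for z
    by (rule has_derivative_transform_within_open[OF C1_on_has_derivative[OF assms(3) that] assms(1) that])
      (use assms(2) in auto)
  show "C1_on v U" by (rule C1_onI[OF D]) (auto intro: C1_on_continuous_derivative[OF assms(3)])
  show "dbar j v z = dbar j u z" if "z \<in> U" unfolding dbar_eq[OF D[OF that]] by (simp add: dbar_def)
qed

lemma C1_on_Un: "C1_on u U \<Longrightarrow> C1_on u V \<Longrightarrow> open U \<Longrightarrow> open V \<Longrightarrow> C1_on u (U \<union> V)"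
  by (auto simp: C1_on_def intro: continuous_on_open_Un)

text \<open>\<open>V\<close> and the complement of \<open>Q\<close> are open and cover the space; on
  the second set the extension is identically zero, so regularity holds locally everywhere.\<close>

lemma C1_on_extend:
  assumes V: "open V" and Q: "compact Q" "Q \<subseteq> V" and u: "C1_on u V" "\<And>z. z \<in> V - Q \<Longrightarrow> u z = 0"
  defines "w \<equiv> \<lambda>z. if z \<in> V then u z else 0"
  shows "C1_on w UNIV" and "\<And>z. z \<in> V \<Longrightarrow> dbar j w z = dbar j u z"
    and "\<And>z. z \<notin> Q \<Longrightarrow> w z = 0"
proof -
  have oQ: "open (- Q)" using Q by (simp add: compact_imp_closed open_Compl)
  have 1: "C1_on w V" "\<And>z. z \<in> V \<Longrightarrow> dbar j w z = dbar j u z"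
    using C1_on_cong[OF V _ u(1), of w] by (auto simp: w_def)
  have 2: "C1_on w (- Q)"
    by (rule C1_on_cong[OF oQ _ C1_on_const[of 0]]) (use u(2) in \<open>auto simp: w_def\<close>)
  have "V \<union> - Q = UNIV" using Q by auto
  then show "C1_on w UNIV" using C1_on_Un[OF 1(1) 2 V oQ] by simp
  show "\<And>z. z \<in> V \<Longrightarrow> dbar j w z = dbar j u z" by (rule 1)
  show "\<And>z. z \<notin> Q \<Longrightarrow> w z = 0" using u(2) by (auto simp: w_def)
qed

section \<open>Integration by parts for compactly supported functions\<close>

lemma integrable_compact_support:
  fixes u :: "complex ^ 'n \<Rightarrow> complex"
  assumes "continuous_on UNIV u" "compact Q" "\<And>z. z \<notin> Q \<Longrightarrow> u z = 0"
  shows "integrable lborel u"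
proof -
  have "integrable lborel (\<lambda>z. indicator Q z *\<^sub>R u z)"
    by (rule borel_integrable_compact[OF assms(2) continuous_on_subset[OF assms(1)]]) simp
  moreover have "indicator Q z *\<^sub>R u z = u z" for z
    using assms(3)[of z] by (auto simp: indicator_def)
  ultimately show ?thesis by simp
qed

lemma derivative_zero_off_support:
  fixes u :: "complex ^ 'n \<Rightarrow> complex"
  assumes Q: "compact Q" "\<And>z. z \<notin> Q \<Longrightarrow> u z = (0::complex)" and z: "z \<notin> Q"
  shows "frechet_derivative u (at z) v = 0"
proof -
  have "open (- Q)" using Q(1) by (simp add: compact_imp_closed open_Compl)
  then have "(u has_derivative (\<lambda>_. 0)) (at z)"
    by (rule has_derivative_transform_within_open[OF has_derivative_const, of _ z]) (use Q(2) z in auto)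
  from frechet_derivative_at[OF this] show ?thesis by (metis)
qed

text \<open>Translation invariance of Lebesgue measure makes every difference quotient integrate to
  zero, and dominated convergence passes to the derivative.\<close>

lemma integral_directional_derivative_zero:
  fixes u :: "complex ^ 'n \<Rightarrow> complex"
  assumes u: "C1_on u UNIV" and Q: "compact Q" "\<And>z. z \<notin> Q \<Longrightarrow> u z = 0"
  shows "(LINT z|lborel. frechet_derivative u (at z) v) = 0"
    and "integrable lborel (\<lambda>z. frechet_derivative u (at z) v)"
proof -
  let ?D = "\<lambda>z. frechet_derivative u (at z)"
  have Dz: "?D z v = 0" if "z \<notin> Q" for z
    by (rule derivative_zero_off_support[OF Q that])
  have cD: "continuous_on UNIV (\<lambda>z. ?D z v)" by (rule C1_on_continuous_derivative[OF u])
  show intD: "integrable lborel (\<lambda>z. ?D z v)"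
    by (rule integrable_compact_support[OF cD Q(1) Dz])
  have cu: "continuous_on UNIV u" by (rule C1_on_continuous[OF u])
  have intu: "integrable lborel u" by (rule integrable_compact_support[OF cu Q])
  have meas: "u \<in> borel_measurable borel" by (rule borel_measurable_continuous_onI[OF cu])
  obtain M where M: "\<And>z. z \<in> Q \<Longrightarrow> norm (?D z v) \<le> M" "M \<ge> 0"
  proof -
    have "bounded ((\<lambda>z. ?D z v) ` Q)"
      by (intro compact_imp_bounded compact_continuous_image Q continuous_on_subset[OF cD]) simp
    then obtain b where b: "\<forall>x\<in>(\<lambda>z. ?D z v) ` Q. norm x \<le> b" unfolding bounded_iff by blast
    show ?thesis
      by (rule that[of "max b 0"]) (use b in \<open>auto intro: max.coboundedI1\<close>)
  qed
  have M': "norm (?D z v) \<le> M" for z using M Dz[of z] by (cases "z \<in> Q") auto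
  \<comment> \<open>All translates of \<open>Q\<close> by \<open>- t *\<^sub>R v\<close> with t in
    [0, 1]: one compact set supporting every difference quotient, hence the dominating function
    \<open>M\<close> on \<open>Q'\<close>.\<close>
  define Q' where "Q' = (\<lambda>(q, t). q - t *\<^sub>R v) ` (Q \<times> {0..1::real})"
  have cQ': "compact Q'" unfolding Q'_def split_beta
    by (intro compact_continuous_image compact_Times Q continuous_intros) auto
  have inQ': "z \<in> Q'" if "z + t *\<^sub>R v \<in> Q" "t \<in> {0..1}" for z t
    unfolding Q'_def by (rule image_eqI[of _ _ "(z + t *\<^sub>R v, t)"]) (use that in auto)
  have diff: "norm (u (z + t *\<^sub>R v) - u z) \<le> M * t" if t: "t \<in> {0..1}" for z t
  proof -
    have "norm (u (z + t *\<^sub>R v) - u (z + 0 *\<^sub>R v)) \<le> M * norm (t - 0)"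
    proof (rule differentiable_bound[where f = "\<lambda>t. u (z + t *\<^sub>R v)" and S = UNIV
          and f' = "\<lambda>s h. ?D (z + s *\<^sub>R v) (h *\<^sub>R v)"])
      fix s :: real
      have "((\<lambda>t. z + t *\<^sub>R v) has_derivative (\<lambda>h. h *\<^sub>R v)) (at s)"
        by (auto intro!: derivative_eq_intros)
      from has_derivative_compose[OF this C1_on_has_derivative[OF u]]
      show "((\<lambda>t. u (z + t *\<^sub>R v)) has_derivative (\<lambda>h. ?D (z + s *\<^sub>R v) (h *\<^sub>R v))) (at s within UNIV)"
        by simp
      have lin: "linear (?D (z + s *\<^sub>R v))"
        using C1_on_has_derivative[OF u] has_derivative_linear by blast
      show "onorm (\<lambda>h. ?D (z + s *\<^sub>R v) (h *\<^sub>R v)) \<le> M"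
        by (rule onorm_le) (simp add: linear_cmul[OF lin] mult.commute[of M] mult_left_mono M')
    qed auto
    then show ?thesis using t by simp
  qed
  define s where "s n z = of_nat (Suc n) * (u (z + (1 / real (Suc n)) *\<^sub>R v) - u z)" for n z
  have int_shift: "integrable lborel (\<lambda>z. u (z + c))" "(LINT z|lborel. u (z + c)) = (LINT z|lborel. u z)" for c
  proof -
    have "integrable (distr lborel borel ((+) c)) u" by (subst lborel_distr_plus) (rule intu)
    then show "integrable lborel (\<lambda>z. u (z + c))"
      by (subst (asm) integrable_distr_eq) (auto simp: meas add.commute)
    have "(LINT z|lborel. u z) = integral\<^sup>L (distr lborel borel ((+) c)) u"
      by (subst lborel_distr_plus) simp
    also have "\<dots> = (LINT z|lborel. u (z + c))"
      by (subst integral_distr) (auto simp: meas add.commute)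
    finally show "(LINT z|lborel. u (z + c)) = (LINT z|lborel. u z)" by simp
  qed
  have "(\<lambda>n. LINT z|lborel. s n z) \<longlonglongrightarrow> (LINT z|lborel. ?D z v)"
  proof (rule integral_dominated_convergence[where w = "\<lambda>z. indicator Q' z *\<^sub>R M"])
    show "(\<lambda>z. ?D z v) \<in> borel_measurable lborel" using intD by simp
    show "s n \<in> borel_measurable lborel" for n
      unfolding s_def[abs_def] using int_shift(1)[THEN borel_measurable_integrable] intu[THEN borel_measurable_integrable]
      by measurable
    show "integrable lborel (\<lambda>z. indicator Q' z *\<^sub>R M)"
      by (rule borel_integrable_compact[OF cQ']) auto
    show "AE z in lborel. (\<lambda>n. s n z) \<longlonglongrightarrow> ?D z v"
    proof (rule AE_I2)
      fix z
      have "((\<lambda>t. z + t *\<^sub>R v) has_derivative (\<lambda>h. h *\<^sub>R v)) (at (0::real))"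
        by (auto intro!: derivative_eq_intros)
      from has_derivative_compose[OF this C1_on_has_derivative[OF u]]
      have "((\<lambda>t. u (z + t *\<^sub>R v)) has_derivative (\<lambda>h. ?D (z + 0 *\<^sub>R v) (h *\<^sub>R v))) (at 0)"
        by simp
      moreover have "linear (?D z)"
        using C1_on_has_derivative[OF u] has_derivative_linear by blast
      ultimately have "((\<lambda>t. u (z + t *\<^sub>R v)) has_derivative (\<lambda>h. h *\<^sub>R ?D z v)) (at 0)"
        by (simp add: linear_cmul)
      then have lim: "((\<lambda>h. norm (u (z + h *\<^sub>R v) - u z - h *\<^sub>R ?D z v) / norm h) \<longlongrightarrow> 0) (at 0)"
        by (simp add: has_derivative_at)
      have "filterlim (\<lambda>n. 1 / real (Suc n)) (at 0) sequentially"
        using LIMSEQ_Suc[OF lim_inverse_n'] by (auto simp: filterlim_at)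
      from filterlim_compose[OF lim this]
      have "(\<lambda>n. norm (u (z + (1 / real (Suc n)) *\<^sub>R v) - u z - (1 / real (Suc n)) *\<^sub>R ?D z v)
          / norm (1 / real (Suc n))) \<longlonglongrightarrow> 0" .
      moreover have "norm (u (z + (1 / real (Suc n)) *\<^sub>R v) - u z - (1 / real (Suc n)) *\<^sub>R ?D z v)
          / norm (1 / real (Suc n)) = norm (s n z - ?D z v)" for n
      proof -
        define d where "d = u (z + (1 / real (Suc n)) *\<^sub>R v) - u z"
        have "s n z - ?D z v = of_nat (Suc n) * (d - (1 / real (Suc n)) *\<^sub>R ?D z v)"
          by (simp add: s_def d_def scaleR_conv_of_real field_simps del: of_nat_Suc)
        then have "norm (s n z - ?D z v) = real (Suc n) * norm (d - (1 / real (Suc n)) *\<^sub>R ?D z v)"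
          by (simp only: norm_mult norm_of_nat)
        then show ?thesis by (simp add: d_def)
      qed
      ultimately have "(\<lambda>n. norm (s n z - ?D z v)) \<longlonglongrightarrow> 0" by simp
      then show "(\<lambda>n. s n z) \<longlonglongrightarrow> ?D z v"
        by (simp add: LIM_zero_iff tendsto_norm_zero_iff)
    qed
    show "AE z in lborel. norm (s n z) \<le> indicator Q' z *\<^sub>R M" for n
    proof (rule AE_I2)
      fix z
      have r01: "1 / real (Suc n) \<in> {0..1}" by simp
      show "norm (s n z) \<le> indicator Q' z *\<^sub>R M"
      proof (cases "z \<in> Q'")
        case True
        have "norm (s n z) = real (Suc n) * norm (u (z + (1 / real (Suc n)) *\<^sub>R v) - u z)"
          by (simp only: s_def norm_mult norm_of_nat)
        also have "\<dots> \<le> real (Suc n) * (M * (1 / real (Suc n)))"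
          by (intro mult_left_mono diff r01) simp
        finally show ?thesis using True by simp
      next
        case False
        then have "z + (1 / real (Suc n)) *\<^sub>R v \<notin> Q" "z \<notin> Q"
          using inQ'[OF _ r01, of z] inQ'[of z 0] by auto
        then show ?thesis using Q(2) False by (simp add: s_def)
      qed
    qed
  qed
  moreover have "(LINT z|lborel. s n z) = 0" for n
    unfolding s_def using int_shift intu by simp
  ultimately show "(LINT z|lborel. ?D z v) = 0"
    using LIMSEQ_unique[OF _ tendsto_const] by simp
qed

lemma integral_dbar_zero:
  assumes u: "C1_on u UNIV" and Q: "compact Q" "\<And>z. z \<notin> Q \<Longrightarrow> u z = 0"
  shows "(LINT z|lborel. dbar j u z) = 0" "integrable lborel (dbar j u)"
  unfolding dbar_def[abs_def] using integral_directional_derivative_zero[OF assms] by simp_all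

section \<open>Jacobian determinants and their divergence structure\<close>

definition jac_matrix :: "(complex ^ 'n \<Rightarrow> complex ^ 'n) \<Rightarrow> complex ^ 'n \<Rightarrow> complex ^ 'n ^ 'n" where
  "jac_matrix F z = (\<chi> k j. pd j (\<lambda>z. F z $ k) z)"

definition jac :: "(complex ^ 'n \<Rightarrow> complex ^ 'n) \<Rightarrow> complex ^ 'n \<Rightarrow> complex" where
  "jac F z = det (jac_matrix F z)"

lemma holomorphic_map_component: "holomorphic_map_Cn F V \<Longrightarrow> holomorphic_Cn (\<lambda>z. F z $ k) V"
  by (simp add: holomorphic_map_Cn_def)

lemma jac_holomorphic:
  assumes "holomorphic_map_Cn F V" "open V" shows "holomorphic_Cn (jac F) V"
  unfolding jac_def[abs_def] det_def jac_matrix_def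
  by (intro holomorphic_Cn_sum holomorphic_Cn_mult holomorphic_Cn_const holomorphic_Cn_prod)
    (simp add: pd_holomorphic[OF holomorphic_map_component[OF assms(1)] assms(2)])

lemma cnj_det: "cnj (det A) = det (\<chi> i j. cnj (A $ i $ j))"
  by (simp add: det_def cnj_sum cnj_prod)

text \<open>Composing with the transposition of \<open>i\<close> and \<open>k\<close> permutes the
  terms and flips each sign, so the sum is its own negative. This is the mechanism by which second
  derivatives cancel.\<close>

lemma alternating_sum_zero:
  fixes T :: "('n::finite \<Rightarrow> 'n) \<Rightarrow> complex"
  assumes "i \<noteq> k" "\<And>p. p permutes UNIV \<Longrightarrow> T (p \<circ> Transposition.transpose i k) = T p"
  shows "(\<Sum>p | p permutes (UNIV :: 'n set). of_int (sign p) * T p) = 0"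
proof -
  let ?\<tau> = "Transposition.transpose i k"
  have tau: "?\<tau> permutes UNIV" by (simp add: permutes_swap_id)
  have "(\<Sum>p | p permutes (UNIV :: 'n set). of_int (sign p) * T p)
      = (\<Sum>p | p permutes (UNIV :: 'n set). of_int (sign (p \<circ> ?\<tau>)) * T (p \<circ> ?\<tau>))"
    by (rule sum_permutations_compose_right[OF tau])
  also have "\<dots> = (\<Sum>p | p permutes (UNIV :: 'n set). - (of_int (sign p) * T p))"
  proof (rule sum.cong[OF refl])
    fix p assume "p \<in> {p. p permutes (UNIV :: 'n set)}"
    then have p: "p permutes UNIV" by simp
    have "sign (p \<circ> ?\<tau>) = - sign p"
      using assms(1) p tau
      by (simp add: sign_compose permutation_permutes exI[of _ UNIV] sign_swap_id permutes_imp_permutation[OF finite])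
    then show "of_int (sign (p \<circ> ?\<tau>)) * T (p \<circ> ?\<tau>) = - (of_int (sign p) * T p)"
      using assms(2)[OF p] by simp
  qed
  finally show ?thesis by (simp add: sum_negf)
qed

text \<open>
  The null Lagrangian property of Jacobian determinants: expanding the determinant and integrating
  each term by parts, the second derivatives of \<open>F\<close> cancel in pairs.
\<close>

lemma integral_jac_zero:
  fixes F :: "complex ^ 'n \<Rightarrow> complex ^ 'n"
  assumes V: "open V" and F: "holomorphic_map_Cn F V" and g: "holomorphic_Cn g V"
    and U: "C1_on U V" and Q: "compact Q" "Q \<subseteq> V" "\<And>z. z \<in> V - Q \<Longrightarrow> U z = 0"
    and th: "\<And>z j. z \<in> V \<Longrightarrow> dbar j U z = (\<Sum>k\<in>UNIV. th k z * cnj (pd j (\<lambda>z. F z $ k) z))"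
  shows "(LINT z|lborel. indicator V z *\<^sub>R (g z * th i z * cnj (jac F z))) = 0"
proof -
  let ?a = "\<lambda>j k z. cnj (pd j (\<lambda>z. F z $ k) z)"
  \<comment> \<open>The \<open>p\<close>-term of the conjugate determinant with the entry in row
    \<open>i\<close> replaced by the potential \<open>U\<close>. Differentiating in direction
    \<open>p i\<close> puts \<open>dbar (p i) U\<close> into that row, up to second derivatives of
    \<open>F\<close>.\<close>
  define u where "u p z = g z * U z * (\<Prod>k\<in>UNIV - {i}. ?a (p k) k z)" for p z
  define w where "w p z = (if z \<in> V then u p z else 0)" for p z
  note hk = holomorphic_map_component[OF F]
  note pdk = pd_holomorphic[OF hk V]
  have C1a: "C1_on (?a j k) V" for j k by (rule C1_on_cnj_holomorphic[OF pdk V])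
  have C1g: "C1_on g V" by (rule C1_on_holomorphic[OF g V])
  have C1gU: "C1_on (\<lambda>z. g z * U z) V" by (rule C1_on_mult[OF C1g U])
  have C1P: "C1_on (\<lambda>z. \<Prod>k\<in>K. ?a (p k) k z) V" for p K by (rule C1_on_prod[OF C1a])
  have C1u: "C1_on (u p) V" for p unfolding u_def by (rule C1_on_mult[OF C1gU C1P])
  have u0: "u p z = 0" if "z \<in> V - Q" for p z using Q(3)[OF that] by (simp add: u_def)
  have w: "C1_on (w p) UNIV" "\<And>z. z \<in> V \<Longrightarrow> dbar j (w p) z = dbar j (u p) z" "\<And>z. z \<notin> Q \<Longrightarrow> w p z = 0"
    for p j using C1_on_extend[OF V Q(1,2) C1u u0] unfolding w_def by auto
  have dbar_u: "dbar j (u p) z = g z * dbar j U z * (\<Prod>k\<in>UNIV - {i}. ?a (p k) k z)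
      + g z * U z * (\<Sum>k\<in>UNIV - {i}. cnj (pd j (pd (p k) (\<lambda>z. F z $ k)) z) * (\<Prod>l\<in>UNIV - {i} - {k}. ?a (p l) l z))"
    if z: "z \<in> V" for p j z
    unfolding u_def dbar_mult[OF C1gU C1P z] dbar_mult[OF C1g U z] dbar_prod[OF C1a z]
      dbar_holomorphic[OF g z] dbar_cnj_holomorphic[OF pdk z] by simp
  have point: "(\<Sum>p | p permutes UNIV. of_int (sign p) * dbar (p i) (w p) z)
      = indicator V z *\<^sub>R (g z * th i z * cnj (jac F z))" for z
  proof (cases "z \<in> V")
    case False
    then have "z \<notin> Q" using Q(2) by blast
    then have "dbar j (w p) z = 0" for j p
      unfolding dbar_def using derivative_zero_off_support[OF Q(1) w(3)] by simp
    then show ?thesis using False by simp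
  next
    case z: True
    let ?A = "\<chi> k j. ?a j k z"
    \<comment> \<open>Exchanging the values of \<open>p\<close> at \<open>i\<close> and
      \<open>k\<close> only changes the order of differentiation of the k-th component.\<close>
    have second: "(\<Sum>p | p permutes UNIV. of_int (sign p) * (cnj (pd (p i) (pd (p k) (\<lambda>z. F z $ k)) z)
        * (\<Prod>l\<in>UNIV - {i} - {k}. ?a (p l) l z))) = 0" if "k \<in> UNIV - {i}" for k
    proof (rule alternating_sum_zero)
      show "i \<noteq> k" using that by auto
      fix p assume "p permutes (UNIV :: 'n set)"
      have "pd (p k) (pd (p i) (\<lambda>z. F z $ k)) z = pd (p i) (pd (p k) (\<lambda>z. F z $ k)) z"
        by (rule pd_commute[OF hk V z])
      moreover have "(\<Prod>l\<in>UNIV - {i} - {k}. ?a (p (Transposition.transpose i k l)) l z) = (\<Prod>l\<in>UNIV - {i} - {k}. ?a (p l) l z)"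
        by (intro prod.cong) (auto simp: Transposition.transpose_def)
      ultimately show "cnj (pd ((p \<circ> Transposition.transpose i k) i) (pd ((p \<circ> Transposition.transpose i k) k) (\<lambda>z. F z $ k)) z)
        * (\<Prod>l\<in>UNIV - {i} - {k}. ?a ((p \<circ> Transposition.transpose i k) l) l z)
        = cnj (pd (p i) (pd (p k) (\<lambda>z. F z $ k)) z) * (\<Prod>l\<in>UNIV - {i} - {k}. ?a (p l) l z)"
        by simp
    qed
    have "(\<Sum>p | p permutes UNIV. of_int (sign p) * dbar (p i) (w p) z)
      = (\<Sum>p | p permutes UNIV. g z * (of_int (sign p) * (dbar (p i) U z * (\<Prod>k\<in>UNIV - {i}. ?a (p k) k z))))
      + (\<Sum>p | p permutes UNIV. g z * U z * (\<Sum>k\<in>UNIV - {i}. of_int (sign p) * (cnj (pd (p i) (pd (p k) (\<lambda>z. F z $ k)) z)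
          * (\<Prod>l\<in>UNIV - {i} - {k}. ?a (p l) l z))))"
      unfolding sum.distrib[symmetric]
      by (intro sum.cong refl) (simp add: w(2)[OF z] dbar_u[OF z] sum_distrib_left algebra_simps)
    also have "(\<Sum>p | p permutes UNIV. g z * U z * (\<Sum>k\<in>UNIV - {i}. of_int (sign p) * (cnj (pd (p i) (pd (p k) (\<lambda>z. F z $ k)) z)
          * (\<Prod>l\<in>UNIV - {i} - {k}. ?a (p l) l z))))
        = g z * U z * (\<Sum>k\<in>UNIV - {i}. \<Sum>p | p permutes UNIV. of_int (sign p) * (cnj (pd (p i) (pd (p k) (\<lambda>z. F z $ k)) z)
          * (\<Prod>l\<in>UNIV - {i} - {k}. ?a (p l) l z)))"
      by (rule trans[OF sum_distrib_left[symmetric]]) (rule arg_cong[OF sum.swap])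
    also have "\<dots> = 0" using second by simp
    \<comment> \<open>The surviving terms expand a determinant whose row \<open>i\<close> is the
      vector of all \<open>dbar j U z\<close>. By \<open>th\<close> this vector is a combination of
      the rows, and Cramer's rule leaves only the coefficient \<open>th i z\<close>.\<close>
    also have "(\<Sum>p | p permutes UNIV. g z * (of_int (sign p) * (dbar (p i) U z * (\<Prod>k\<in>UNIV - {i}. ?a (p k) k z))))
        = g z * det (\<chi> k. if k = i then (\<Sum>l\<in>UNIV. (\<chi> l. th l z) $ l *s row l ?A) else row k ?A)"
      unfolding det_def sum_distrib_left
    proof (intro sum.cong refl)
      fix p
      let ?B = "(\<chi> k. if k = i then (\<Sum>l\<in>UNIV. (\<chi> l. th l z) $ l *s row l ?A) else row k ?A) :: complex ^ 'n ^ 'n"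
      have "(\<Prod>k\<in>UNIV. ?B $ k $ p k) = ?B $ i $ p i * (\<Prod>k\<in>UNIV - {i}. ?B $ k $ p k)"
        by (rule prod.remove) auto
      also have "?B $ i $ p i = dbar (p i) U z"
        by (simp add: th[OF z] row_def)
      also have "(\<Prod>k\<in>UNIV - {i}. ?B $ k $ p k) = (\<Prod>k\<in>UNIV - {i}. ?a (p k) k z)"
        by (intro prod.cong) (auto simp: row_def)
      finally show "g z * (of_int (sign p) * (dbar (p i) U z * (\<Prod>k\<in>UNIV - {i}. ?a (p k) k z)))
        = g z * (of_int (sign p) * (\<Prod>k\<in>UNIV. ?B $ k $ p k))" by simp
    qed
    also have "\<dots> = g z * (th i z * det ?A)"
      unfolding cramer_lemma_transpose by simp
    also have "det ?A = cnj (jac F z)"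
      by (simp add: jac_def cnj_det jac_matrix_def)
    finally show ?thesis using z by simp
  qed
  have int0: "(LINT z|lborel. dbar (p i) (w p) z) = 0" "integrable lborel (dbar (p i) (w p))" for p
    using integral_dbar_zero[OF w(1) Q(1) w(3)] by auto
  have "(LINT z|lborel. (\<Sum>p | p permutes UNIV. of_int (sign p) * dbar (p i) (w p) z))
      = (\<Sum>p | p permutes UNIV. (LINT z|lborel. of_int (sign p) * dbar (p i) (w p) z))"
    by (rule Bochner_Integration.integral_sum) (use int0(2) in simp)
  also have "\<dots> = 0" using int0 by simp
  finally show ?thesis by (simp add: point)
qed

section \<open>Traces over fibres\<close>

text \<open>The square gives a continuous derivative \<open>2 * max 0 t\<close>, as integration by
  parts demands, and ties the bump to its derivative by \<open>bump t = t * max 0 t\<close>, from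
  which the scaling law in \<rho> will follow.\<close>

definition bump :: "real \<Rightarrow> real" where "bump t = (max 0 t)\<^sup>2"

lemma bump_nonneg [simp]: "bump t \<ge> 0" by (simp add: bump_def)

lemma bump_eq_0 [simp]: "t \<le> 0 \<Longrightarrow> bump t = 0" by (simp add: bump_def)

lemma bump_pos: "t > 0 \<Longrightarrow> bump t > 0" by (simp add: bump_def)

text \<open>A first-order Taylor estimate with constant 1, valid across the kink at 0. Being uniform
  in \<open>t\<close>, it integrates to derivatives of the trace integrals in \<rho> and in
  \<open>w\<close>.\<close>

lemma bump_quadratic: "\<bar>bump (t + d) - bump t - 2 * max 0 t * d\<bar> \<le> d\<^sup>2"
proof -
  have *: "(t + d)\<^sup>2 = t\<^sup>2 + 2 * t * d + d\<^sup>2" by (simp add: power2_eq_square algebra_simps)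
  consider "t \<ge> 0" "t + d \<ge> 0" | "t \<ge> 0" "t + d < 0" | "t < 0" "t + d \<ge> 0" | "t < 0" "t + d < 0"
    by linarith
  then show ?thesis
  proof cases
    case 1 then show ?thesis by (simp add: bump_def max_def *)
  next
    case 2
    have "t * (- 2 * d - t) \<ge> 0" using 2 by (intro mult_nonneg_nonneg) auto
    moreover have "(t + d)\<^sup>2 \<ge> 0" by simp
    ultimately have "\<bar>- t\<^sup>2 - 2 * t * d\<bar> \<le> d\<^sup>2"
      using * by (simp add: power2_eq_square algebra_simps)
    then show ?thesis using 2 by (simp add: bump_def max_def)
  next
    case 3
    have "(t + d)\<^sup>2 \<le> d\<^sup>2" using 3 by (intro power_mono) auto
    then show ?thesis using 3 by (simp add: bump_def max_def)
  next
    case 4 then show ?thesis by (simp add: bump_def max_def)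
  qed
qed

lemma has_derivative_quadratic:
  fixes f :: "'a::real_normed_vector \<Rightarrow> 'b::real_normed_vector"
  assumes A: "bounded_linear A" and d: "(\<delta>::real) > 0"
    and q: "\<And>v. norm v < \<delta> \<Longrightarrow> norm (f (x + v) - f x - A v) \<le> C * (norm v)\<^sup>2"
  shows "(f has_derivative A) (at x)"
  unfolding has_derivative_at
proof (intro conjI A)
  have "(\<lambda>h. norm (f (x + h) - f x - A h) / norm h) \<midarrow>0\<rightarrow> 0"
  proof (rule Lim_null_comparison[where g = "\<lambda>h. C * norm h"])
    show "\<forall>\<^sub>F h in at 0. norm (norm (f (x + h) - f x - A h) / norm h) \<le> C * norm h"
      unfolding eventually_at
    proof (intro exI conjI ballI impI)
      show "\<delta> > 0" by fact
      fix h :: 'a assume "h \<noteq> 0 \<and> dist h 0 < \<delta>"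
      then have "norm (f (x + h) - f x - A h) \<le> C * (norm h)\<^sup>2" "norm h > 0" using q by auto
      then show "norm (norm (f (x + h) - f x - A h) / norm h) \<le> C * norm h"
        by (simp add: divide_le_eq power2_eq_square mult.assoc)
    qed
    show "((\<lambda>h. C * norm h) \<longlongrightarrow> 0) (at 0)"
      by (rule tendsto_mult_right_zero) (rule tendsto_norm_zero[OF tendsto_ident_at])
  qed
  then show "(\<lambda>h. norm (f (x + h) - f x - A h) / norm h) \<midarrow>0\<rightarrow> 0" .
qed

lemma bump_derivative: "(bump has_real_derivative 2 * max 0 t) (at t)"
  unfolding has_field_derivative_def
  by (rule has_derivative_quadratic[where \<delta> = 1 and C = 1])
    (use bump_quadratic in \<open>auto simp: bounded_linear_mult_right\<close>)

definition sqdist :: "(complex ^ 'n \<Rightarrow> complex ^ 'n) \<Rightarrow> complex ^ 'n \<Rightarrow> complex ^ 'n \<Rightarrow> real" where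
  "sqdist F w z = (norm (F z - w))\<^sup>2"

lemma sqdist_nonneg [simp]: "sqdist F w z \<ge> 0" by (simp add: sqdist_def)

lemma norm_square_sum: "complex_of_real ((norm (x :: complex ^ 'n))\<^sup>2) = (\<Sum>k\<in>UNIV. x $ k * cnj (x $ k))"
proof -
  have "(norm x)\<^sup>2 = (\<Sum>k\<in>UNIV. (norm (x $ k))\<^sup>2)"
    by (simp add: norm_vec_def L2_set_def sum_nonneg)
  then show ?thesis by (simp add: complex_norm_square del: of_real_power)
qed

lemma sqdist_sum: "complex_of_real (sqdist F w z) = (\<Sum>k\<in>UNIV. (F z $ k - w $ k) * cnj (F z $ k - w $ k))"
  unfolding sqdist_def norm_square_sum by simp

lemma C1_on_sqdist:
  assumes F: "holomorphic_map_Cn F V" and V: "open V"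
  shows "C1_on (\<lambda>z. complex_of_real (sqdist F w z)) V"
    and "z \<in> V \<Longrightarrow> dbar j (\<lambda>z. complex_of_real (sqdist F w z)) z
      = (\<Sum>k\<in>UNIV. (F z $ k - w $ k) * cnj (pd j (\<lambda>z. F z $ k) z))"
proof -
  have hk: "holomorphic_Cn (\<lambda>z. F z $ k - w $ k) V" for k
    by (intro holomorphic_Cn_diff holomorphic_map_component[OF F] holomorphic_Cn_const)
  note c = C1_on_holomorphic[OF hk V] C1_on_cnj_holomorphic[OF hk V]
  have pdk: "pd j (\<lambda>z. F z $ k - w $ k) z = pd j (\<lambda>z. F z $ k) z" if "z \<in> V" for z k
    by (rule pd_diff_const[OF holomorphic_map_component[OF F] that])
  show "C1_on (\<lambda>z. complex_of_real (sqdist F w z)) V"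
    unfolding sqdist_sum by (intro C1_on_sum C1_on_mult c)
  show "dbar j (\<lambda>z. complex_of_real (sqdist F w z)) z
      = (\<Sum>k\<in>UNIV. (F z $ k - w $ k) * cnj (pd j (\<lambda>z. F z $ k) z))" if "z \<in> V"
  proof -
    have "dbar j (\<lambda>z. (F z $ k - w $ k) * cnj (F z $ k - w $ k)) z
        = (F z $ k - w $ k) * cnj (pd j (\<lambda>z. F z $ k) z)" for k
      by (rule trans[OF dbar_mult[OF c that]])
        (simp only: dbar_holomorphic[OF hk that] dbar_cnj_holomorphic[OF hk that] pdk[OF that]
          mult_zero_left add_0_right)
    then show ?thesis
      unfolding sqdist_sum by (intro trans[OF dbar_sum[OF C1_on_mult[OF c] that]] sum.cong refl)
  qed
qed

text \<open>The conjugate variables enter only through the conjugate of \<open>F\<close>, so the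
  result is a combination of the \<open>cnj (pd j (\<lambda>z. F z $ k) z)\<close>: the form
  required of \<open>U\<close> in \<open>integral_jac_zero\<close>.\<close>

lemma C1_on_bump_sqdist:
  assumes F: "holomorphic_map_Cn F V" and V: "open V"
  shows "C1_on (\<lambda>z. complex_of_real (bump (\<rho> - sqdist F w z))) V"
    and "z \<in> V \<Longrightarrow> dbar j (\<lambda>z. complex_of_real (bump (\<rho> - sqdist F w z))) z
      = (\<Sum>k\<in>UNIV. (complex_of_real (- 2 * max 0 (\<rho> - sqdist F w z)) * (F z $ k - w $ k))
          * cnj (pd j (\<lambda>z. F z $ k) z))"
proof -
  have e: "((\<lambda>s. bump (\<rho> - s)) has_real_derivative (- 2 * max 0 (\<rho> - s))) (at s)" for s
  proof -
    have "((\<lambda>s. \<rho> - s) has_real_derivative -1) (at s)" by (auto intro!: derivative_eq_intros)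
    from DERIV_chain2[OF bump_derivative this] show ?thesis by simp
  qed
  have ce: "continuous_on UNIV (\<lambda>s. - 2 * max 0 (\<rho> - s))" by (intro continuous_intros)
  note C = C1_on_real_compose[OF C1_on_sqdist(1)[OF F V] e ce]
  show "C1_on (\<lambda>z. complex_of_real (bump (\<rho> - sqdist F w z))) V" by (rule C(1))
  show "dbar j (\<lambda>z. complex_of_real (bump (\<rho> - sqdist F w z))) z
      = (\<Sum>k\<in>UNIV. (complex_of_real (- 2 * max 0 (\<rho> - sqdist F w z)) * (F z $ k - w $ k))
          * cnj (pd j (\<lambda>z. F z $ k) z))" if "z \<in> V"
    unfolding C(2)[OF that] C1_on_sqdist(2)[OF F V that] by (simp add: sum_distrib_left mult.assoc)
qed

section \<open>Local properness and trace integrals\<close>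

text \<open>Properness over a single closed ball. It suffices for integrals whose kernel is
  supported over that ball, and unlike global properness it can be had for perturbations of a map
  and for restrictions to a small ball about one fibre point.\<close>

definition proper_at :: "(complex ^ 'n) set \<Rightarrow> (complex ^ 'n \<Rightarrow> complex ^ 'n) \<Rightarrow> complex ^ 'n \<Rightarrow> real \<Rightarrow> bool" where
  "proper_at V F w r \<longleftrightarrow> open V \<and> holomorphic_map_Cn F V \<and> r > 0 \<and> compact (V \<inter> F -` cball w r)"

lemma holomorphic_map_continuous_on:
  fixes F :: "complex ^ 'n \<Rightarrow> complex ^ 'm"
  assumes "holomorphic_map_Cn F V" shows "continuous_on V F"
proof -
  have "continuous_on V (\<lambda>z. \<chi> k. F z $ k)"
    by (intro continuous_on_vec_lambda holomorphic_Cn_continuous_on)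
      (use assms in \<open>simp add: holomorphic_map_Cn_def\<close>)
  then show ?thesis by (simp add: vec_nth_inverse)
qed

lemma proper_at_mono:
  assumes "proper_at V F w r" "dist w w' + r' \<le> r" "r' > 0"
  shows "proper_at V F w' r'"
proof -
  have V: "open V" "holomorphic_map_Cn F V" "compact (V \<inter> F -` cball w r)"
    using assms(1) by (auto simp: proper_at_def)
  have sub: "cball w' r' \<subseteq> cball w r" using assms(2) by (auto simp: cball_subset_cball_iff dist_commute)
  have "continuous_on (V \<inter> F -` cball w r) F"
    by (rule continuous_on_subset[OF holomorphic_map_continuous_on[OF V(2)]]) auto
  then have "closed ((V \<inter> F -` cball w r) \<inter> F -` cball w' r')"
    by (rule continuous_closed_preimage[OF _ compact_imp_closed[OF V(3)] closed_cball])
  then have "compact ((V \<inter> F -` cball w r) \<inter> ((V \<inter> F -` cball w r) \<inter> F -` cball w' r'))"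
    by (rule compact_Int_closed[OF V(3)])
  moreover have "(V \<inter> F -` cball w r) \<inter> ((V \<inter> F -` cball w r) \<inter> F -` cball w' r') = V \<inter> F -` cball w' r'"
    using sub by auto
  ultimately show ?thesis using V assms(3) by (simp add: proper_at_def)
qed

lemma proper_at_support:
  assumes "z \<in> V" "\<rho> - sqdist F w z > 0" "\<rho> \<le> r\<^sup>2" "r \<ge> 0"
  shows "z \<in> V \<inter> F -` cball w r"
proof -
  have "(norm (F z - w))\<^sup>2 \<le> r\<^sup>2" using assms unfolding sqdist_def by linarith
  then have "norm (F z - w) \<le> r" using assms(4) by (rule power2_le_imp_le)
  then show ?thesis using assms(1) by (simp add: dist_norm norm_minus_commute)
qed

lemma integrable_open_compact_support:
  fixes \<phi> :: "complex ^ 'n \<Rightarrow> 'b::{banach, second_countable_topology}"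
  assumes "continuous_on V \<phi>" "compact Q" "Q \<subseteq> V" "\<And>z. z \<in> V - Q \<Longrightarrow> \<phi> z = 0"
  shows "integrable lborel (\<lambda>z. indicator V z *\<^sub>R \<phi> z)"
proof -
  have "integrable lborel (\<lambda>z. indicator Q z *\<^sub>R \<phi> z)"
    by (rule borel_integrable_compact[OF assms(2) continuous_on_subset[OF assms(1,3)]])
  moreover have "indicator Q z *\<^sub>R \<phi> z = indicator V z *\<^sub>R \<phi> z" for z
    using assms(3,4) by (auto simp: indicator_def)
  ultimately show ?thesis by simp
qed

text \<open>The squared modulus of \<open>jac F z\<close> is the real Jacobian of \<open>F\<close>,
  so formally this integrates the fibre sums of \<open>h\<close> over values near \<open>w\<close>
  against a radial kernel centred at \<open>w\<close>. The substitution itself is never carried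
  out.\<close>

definition trace_int ::
  "(complex ^ 'n) set \<Rightarrow> (complex ^ 'n \<Rightarrow> complex ^ 'n) \<Rightarrow> (complex ^ 'n \<Rightarrow> complex) \<Rightarrow> real \<Rightarrow> complex ^ 'n \<Rightarrow> complex" where
  "trace_int V F h \<rho> w = (LINT z|lborel. indicator V z *\<^sub>R
     (h z * complex_of_real ((cmod (jac F z))\<^sup>2 * bump (\<rho> - sqdist F w z))))"

text \<open>
  For small \<open>\<rho>\<close> the integral is \<open>\<rho>\<^bsup>n+2\<^esup>\<close> times a quantity independent of \<open>\<rho>\<close>; letting \<open>\<rho>\<close> tend
  to \<open>0\<close> shows that, over a finite fibre, this quantity is a positively weighted sum of the values
  of \<open>h\<close> on the fibre.
\<close>

definition fibre_trace ::
  "(complex ^ 'n) set \<Rightarrow> (complex ^ 'n \<Rightarrow> complex ^ 'n) \<Rightarrow> (complex ^ 'n \<Rightarrow> complex) \<Rightarrow> complex ^ 'n \<Rightarrow> complex" where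
  "fibre_trace V F h w = (THE c. \<forall>\<^sub>F \<rho> in at_right 0. trace_int V F h \<rho> w = complex_of_real (\<rho> ^ (CARD('n) + 2)) * c)"

lemma sum_affine:
  fixes X :: "'n::finite \<Rightarrow> complex"
  shows "(\<Sum>i\<in>UNIV. a * (- 2 * m * X i + b)) = a * (- 2 * (m * (\<Sum>i\<in>UNIV. X i)) + of_nat CARD('n) * b)"
  by (simp add: sum_distrib_left sum.distrib sum_subtractf sum_negf algebra_simps)

lemma sum_collect:
  fixes a :: complex
  shows "(\<Sum>i\<in>I. v i * (a * (A * (2 * m * y i))) + v' i * (2 * (a * (A * (m * x i))))) - n * (a * (A * (2 * m)))
    = a * (A * (2 * m * ((\<Sum>i\<in>I. v i * y i + v' i * x i) - n)))"
  by (simp add: sum_distrib_left algebra_simps)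

lemma integral_diff_mult:
  fixes f g :: "'a \<Rightarrow> complex"
  assumes "integrable M f" "integrable M g"
  shows "(LINT z|M. a * f z - b * g z) = a * integral\<^sup>L M f - b * integral\<^sup>L M g"
  using assms by simp

context
  fixes V :: "(complex ^ 'n) set" and F w r h
  assumes pa: "proper_at V F w r" and h: "holomorphic_Cn h V"
begin

lemma pa_V: "open V" and pa_F: "holomorphic_map_Cn F V" and pa_r: "r > 0"
  and pa_Q: "compact (V \<inter> F -` cball w r)"
  using pa by (auto simp: proper_at_def)

lemma cont_h: "continuous_on V h" by (rule holomorphic_Cn_continuous_on[OF h])
lemma cont_F: "continuous_on V F" by (rule holomorphic_map_continuous_on[OF pa_F])
lemma cont_jac: "continuous_on V (jac F)"
  by (rule holomorphic_Cn_continuous_on[OF jac_holomorphic[OF pa_F pa_V]])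

lemma cont_sqdist: "continuous_on V (sqdist F w')"
  unfolding sqdist_def[abs_def] by (intro continuous_intros cont_F)

lemma cont_bump: "continuous_on V (\<lambda>z. bump (\<rho> - sqdist F w' z))"
  unfolding bump_def by (intro continuous_intros cont_sqdist)

lemma integrable_kernel:
  assumes "continuous_on V \<phi>" "\<And>z. z \<in> V \<Longrightarrow> sqdist F w' z \<ge> \<rho> \<Longrightarrow> \<phi> z = (0::complex)"
    "\<rho> \<le> r'\<^sup>2" "r' \<ge> 0" "dist w w' + r' \<le> r"
  shows "integrable lborel (\<lambda>z. indicator V z *\<^sub>R \<phi> z)"
proof (rule integrable_open_compact_support[OF assms(1) pa_Q])
  show "\<phi> z = 0" if "z \<in> V - V \<inter> F -` cball w r" for z
  proof (rule assms(2))
    show "sqdist F w' z \<ge> \<rho>"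
    proof (rule ccontr)
      assume "\<not> ?thesis"
      then have "z \<in> V \<inter> F -` cball w' r'" using proper_at_support[of z V \<rho> F w' r'] that assms(3,4) by simp
      moreover have "cball w' r' \<subseteq> cball w r" using assms(5) by (auto simp: cball_subset_cball_iff dist_commute)
      ultimately show False using that by auto
    qed
  qed (use that in auto)
qed auto

lemma integrable_trace_int:
  assumes "\<rho> \<le> r'\<^sup>2" "r' \<ge> 0" "dist w w' + r' \<le> r" "continuous_on V k"
  shows "integrable lborel (\<lambda>z. indicator V z *\<^sub>R
     (k z * complex_of_real ((cmod (jac F z))\<^sup>2 * bump (\<rho> - sqdist F w' z))))"
  by (rule integrable_kernel[OF _ _ assms(1-3)])
    (auto intro!: continuous_intros assms(4) cont_jac cont_bump)

text \<open>Differentiating the kernel in the conjugate of \<open>w $ i\<close> produces twice this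
  integrand, so the identity is the Cauchy-Riemann equation for the trace integral. The potential is
  the kernel itself, and \<open>h z * jac F z\<close> is the holomorphic factor.\<close>

lemma stokes_first:
  assumes "\<rho> \<le> r\<^sup>2"
  shows "(LINT z|lborel. indicator V z *\<^sub>R (h z * complex_of_real ((cmod (jac F z))\<^sup>2)
     * (complex_of_real (max 0 (\<rho> - sqdist F w z)) * (F z $ i - w $ i)))) = 0"
proof -
  let ?U = "\<lambda>z. complex_of_real (bump (\<rho> - sqdist F w z))"
  let ?th = "\<lambda>k z. complex_of_real (- 2 * max 0 (\<rho> - sqdist F w z)) * (F z $ k - w $ k)"
  have "(LINT z|lborel. indicator V z *\<^sub>R ((h z * jac F z) * ?th i z * cnj (jac F z))) = 0"
  proof (rule integral_jac_zero[OF pa_V pa_F holomorphic_Cn_mult[OF h jac_holomorphic[OF pa_F pa_V]]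
        C1_on_bump_sqdist(1)[OF pa_F pa_V] pa_Q _ _ C1_on_bump_sqdist(2)[OF pa_F pa_V]])
    show "?U z = 0" if "z \<in> V - V \<inter> F -` cball w r" for z
    proof -
      have "\<not> (\<rho> - sqdist F w z > 0)"
        using proper_at_support[of z V \<rho> F w r] that assms pa_r by auto
      then show ?thesis by simp
    qed
  qed auto
  moreover have "indicator V z *\<^sub>R ((h z * jac F z) * ?th i z * cnj (jac F z))
     = - 2 * (indicator V z *\<^sub>R (h z * complex_of_real ((cmod (jac F z))\<^sup>2)
        * (complex_of_real (max 0 (\<rho> - sqdist F w z)) * (F z $ i - w $ i))))" for z
    unfolding complex_norm_square by (simp add: scaleR_conv_of_real)
  ultimately have "(LINT z|lborel. - 2 * (indicator V z *\<^sub>R (h z * complex_of_real ((cmod (jac F z))\<^sup>2)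
        * (complex_of_real (max 0 (\<rho> - sqdist F w z)) * (F z $ i - w $ i))))) = 0"
    by (simp only:)
  then show ?thesis unfolding integral_mult_right_zero by simp
qed

text \<open>Euler's relation for homogeneity of degree n + 2. The potentials are
  \<open>cnj (F z $ i - w $ i)\<close> times the kernel: their first factor contributes the kernel
  once for each of the n coordinates, and the summed derivative of the kernel contributes the
  remaining 2 through \<open>mP\<close>.\<close>

lemma stokes_second:
  assumes "\<rho> \<le> r\<^sup>2"
  shows "of_nat (CARD('n) + 2) * trace_int V F h \<rho> w = 2 * complex_of_real \<rho> *
    (LINT z|lborel. indicator V z *\<^sub>R (h z * complex_of_real ((cmod (jac F z))\<^sup>2 * max 0 (\<rho> - sqdist F w z))))"
proof -
  let ?b = "\<lambda>z. complex_of_real (bump (\<rho> - sqdist F w z))"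
  let ?m = "\<lambda>z. complex_of_real (max 0 (\<rho> - sqdist F w z))"
  let ?A = "\<lambda>z. h z * complex_of_real ((cmod (jac F z))\<^sup>2)"
  let ?U = "\<lambda>i z. cnj (F z $ i - w $ i) * ?b z"
  let ?th = "\<lambda>i k z. cnj (F z $ i - w $ i) * (complex_of_real (- 2) * ?m z * (F z $ k - w $ k)) + (if k = i then ?b z else 0)"
  have hk: "holomorphic_Cn (\<lambda>z. F z $ k - w $ k) V" for k
    by (intro holomorphic_Cn_diff holomorphic_map_component[OF pa_F] holomorphic_Cn_const)
  have pdk: "pd j (\<lambda>z. F z $ k - w $ k) z = pd j (\<lambda>z. F z $ k) z" if "z \<in> V" for j z k
    by (rule pd_diff_const[OF holomorphic_map_component[OF pa_F] that])
  note c = C1_on_cnj_holomorphic[OF hk pa_V]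
  note b = C1_on_bump_sqdist[OF pa_F pa_V]
  have supp: "max 0 (\<rho> - sqdist F w z) = 0" if "z \<in> V - V \<inter> F -` cball w r" for z
    using proper_at_support[of z V \<rho> F w r] that assms pa_r by force
  then have supp_b: "?b z = 0" if "z \<in> V - V \<inter> F -` cball w r" for z
    using that by (metis bump_def of_real_0 power_zero_numeral)
  have zero: "(LINT z|lborel. indicator V z *\<^sub>R ((h z * jac F z) * ?th i i z * cnj (jac F z))) = 0" for i
  proof (rule integral_jac_zero[where th = "?th i" and U = "?U i", OF pa_V pa_F
        holomorphic_Cn_mult[OF h jac_holomorphic[OF pa_F pa_V]] C1_on_mult[OF c b(1)] pa_Q])
    show "?U i z = 0" if "z \<in> V - V \<inter> F -` cball w r" for z
      using supp_b[OF that] by simp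
    fix z j assume z: "z \<in> V"
    have "dbar j (?U i) z = cnj (F z $ i - w $ i) * (\<Sum>k\<in>UNIV. (complex_of_real (- 2) * ?m z * (F z $ k - w $ k))
          * cnj (pd j (\<lambda>z. F z $ k) z)) + cnj (pd j (\<lambda>z. F z $ i) z) * ?b z"
      by (rule trans[OF dbar_mult[OF c b(1) z]])
        (simp only: dbar_cnj_holomorphic[OF hk z] pdk[OF z] b(2)[OF z] of_real_mult)
    also have "cnj (pd j (\<lambda>z. F z $ i) z) * ?b z
        = (\<Sum>k\<in>UNIV. (if k = i then ?b z else 0) * cnj (pd j (\<lambda>z. F z $ k) z))"
      by (simp add: if_distrib[of "\<lambda>x. x * _"] cong: if_cong)
    finally show "dbar j (?U i) z = (\<Sum>k\<in>UNIV. ?th i k z * cnj (pd j (\<lambda>z. F z $ k) z))"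
      by (simp add: sum_distrib_left sum.distrib[symmetric] algebra_simps del: sum.delta)
  qed auto
  have conv: "(h z * jac F z) * ?th i i z * cnj (jac F z)
      = ?A z * (- 2 * ?m z * ((F z $ i - w $ i) * cnj (F z $ i - w $ i)) + ?b z)" for i z
    by (simp add: complex_norm_square algebra_simps del: of_real_power)
  have cont_m: "continuous_on V (\<lambda>z. max 0 (\<rho> - sqdist F w z))"
    by (intro continuous_intros cont_sqdist)
  have cont_Fi: "continuous_on V (\<lambda>z. F z $ i)" for i
    by (intro continuous_intros cont_F)
  have r0: "r \<ge> 0" "dist w w + r \<le> r" using pa_r by auto
  have int1: "integrable lborel (\<lambda>z. indicator V z *\<^sub>R
      (?A z * (- 2 * ?m z * ((F z $ i - w $ i) * cnj (F z $ i - w $ i)) + ?b z)))" for i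
    by (rule integrable_kernel[OF _ _ assms r0])
      (auto intro!: continuous_intros cont_h cont_jac cont_m cont_bump cont_Fi)
  have int2: "integrable lborel (\<lambda>z. indicator V z *\<^sub>R (?A z * ?m z))"
    by (rule integrable_kernel[OF _ _ assms r0])
      (auto intro!: continuous_intros cont_h cont_jac cont_m)
  have int3: "integrable lborel (\<lambda>z. indicator V z *\<^sub>R (?A z * ?b z))"
    by (rule integrable_kernel[OF _ _ assms r0])
      (auto intro!: continuous_intros cont_h cont_jac cont_bump)
  \<comment> \<open>With t = \<rho> - s this is max(0, t) s = \<rho> max(0, t) - max(0, t)^2, which
    brings the kernel itself back from its derivative.\<close>
  have mP: "?m z * complex_of_real (sqdist F w z) = complex_of_real \<rho> * ?m z - ?b z" for z
  proof -
    have "max 0 (\<rho> - sqdist F w z) * sqdist F w z = \<rho> * max 0 (\<rho> - sqdist F w z) - bump (\<rho> - sqdist F w z)"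
      by (simp add: bump_def max_def power2_eq_square algebra_simps)
    from arg_cong[OF this, of complex_of_real] show ?thesis by simp
  qed
  have "0 = (\<Sum>i\<in>(UNIV :: 'n set). (LINT z|lborel. indicator V z *\<^sub>R
      (?A z * (- 2 * ?m z * ((F z $ i - w $ i) * cnj (F z $ i - w $ i)) + ?b z))))"
    using zero unfolding conv by simp
  also have "\<dots> = (LINT z|lborel. (\<Sum>i\<in>(UNIV :: 'n set). indicator V z *\<^sub>R
      (?A z * (- 2 * ?m z * ((F z $ i - w $ i) * cnj (F z $ i - w $ i)) + ?b z))))"
    by (rule Bochner_Integration.integral_sum[symmetric]) (rule int1)
  also have "\<dots> = (LINT z|lborel. of_nat (CARD('n) + 2) * (indicator V z *\<^sub>R (?A z * ?b z))
      - 2 * complex_of_real \<rho> * (indicator V z *\<^sub>R (?A z * ?m z)))"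
  proof (rule Bochner_Integration.integral_cong[OF refl])
    fix z
    have "(\<Sum>i\<in>(UNIV :: 'n set). ?A z * (- 2 * ?m z * ((F z $ i - w $ i) * cnj (F z $ i - w $ i)) + ?b z))
        = ?A z * (- 2 * (?m z * (\<Sum>i\<in>(UNIV :: 'n set). (F z $ i - w $ i) * cnj (F z $ i - w $ i))) + of_nat CARD('n) * ?b z)"
      by (rule sum_affine)
    also have "\<dots> = ?A z * (- 2 * (complex_of_real \<rho> * ?m z - ?b z) + of_nat CARD('n) * ?b z)"
      unfolding sqdist_sum[symmetric] mP ..
    finally have eq: "(\<Sum>i\<in>(UNIV :: 'n set). ?A z * (- 2 * ?m z * ((F z $ i - w $ i) * cnj (F z $ i - w $ i)) + ?b z))
        = ?A z * (- 2 * (complex_of_real \<rho> * ?m z - ?b z) + of_nat CARD('n) * ?b z)" .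
    show "(\<Sum>i\<in>(UNIV :: 'n set). indicator V z *\<^sub>R
      (?A z * (- 2 * ?m z * ((F z $ i - w $ i) * cnj (F z $ i - w $ i)) + ?b z)))
      = of_nat (CARD('n) + 2) * (indicator V z *\<^sub>R (?A z * ?b z))
      - 2 * complex_of_real \<rho> * (indicator V z *\<^sub>R (?A z * ?m z))"
      unfolding scaleR_sum_right[symmetric] eq by (simp add: scaleR_conv_of_real algebra_simps)
  qed
  also have "\<dots> = of_nat (CARD('n) + 2) * (LINT z|lborel. indicator V z *\<^sub>R (?A z * ?b z))
      - 2 * complex_of_real \<rho> * (LINT z|lborel. indicator V z *\<^sub>R (?A z * ?m z))"
    by (rule integral_diff_mult[OF int3 int2])
  finally show ?thesis by (simp add: trace_int_def mult.assoc)
qed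

lemma integral_linear_combination:
  fixes f g k :: "'a \<Rightarrow> complex"
  assumes "integrable M f" "integrable M g" "integrable M k"
  shows "(LINT z|M. f z - g z - d *\<^sub>R (2 * k z)) = integral\<^sup>L M f - integral\<^sup>L M g - d *\<^sub>R (2 * integral\<^sup>L M k)"
  using assms by simp

text \<open>The \<rho>-derivative of the kernel is \<open>2 * max 0 (\<rho> - sqdist F w z)\<close>,
  and \<open>stokes_second\<close> re-expresses its integral through the trace integral: a linear
  differential equation in \<rho>.\<close>

lemma trace_int_derivative:
  assumes "0 < \<rho>" "\<rho> < r\<^sup>2"
  shows "((\<lambda>\<rho>. trace_int V F h \<rho> w) has_vector_derivative
    (of_nat (CARD('n) + 2) / complex_of_real \<rho> * trace_int V F h \<rho> w)) (at \<rho>)"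
proof -
  let ?A = "\<lambda>z. h z * complex_of_real ((cmod (jac F z))\<^sup>2)"
  let ?Q = "V \<inter> F -` cball w r"
  let ?M = "LINT z|lborel. indicator V z *\<^sub>R (?A z * complex_of_real (max 0 (\<rho> - sqdist F w z)))"
  let ?B = "LINT z|lborel. indicator ?Q z *\<^sub>R norm (?A z)"
  have r0: "r \<ge> 0" "dist w w + r \<le> r" using pa_r by auto
  have intA: "integrable lborel (\<lambda>z. indicator ?Q z *\<^sub>R norm (?A z))"
    by (rule borel_integrable_compact[OF pa_Q])
      (auto intro!: continuous_intros continuous_on_subset[OF cont_h] continuous_on_subset[OF cont_jac])
  have int2: "integrable lborel (\<lambda>z. indicator V z *\<^sub>R (?A z * complex_of_real (max 0 (\<rho> - sqdist F w z))))"
    by (rule integrable_kernel[OF _ _ less_imp_le[OF assms(2)] r0])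
      (auto intro!: continuous_intros cont_h cont_jac cont_sqdist)
  have int3: "integrable lborel (\<lambda>z. indicator V z *\<^sub>R (?A z * complex_of_real (bump (\<rho>' - sqdist F w z))))"
    if "\<rho>' \<le> r\<^sup>2" for \<rho>'
    by (rule integrable_kernel[OF _ _ that r0])
      (auto intro!: continuous_intros cont_h cont_jac cont_bump)
  \<comment> \<open>Pointwise the quadratic error is at most \<open>d\<^sup>2\<close>, so its
    constant is the integral \<open>?B\<close> over the compact preimage \<open>?Q\<close>;
    increments below \<open>r\<^sup>2 - \<rho>\<close> keep both kernels supported there.\<close>
  have "((\<lambda>\<rho>. trace_int V F h \<rho> w) has_derivative (\<lambda>d. d *\<^sub>R (2 * ?M))) (at \<rho>)"
  proof (rule has_derivative_quadratic[where \<delta> = "r\<^sup>2 - \<rho>" and C = ?B])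
    fix d :: real assume d: "norm d < r\<^sup>2 - \<rho>"
    let ?e = "\<lambda>z. bump (\<rho> + d - sqdist F w z) - bump (\<rho> - sqdist F w z) - 2 * max 0 (\<rho> - sqdist F w z) * d"
    have le: "\<rho> + d \<le> r\<^sup>2" "\<rho> \<le> r\<^sup>2" using d assms by auto
    have "trace_int V F h (\<rho> + d) w - trace_int V F h \<rho> w - d *\<^sub>R (2 * ?M)
        = (LINT z|lborel. indicator V z *\<^sub>R (?A z * complex_of_real (bump (\<rho> + d - sqdist F w z)))
           - indicator V z *\<^sub>R (?A z * complex_of_real (bump (\<rho> - sqdist F w z)))
           - d *\<^sub>R (2 * (indicator V z *\<^sub>R (?A z * complex_of_real (max 0 (\<rho> - sqdist F w z))))))"
      unfolding integral_linear_combination[OF int3[OF le(1)] int3[OF le(2)] int2]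
      by (simp add: trace_int_def mult.assoc)
    also have "\<dots> = (LINT z|lborel. indicator V z *\<^sub>R (?A z * complex_of_real (?e z)))"
      by (intro Bochner_Integration.integral_cong) (auto simp: scaleR_conv_of_real algebra_simps)
    finally have eq: "trace_int V F h (\<rho> + d) w - trace_int V F h \<rho> w - d *\<^sub>R (2 * ?M)
        = (LINT z|lborel. indicator V z *\<^sub>R (?A z * complex_of_real (?e z)))" .
    have "norm (LINT z|lborel. indicator V z *\<^sub>R (?A z * complex_of_real (?e z)))
        \<le> (LINT z|lborel. indicator ?Q z *\<^sub>R norm (?A z) * d\<^sup>2)"
    proof (rule Bochner_Integration.integral_norm_bound_integral)
      show "integrable lborel (\<lambda>z. indicator ?Q z *\<^sub>R norm (?A z) * d\<^sup>2)" using intA by simp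
      show "integrable lborel (\<lambda>z. indicator V z *\<^sub>R (?A z * complex_of_real (?e z)))"
      proof (rule integrable_kernel[OF _ _ _ r0])
        show "max \<rho> (\<rho> + d) \<le> r\<^sup>2" using le by simp
      qed (auto intro!: continuous_intros cont_h cont_jac cont_bump cont_sqdist)
      fix z
      show "norm (indicator V z *\<^sub>R (?A z * complex_of_real (?e z))) \<le> indicator ?Q z *\<^sub>R norm (?A z) * d\<^sup>2"
      proof (cases "z \<in> V")
        case z: True
        show ?thesis
        proof (cases "z \<in> ?Q")
          case True
          have "\<bar>?e z\<bar> \<le> d\<^sup>2"
            using bump_quadratic[of "\<rho> - sqdist F w z" d] by (simp add: algebra_simps)
          then have "norm (?A z) * \<bar>?e z\<bar> \<le> norm (?A z) * d\<^sup>2" by (intro mult_left_mono) auto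
          then show ?thesis using True z
            by (simp add: norm_mult del: of_real_diff of_real_mult of_real_power)
        next
          case False
          then have "\<not> (\<rho> - sqdist F w z > 0)" "\<not> (\<rho> + d - sqdist F w z > 0)"
            using proper_at_support[of z V _ F w r] z le pa_r by force+
          then show ?thesis using False by simp
        qed
      qed simp
    qed
    then show "norm (trace_int V F h (\<rho> + d) w - trace_int V F h \<rho> w - d *\<^sub>R (2 * ?M)) \<le> ?B * (norm d)\<^sup>2"
      unfolding eq by simp
  qed (use assms in \<open>auto simp: bounded_linear_scaleR_left\<close>)
  moreover have "2 * ?M = of_nat (CARD('n) + 2) / complex_of_real \<rho> * trace_int V F h \<rho> w"
    using stokes_second[OF less_imp_le[OF assms(2)]] assms(1) by (simp add: field_simps)
  ultimately show ?thesis by (simp add: has_vector_derivative_def)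
qed

text \<open>By the differential equation the quotient by \<open>\<rho> ^ (CARD('n) + 2)\<close> has
  zero derivative on the whole interval, hence is constant there. The value that
  \<open>fibre_trace\<close> picks for arbitrarily small \<rho> is therefore valid up to
  \<open>r\<^sup>2\<close>.\<close>

lemma trace_int_eq:
  assumes "0 < \<rho>" "\<rho> < r\<^sup>2"
  shows "trace_int V F h \<rho> w = complex_of_real (\<rho> ^ (CARD('n) + 2)) * fibre_trace V F h w"
proof -
  let ?N = "CARD('n) + 2"
  define f where "f \<rho> = (inverse \<rho> ^ ?N) *\<^sub>R trace_int V F h \<rho> w" for \<rho>
  have f_der: "(f has_derivative (\<lambda>_. 0)) (at \<rho>)" if "\<rho> \<in> {0<..<r\<^sup>2}" for \<rho>
  proof -
    have \<rho>: "0 < \<rho>" "\<rho> < r\<^sup>2" using that by auto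
    have "((\<lambda>\<rho>. inverse \<rho> ^ ?N) has_real_derivative (- (of_nat ?N * inverse \<rho> * inverse \<rho> ^ ?N))) (at \<rho>)"
      using DERIV_power[OF DERIV_inverse[of \<rho>], where n = ?N] \<rho> by (simp add: mult_ac)
    then have "(f has_vector_derivative (inverse \<rho> ^ ?N) *\<^sub>R (of_nat ?N / complex_of_real \<rho> * trace_int V F h \<rho> w)
        + (- (of_nat ?N * inverse \<rho> * inverse \<rho> ^ ?N)) *\<^sub>R trace_int V F h \<rho> w) (at \<rho>)"
      unfolding f_def[abs_def] by (rule has_vector_derivative_scaleR[OF _ trace_int_derivative[OF \<rho>]])
    also have "(inverse \<rho> ^ ?N) *\<^sub>R (of_nat ?N / complex_of_real \<rho> * trace_int V F h \<rho> w)
        + (- (of_nat ?N * inverse \<rho> * inverse \<rho> ^ ?N)) *\<^sub>R trace_int V F h \<rho> w = 0"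
      by (simp add: scaleR_conv_of_real divide_inverse)
    finally show ?thesis by (simp add: has_vector_derivative_def)
  qed
  have f_const: "f \<rho>1 = f \<rho>2" if "\<rho>1 \<in> {0<..<r\<^sup>2}" "\<rho>2 \<in> {0<..<r\<^sup>2}" for \<rho>1 \<rho>2
    by (rule has_derivative_zero_unique_connected[OF _ _ f_der that]) auto
  have eq: "trace_int V F h \<rho>' w = complex_of_real (\<rho>' ^ ?N) * f \<rho>" if "\<rho>' \<in> {0<..<r\<^sup>2}" for \<rho>'
  proof -
    have "trace_int V F h \<rho>' w = complex_of_real (\<rho>' ^ ?N) * f \<rho>'"
    proof -
      have "\<rho>' ^ ?N * inverse \<rho>' ^ ?N = 1"
        using that by (simp only: power_mult_distrib[symmetric]) simp
      then have "complex_of_real (\<rho>' ^ ?N * inverse \<rho>' ^ ?N) = 1" by (simp only: of_real_1)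
      then show ?thesis
        unfolding f_def scaleR_conv_of_real mult.assoc[symmetric] of_real_mult by simp
    qed
    also have "f \<rho>' = f \<rho>" by (rule f_const) (use that assms in auto)
    finally show ?thesis .
  qed
  have ev: "\<forall>\<^sub>F \<rho>' in at_right 0. trace_int V F h \<rho>' w = complex_of_real (\<rho>' ^ ?N) * f \<rho>"
    unfolding eventually_at_right_field
    by (rule exI[of _ "r\<^sup>2"]) (use eq pa_r in auto)
  have "fibre_trace V F h w = f \<rho>"
    unfolding fibre_trace_def
  proof (rule the_equality[where P = "\<lambda>c. \<forall>\<^sub>F \<rho> in at_right 0. trace_int V F h \<rho> w = complex_of_real (\<rho> ^ ?N) * c", OF ev])
    fix c assume "\<forall>\<^sub>F \<rho> in at_right 0. trace_int V F h \<rho> w = complex_of_real (\<rho> ^ ?N) * c"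
    with ev have "\<forall>\<^sub>F \<rho>' in at_right (0::real). \<rho>' > 0 \<and> complex_of_real (\<rho>' ^ ?N) * c = complex_of_real (\<rho>' ^ ?N) * f \<rho>"
      using eventually_at_right_less[of "0::real"] by eventually_elim simp
    then obtain \<rho>' :: real where "\<rho>' > 0 \<and> complex_of_real (\<rho>' ^ ?N) * c = complex_of_real (\<rho>' ^ ?N) * f \<rho>"
      using eventually_happens'[OF trivial_limit_at_right_real] by blast
    then show "c = f \<rho>" by (auto simp del: of_real_power)
  qed
  then show ?thesis using eq[of \<rho>] assms by simp
qed

text \<open>With \<rho> fixed the kernel is expanded to first order in \<open>w\<close>;
  \<open>stokes_first\<close> removes the coefficients of the conjugates of \<open>v $ i\<close>,
  and a complex linear form remains. The hypothesis \<open>T\<close> covers the neighbouring centres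
  \<open>w'\<close>, at which properness holds with another radius than at \<open>w\<close>.\<close>

lemma fibre_trace_has_derivative:
  assumes T: "\<And>w'. dist w w' < r / 3 \<Longrightarrow>
    trace_int V F h ((r / 3)\<^sup>2) w' = complex_of_real (((r / 3)\<^sup>2) ^ (CARD('n) + 2)) * fibre_trace V F h w'"
  shows "\<exists>c. (fibre_trace V F h has_derivative (\<lambda>v. \<Sum>i\<in>UNIV. c i * v $ i)) (at w)"
proof -
  \<comment> \<open>Shifting the centre by less than r/3 and taking a kernel of radius r/3 keeps all
    supports over \<open>cball w r\<close>.\<close>
  define \<rho> where "\<rho> = (r / 3)\<^sup>2"
  let ?N = "CARD('n) + 2"
  have \<rho>: "\<rho> > 0" "\<rho> \<le> r\<^sup>2"
    using pa_r by (auto simp: \<rho>_def power_divide power_mult_distrib)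
  let ?A = "\<lambda>z. h z * complex_of_real ((cmod (jac F z))\<^sup>2)"
  let ?m = "\<lambda>z. max 0 (\<rho> - sqdist F w z)"
  let ?Q = "V \<inter> F -` cball w r"
  define k where "k z = indicator V z *\<^sub>R (?A z * complex_of_real (2 * ?m z))" for z
  define k1 where "k1 i z = indicator V z *\<^sub>R (?A z * (complex_of_real (2 * ?m z) * cnj (F z $ i - w $ i)))" for i z
  define k2 where "k2 i z = indicator V z *\<^sub>R (?A z * (complex_of_real (?m z) * (F z $ i - w $ i)))" for i z
  define c where "c i = integral\<^sup>L lborel (k1 i)" for i
  define C where "C = (LINT z|lborel. indicator ?Q z *\<^sub>R norm (?A z)) * (3 * r)\<^sup>2 + norm (integral\<^sup>L lborel k)"
  have r0: "r \<ge> 0" "dist w w + r \<le> r" using pa_r by auto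
  have cont_Fi: "continuous_on V (\<lambda>z. F z $ i)" for i by (intro continuous_intros cont_F)
  have intA: "integrable lborel (\<lambda>z. indicator ?Q z *\<^sub>R norm (?A z))"
    by (rule borel_integrable_compact[OF pa_Q])
      (auto intro!: continuous_intros continuous_on_subset[OF cont_h] continuous_on_subset[OF cont_jac])
  have intk: "integrable lborel k" "integrable lborel (k1 i)" "integrable lborel (k2 i)" for i
    unfolding k_def k1_def k2_def
    by (rule integrable_kernel[OF _ _ \<rho>(2) r0];
      auto intro!: continuous_intros cont_h cont_jac cont_sqdist cont_Fi)+
  have k2_0: "integral\<^sup>L lborel (k2 i) = 0" for i
    unfolding k2_def[abs_def] by (rule stokes_first[OF \<rho>(2)])
  note T = T[folded \<rho>_def]
  have "((\<lambda>w'. trace_int V F h \<rho> w') has_derivative (\<lambda>v. \<Sum>i\<in>UNIV. c i * v $ i)) (at w)"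
  proof (rule has_derivative_quadratic[where \<delta> = "r / 3" and C = C])
    fix v :: "complex ^ 'n" assume v: "norm v < r / 3"
    \<comment> \<open>The exact increment of the kernel's argument. Its part linear in
      \<open>v\<close> yields \<open>k1\<close> and \<open>k2\<close>; the rest is minus the squared
      norm of \<open>v\<close>, which goes into the error through \<open>k\<close>.\<close>
    define e where "e z = sqdist F w z - sqdist F (w + v) z" for z
    let ?E = "\<lambda>z. bump (\<rho> - sqdist F (w + v) z) - bump (\<rho> - sqdist F w z) - 2 * ?m z * e z"
    have le: "\<rho> \<le> (r / 3)\<^sup>2" "r / 3 \<ge> 0" "dist w (w + v) + r / 3 \<le> r" using pa_r v by (auto simp: \<rho>_def dist_norm)
    have e_eq: "complex_of_real (e z) = (\<Sum>i\<in>UNIV. v $ i * cnj (F z $ i - w $ i) + cnj (v $ i) * (F z $ i - w $ i))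
        - complex_of_real ((norm v)\<^sup>2)" for z
      unfolding e_def of_real_diff sqdist_sum norm_square_sum sum_subtractf[symmetric]
      by (intro sum.cong refl) (simp add: algebra_simps)
    have e_le: "\<bar>e z\<bar> \<le> 3 * r * norm v" if "z \<in> ?Q" for z
    proof -
      have F: "norm (F z - w) \<le> r" using that by (simp add: dist_norm norm_minus_commute)
      let ?a = "norm (F z - w)" and ?b = "norm (F z - (w + v))"
      have "\<bar>?a - ?b\<bar> \<le> norm v"
        using norm_triangle_ineq3[of "F z - w" "F z - (w + v)"] by simp
      moreover have "?b \<le> ?a + norm v"
        using norm_triangle_ineq4[of "F z - w" v] by (simp add: algebra_simps)
      then have "?a + ?b \<le> 3 * r" using F v pa_r by simp
      ultimately have "\<bar>?a - ?b\<bar> * (?a + ?b) \<le> norm v * (3 * r)" by (intro mult_mono) auto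
      moreover have "e z = (?a - ?b) * (?a + ?b)" by (simp add: e_def sqdist_def power2_eq_square algebra_simps)
      then have "\<bar>e z\<bar> = \<bar>?a - ?b\<bar> * (?a + ?b)" by (simp add: abs_mult)
      ultimately show ?thesis by (simp add: mult_ac)
    qed
    have int1: "integrable lborel (\<lambda>z. indicator V z *\<^sub>R (?A z * complex_of_real (bump (\<rho> - sqdist F (w + v) z))))"
      by (rule integrable_kernel[OF _ _ le]) (auto intro!: continuous_intros cont_h cont_jac cont_bump)
    have int2: "integrable lborel (\<lambda>z. indicator V z *\<^sub>R (?A z * complex_of_real (bump (\<rho> - sqdist F w z))))"
      by (rule integrable_kernel[OF _ _ \<rho>(2) r0]) (auto intro!: continuous_intros cont_h cont_jac cont_bump)
    have int3: "integrable lborel (\<lambda>z. \<Sum>i\<in>UNIV. v $ i * k1 i z + cnj (v $ i) * (2 * k2 i z))"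
      using intk by (intro Bochner_Integration.integrable_sum Bochner_Integration.integrable_add) auto
    have int4: "integrable lborel (\<lambda>z. complex_of_real ((norm v)\<^sup>2) * k z)" using intk by simp
    have split: "indicator V z *\<^sub>R (?A z * complex_of_real (?E z))
        = indicator V z *\<^sub>R (?A z * complex_of_real (bump (\<rho> - sqdist F (w + v) z)))
        - indicator V z *\<^sub>R (?A z * complex_of_real (bump (\<rho> - sqdist F w z)))
        - ((\<Sum>i\<in>UNIV. v $ i * k1 i z + cnj (v $ i) * (2 * k2 i z)) - complex_of_real ((norm v)\<^sup>2) * k z)" for z
    proof -
      have "(\<Sum>i\<in>UNIV. v $ i * k1 i z + cnj (v $ i) * (2 * k2 i z)) - complex_of_real ((norm v)\<^sup>2) * k z
        = indicator V z *\<^sub>R (?A z * (complex_of_real (2 * ?m z) * ((\<Sum>i\<in>UNIV. v $ i * cnj (F z $ i - w $ i)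
           + cnj (v $ i) * (F z $ i - w $ i)) - complex_of_real ((norm v)\<^sup>2))))"
        unfolding k_def k1_def k2_def scaleR_conv_of_real of_real_mult of_real_numeral by (rule sum_collect)
      also have "\<dots> = indicator V z *\<^sub>R (?A z * (complex_of_real (2 * ?m z) * complex_of_real (e z)))"
        unfolding e_eq ..
      finally have *: "(\<Sum>i\<in>UNIV. v $ i * k1 i z + cnj (v $ i) * (2 * k2 i z)) - complex_of_real ((norm v)\<^sup>2) * k z
        = indicator V z *\<^sub>R (?A z * (complex_of_real (2 * ?m z) * complex_of_real (e z)))" .
      show ?thesis unfolding * of_real_diff of_real_mult by (simp add: scaleR_conv_of_real algebra_simps)
    qed
    have intE: "integrable lborel (\<lambda>z. indicator V z *\<^sub>R (?A z * complex_of_real (?E z)))"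
      unfolding split using int1 int2 int3 int4 by (intro Bochner_Integration.integrable_diff)
    have "(LINT z|lborel. indicator V z *\<^sub>R (?A z * complex_of_real (?E z)))
        = trace_int V F h \<rho> (w + v) - trace_int V F h \<rho> w
        - ((LINT z|lborel. (\<Sum>i\<in>UNIV. v $ i * k1 i z + cnj (v $ i) * (2 * k2 i z)))
          - complex_of_real ((norm v)\<^sup>2) * integral\<^sup>L lborel k)"
      unfolding split
      by (subst Bochner_Integration.integral_diff, intro Bochner_Integration.integrable_diff int1 int2,
          intro Bochner_Integration.integrable_diff int3 int4,
          subst Bochner_Integration.integral_diff, rule int1, rule int2,
          subst Bochner_Integration.integral_diff, rule int3, rule int4)
        (simp add: trace_int_def mult.assoc)
    also have "(LINT z|lborel. (\<Sum>i\<in>UNIV. v $ i * k1 i z + cnj (v $ i) * (2 * k2 i z))) = (\<Sum>i\<in>UNIV. c i * v $ i)"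
      using intk by (subst Bochner_Integration.integral_sum) (auto simp: c_def k2_0 mult.commute)
    finally have eq: "trace_int V F h \<rho> (w + v) - trace_int V F h \<rho> w - (\<Sum>i\<in>UNIV. c i * v $ i)
        = (LINT z|lborel. indicator V z *\<^sub>R (?A z * complex_of_real (?E z)))
          - complex_of_real ((norm v)\<^sup>2) * integral\<^sup>L lborel k" by simp
    have "norm (LINT z|lborel. indicator V z *\<^sub>R (?A z * complex_of_real (?E z)))
        \<le> (LINT z|lborel. indicator ?Q z *\<^sub>R norm (?A z) * (3 * r * norm v)\<^sup>2)"
    proof (rule Bochner_Integration.integral_norm_bound_integral[OF intE])
      show "integrable lborel (\<lambda>z. indicator ?Q z *\<^sub>R norm (?A z) * (3 * r * norm v)\<^sup>2)" using intA by simp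
      fix z
      show "norm (indicator V z *\<^sub>R (?A z * complex_of_real (?E z))) \<le> indicator ?Q z *\<^sub>R norm (?A z) * (3 * r * norm v)\<^sup>2"
      proof (cases "z \<in> V")
        case z: True
        show ?thesis
        proof (cases "z \<in> ?Q")
          case True
          have "\<bar>?E z\<bar> \<le> (e z)\<^sup>2"
            using bump_quadratic[of "\<rho> - sqdist F w z" "e z"] by (simp add: e_def)
          also have "\<dots> \<le> (3 * r * norm v)\<^sup>2"
            using e_le[OF True] by (metis abs_ge_zero power2_abs power_mono)
          finally have "norm (?A z) * \<bar>?E z\<bar> \<le> norm (?A z) * (3 * r * norm v)\<^sup>2" by (intro mult_left_mono) auto
          then show ?thesis using True z by (simp add: norm_mult del: of_real_diff of_real_mult of_real_power)
        next
          case False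
          have "z \<notin> V \<inter> F -` cball (w + v) (r / 3)"
          proof
            assume "z \<in> V \<inter> F -` cball (w + v) (r / 3)"
            moreover have "dist w (F z) \<le> dist w (w + v) + dist (w + v) (F z)" by (rule dist_triangle)
            ultimately show False using False le(3) by auto
          qed
          then have "\<not> (\<rho> - sqdist F (w + v) z > 0)" "\<not> (\<rho> - sqdist F w z > 0)"
            using proper_at_support[of z V \<rho> F "w + v" "r / 3"] proper_at_support[of z V \<rho> F w r] z le \<rho> pa_r False by auto
          then show ?thesis using False by simp
        qed
      qed simp
    qed
    also have "\<dots> = (LINT z|lborel. indicator ?Q z *\<^sub>R norm (?A z)) * (3 * r)\<^sup>2 * (norm v)\<^sup>2"
      by (simp add: power_mult_distrib)
    finally have 1: "norm (LINT z|lborel. indicator V z *\<^sub>R (?A z * complex_of_real (?E z)))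
        \<le> (LINT z|lborel. indicator ?Q z *\<^sub>R norm (?A z)) * (3 * r)\<^sup>2 * (norm v)\<^sup>2" .
    show "norm (trace_int V F h \<rho> (w + v) - trace_int V F h \<rho> w - (\<Sum>i\<in>UNIV. c i * v $ i)) \<le> C * (norm v)\<^sup>2"
      unfolding eq C_def distrib_right
      by (rule order_trans[OF norm_triangle_ineq4]) (use 1 in \<open>auto simp: norm_mult norm_power\<close>)
  qed (use pa_r bounded_linear_cform in auto)
  from has_derivative_mult_right[OF this, of "1 / complex_of_real (\<rho> ^ ?N)"]
  have "((\<lambda>w'. 1 / complex_of_real (\<rho> ^ ?N) * trace_int V F h \<rho> w') has_derivative
      (\<lambda>v. \<Sum>i\<in>UNIV. (1 / complex_of_real (\<rho> ^ ?N) * c i) * v $ i)) (at w)"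
    by (simp add: sum_distrib_left mult.assoc)
  then have "(fibre_trace V F h has_derivative (\<lambda>v. \<Sum>i\<in>UNIV. (1 / complex_of_real (\<rho> ^ ?N) * c i) * v $ i)) (at w)"
  proof (rule has_derivative_transform_within_open[where s = "ball w (r / 3)"])
    show "1 / complex_of_real (\<rho> ^ ?N) * trace_int V F h \<rho> w' = fibre_trace V F h w'" if "w' \<in> ball w (r / 3)" for w'
      using T[of w'] that \<rho>(1) by simp
  qed (use pa_r in auto)
  then show ?thesis by (rule exI[of _ "\<lambda>i. 1 / complex_of_real (\<rho> ^ ?N) * c i"])
qed

end

lemma fibre_trace_holomorphic:
  assumes pa: "\<And>w. w \<in> W \<Longrightarrow> \<exists>r. proper_at V F w r" and h: "holomorphic_Cn h V"
  shows "holomorphic_Cn (fibre_trace V F h) W"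
proof -
  have "\<exists>c. (fibre_trace V F h has_derivative (\<lambda>v. \<Sum>i\<in>UNIV. c i * v $ i)) (at w)" if "w \<in> W" for w
  proof -
    obtain r where r: "proper_at V F w r" using pa[OF \<open>w \<in> W\<close>] ..
    have r0: "r > 0" using r by (simp add: proper_at_def)
    show ?thesis
    proof (rule fibre_trace_has_derivative[OF r h])
      fix w' assume "dist w w' < r / 3"
      \<comment> \<open>At \<open>w'\<close> the radius 2r/3 is still available, and r/3 lies
        strictly below it, so \<open>trace_int_eq\<close> applies with the same \<rho> as at
        \<open>w\<close>.\<close>
      then have "proper_at V F w' (2 * r / 3)"
        by (intro proper_at_mono[OF r]) (use r0 in auto)
      moreover have "0 < (r / 3)\<^sup>2" "(r / 3)\<^sup>2 < (2 * r / 3)\<^sup>2" using r0 by (auto intro!: power_strict_mono)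
      ultimately show "trace_int V F h ((r / 3)\<^sup>2) w' = complex_of_real (((r / 3)\<^sup>2) ^ (CARD('a) + 2)) * fibre_trace V F h w'"
        using trace_int_eq[OF _ h] by blast
    qed
  qed
  then obtain c where "\<And>w. w \<in> W \<Longrightarrow> (fibre_trace V F h has_derivative (\<lambda>v. \<Sum>i\<in>UNIV. c w i * v $ i)) (at w)"
    by metis
  then show ?thesis by (rule holomorphic_CnI)
qed

section \<open>Local injectivity at regular points\<close>

lemma jac_matrix_mult: "(jac_matrix F z *v v) $ k = (\<Sum>j\<in>UNIV. pd j (\<lambda>z. F z $ k) z * v $ j)"
  by (simp add: jac_matrix_def matrix_vector_mult_def)

lemma holomorphic_map_has_derivative:
  fixes F :: "complex ^ 'n \<Rightarrow> complex ^ 'n"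
  assumes "holomorphic_map_Cn F V" "z \<in> V"
  shows "(F has_derivative (\<lambda>v. jac_matrix F z *v v)) (at z)"
proof -
  have "((\<lambda>z. \<Sum>k\<in>UNIV. F z $ k *s axis k 1) has_derivative
      (\<lambda>v. \<Sum>k\<in>UNIV. (jac_matrix F z *v v) $ k *s axis k 1)) (at z)"
    unfolding jac_matrix_mult
    by (intro has_derivative_sum bounded_linear.has_derivative[OF bounded_linear_scal]
        holomorphic_Cn_D[OF holomorphic_map_component[OF assms(1)] assms(2)])
  then show ?thesis by (simp only: basis_expansion)
qed

lemma norm_vec_le_sum: "norm (x :: complex ^ 'n) \<le> (\<Sum>k\<in>UNIV. norm (x $ k))"
  unfolding norm_vec_def by (rule L2_set_le_sum) simp

text \<open>The half of the inverse function theorem that is used. The entrywise sum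
  \<open>s\<close> of differences of partials bounds the operator norm and tends to 0 at
  \<open>z\<close> because the partials are continuous.\<close>

lemma jac_locally_injective:
  fixes F :: "complex ^ 'n \<Rightarrow> complex ^ 'n"
  assumes V: "open V" and F: "holomorphic_map_Cn F V" and z: "z \<in> V" "jac F z \<noteq> 0"
  obtains e where "e > 0" "ball z e \<subseteq> V" "inj_on F (ball z e)"
proof -
  obtain A where A: "A ** jac_matrix F z = mat 1"
    using z(2) unfolding jac_def invertible_det_nz[symmetric] invertible_def by blast
  let ?f' = "\<lambda>z v. jac_matrix F z *v v"
  show thesis
  proof (rule has_derivative_locally_injective[where f = F and f' = ?f' and g' = "\<lambda>v. A *v v" and a = z and S = V])
    show "(\<lambda>v. A *v v) \<circ> ?f' z = id"
      by (simp add: fun_eq_iff matrix_vector_mul_assoc A)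
    show "(F has_derivative ?f' x) (at x)" if "x \<in> V" for x
      by (rule holomorphic_map_has_derivative[OF F that])
    fix \<epsilon> :: real assume "\<epsilon> > 0"
    define s where "s x = (\<Sum>k\<in>UNIV. \<Sum>j\<in>UNIV. norm (pd j (\<lambda>z. F z $ k) x - pd j (\<lambda>z. F z $ k) z))" for x
    have "continuous_on V s"
      unfolding s_def by (intro continuous_intros pd_continuous_on[OF holomorphic_map_component[OF F] V])
    then have "isCont s z" using V z(1) by (simp add: continuous_on_eq_continuous_at)
    then have "(s \<longlongrightarrow> s z) (at z)" by (simp add: isCont_def)
    moreover have "s z = 0" by (simp add: s_def)
    ultimately have "\<forall>\<^sub>F x in at z. dist (s x) 0 < \<epsilon> / 2" using \<open>\<epsilon> > 0\<close> by (metis half_gt_zero tendstoD)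
    then obtain d where d: "d > 0" "\<And>x. x \<noteq> z \<Longrightarrow> dist x z < d \<Longrightarrow> dist (s x) 0 < \<epsilon> / 2"
      unfolding eventually_at by auto
    have "onorm (\<lambda>v. ?f' x v - ?f' z v) < \<epsilon>" if "dist z x < d" for x
    proof -
      have sx: "s x < \<epsilon> / 2" "0 \<le> s x"
        using d(2)[of x] that \<open>s z = 0\<close> \<open>\<epsilon> > 0\<close> by (cases "x = z"; simp add: dist_commute s_def sum_nonneg)+
      have "norm (?f' x v - ?f' z v) \<le> s x * norm v" for v
      proof -
        have "norm (?f' x v - ?f' z v) \<le> (\<Sum>k\<in>UNIV. norm ((?f' x v - ?f' z v) $ k))" by (rule norm_vec_le_sum)
        also have "\<dots> \<le> (\<Sum>k\<in>UNIV. \<Sum>j\<in>UNIV. norm (pd j (\<lambda>z. F z $ k) x - pd j (\<lambda>z. F z $ k) z) * norm v)"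
        proof (rule sum_mono)
          fix k
          have "(?f' x v - ?f' z v) $ k = (\<Sum>j\<in>UNIV. (pd j (\<lambda>z. F z $ k) x - pd j (\<lambda>z. F z $ k) z) * v $ j)"
            by (simp add: jac_matrix_mult sum_subtractf[symmetric] left_diff_distrib)
          also have "norm \<dots> \<le> (\<Sum>j\<in>UNIV. norm ((pd j (\<lambda>z. F z $ k) x - pd j (\<lambda>z. F z $ k) z) * v $ j))"
            by (rule norm_sum)
          also have "\<dots> \<le> (\<Sum>j\<in>UNIV. norm (pd j (\<lambda>z. F z $ k) x - pd j (\<lambda>z. F z $ k) z) * norm v)"
            unfolding norm_mult by (intro sum_mono mult_left_mono Finite_Cartesian_Product.norm_nth_le) auto
          finally show "norm ((?f' x v - ?f' z v) $ k)
            \<le> (\<Sum>j\<in>UNIV. norm (pd j (\<lambda>z. F z $ k) x - pd j (\<lambda>z. F z $ k) z) * norm v)" .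
        qed
        also have "\<dots> = s x * norm v" by (simp add: s_def sum_distrib_right)
        finally show ?thesis .
      qed
      then have "onorm (\<lambda>v. ?f' x v - ?f' z v) \<le> s x" by (rule onorm_le)
      then show ?thesis using sx \<open>\<epsilon> > 0\<close> by linarith
    qed
    then show "\<exists>d>0. \<forall>x. dist z x < d \<longrightarrow> onorm (\<lambda>v. ?f' x v - ?f' z v) < \<epsilon>"
      using d(1) by blast
  qed (use that V z in auto)
qed

section \<open>Localisation at a fibre and the total mass\<close>

text \<open>On the compact part of the preimage outside \<open>W\<close> the distance of
  \<open>F z\<close> from \<open>w\<close> has a positive minimum. This transfers information about
  one fibre to all nearby ones.\<close>

lemma fibre_nearby:
  assumes pa: "proper_at V F w r" and W: "open W" "V \<inter> F -` {w} \<subseteq> W"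
  obtains \<delta> where "\<delta> > 0" "\<delta> \<le> r" "\<And>z. z \<in> V \<Longrightarrow> dist w (F z) \<le> \<delta> \<Longrightarrow> z \<in> W"
proof -
  let ?Q = "(V \<inter> F -` cball w r) - W"
  have r: "r > 0" and Q: "compact ?Q" and F: "holomorphic_map_Cn F V"
    using pa W by (auto simp: proper_at_def intro: compact_diff)
  show thesis
  proof (cases "?Q = {}")
    case True
    show thesis
    proof (rule that[of r])
      show "z \<in> W" if "z \<in> V" "dist w (F z) \<le> r" for z
        using True that by auto
    qed (use r in simp_all)
  next
    case False
    have "continuous_on ?Q (\<lambda>z. dist w (F z))"
      by (intro continuous_intros continuous_on_subset[OF holomorphic_map_continuous_on[OF F]]) auto
    then obtain q where q: "q \<in> ?Q" "\<And>z. z \<in> ?Q \<Longrightarrow> dist w (F q) \<le> dist w (F z)"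
      using continuous_attains_inf[OF Q False] by blast
    have pos: "dist w (F q) > 0" using q(1) W(2) by auto
    show thesis
    proof (rule that[of "min r (dist w (F q) / 2)"])
      fix z assume z: "z \<in> V" "dist w (F z) \<le> min r (dist w (F q) / 2)"
      show "z \<in> W"
      proof (rule ccontr)
        assume "z \<notin> W"
        then have "z \<in> ?Q" using z by simp
        from q(2)[OF this] z(2) pos show False by auto
      qed
    qed (use r pos in auto)
  qed
qed

lemma trace_int_cong:
  assumes "\<And>z. dist w (F z) < \<delta> \<Longrightarrow> z \<in> V \<longleftrightarrow> z \<in> V'"
    "\<And>z. dist w (F z) < \<delta> \<Longrightarrow> z \<in> V \<Longrightarrow> h z = h' z" "\<delta> > 0" "\<rho> \<le> \<delta>\<^sup>2"
  shows "trace_int V F h \<rho> w = trace_int V' F h' \<rho> w"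
  unfolding trace_int_def
proof (rule Bochner_Integration.integral_cong[OF refl])
  fix z
  show "indicator V z *\<^sub>R (h z * complex_of_real ((cmod (jac F z))\<^sup>2 * bump (\<rho> - sqdist F w z)))
     = indicator V' z *\<^sub>R (h' z * complex_of_real ((cmod (jac F z))\<^sup>2 * bump (\<rho> - sqdist F w z)))"
  proof (cases "dist w (F z) < \<delta>")
    case True
    then show ?thesis using assms(1,2)[OF True] by (auto simp: indicator_def)
  next
    case False
    then have "\<delta>\<^sup>2 \<le> sqdist F w z"
      unfolding sqdist_def using assms(3) by (intro power_mono) (auto simp: dist_norm norm_minus_commute)
    then have "bump (\<rho> - sqdist F w z) = 0" using assms(4) by simp
    then show ?thesis by simp
  qed
qed

text \<open>Only arbitrarily small \<rho> enter the definition, so the trace depends on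
  \<open>V\<close> and \<open>h\<close> merely over a neighbourhood of \<open>w\<close>.\<close>

lemma fibre_trace_cong:
  assumes "\<And>z. dist w (F z) < \<delta> \<Longrightarrow> z \<in> V \<longleftrightarrow> z \<in> V'"
    "\<And>z. dist w (F z) < \<delta> \<Longrightarrow> z \<in> V \<Longrightarrow> h z = h' z" "\<delta> > 0"
  shows "fibre_trace V F h w = fibre_trace V' F h' w"
proof -
  have ev: "\<forall>\<^sub>F \<rho> in at_right 0. trace_int V F h \<rho> w = trace_int V' F h' \<rho> w"
    unfolding eventually_at_right_field
  proof (intro exI conjI allI impI)
    show "0 < \<delta>\<^sup>2" using assms(3) by simp
    show "trace_int V F h \<rho> w = trace_int V' F h' \<rho> w" if "0 < \<rho>" "\<rho> < \<delta>\<^sup>2" for \<rho>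
      by (rule trace_int_cong[OF assms]) (use that in auto)
  qed
  have "(\<forall>\<^sub>F \<rho> in at_right 0. trace_int V F h \<rho> w = X \<rho>) \<longleftrightarrow>
      (\<forall>\<^sub>F \<rho> in at_right 0. trace_int V' F h' \<rho> w = X \<rho>)" for X
    by (rule eventually_cong[OF ev]) auto
  then show ?thesis unfolding fibre_trace_def by simp
qed

text \<open>Taking \<open>Re\<close> only makes the type real: at proper points the trace of 1 is
  real by \<open>mass_eq\<close>. It plays the role of the number of fibre points counted with
  multiplicity, in an unspecified unit.\<close>

definition mass :: "(complex ^ 'n) set \<Rightarrow> (complex ^ 'n \<Rightarrow> complex ^ 'n) \<Rightarrow> complex ^ 'n \<Rightarrow> real" where
  "mass V F w = Re (fibre_trace V F (\<lambda>_. 1) w)"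

lemma mass_cong:
  assumes "\<And>z. dist w (F z) < \<delta> \<Longrightarrow> z \<in> V \<longleftrightarrow> z \<in> V'" "\<delta> > 0"
  shows "mass V F w = mass V' F w"
  unfolding mass_def by (rule arg_cong[where f = Re], rule fibre_trace_cong[OF assms(1) refl assms(2)])

lemma trace_int_one:
  "trace_int V F (\<lambda>_. 1) \<rho> w
    = complex_of_real (LINT z|lborel. indicator V z * ((cmod (jac F z))\<^sup>2 * bump (\<rho> - sqdist F w z)))"
proof -
  have "indicator V z *\<^sub>R (1 * complex_of_real t) = complex_of_real (indicator V z * t)" for z t
    by (simp add: indicator_def)
  then show ?thesis
    unfolding trace_int_def by (simp only: integral_complex_of_real)
qed

lemma mass_eq:
  fixes F :: "complex ^ 'n \<Rightarrow> complex ^ 'n"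
  assumes pa: "proper_at V F w r" and \<rho>: "0 < \<rho>" "\<rho> < r\<^sup>2"
  shows "(LINT z|lborel. indicator V z * ((cmod (jac F z))\<^sup>2 * bump (\<rho> - sqdist F w z)))
      = \<rho> ^ (CARD('n) + 2) * mass V F w"
    and "fibre_trace V F (\<lambda>_. 1) w = complex_of_real (mass V F w)"
    and "mass V F w \<ge> 0"
proof -
  let ?I = "LINT z|lborel. indicator V z * ((cmod (jac F z))\<^sup>2 * bump (\<rho> - sqdist F w z))"
  have eq: "complex_of_real ?I = complex_of_real (\<rho> ^ (CARD('n) + 2)) * fibre_trace V F (\<lambda>_. 1) w"
    using trace_int_eq[OF pa holomorphic_Cn_const[of 1] \<rho>] unfolding trace_int_one .
  from arg_cong[OF this, of Re] show 1: "?I = \<rho> ^ (CARD('n) + 2) * mass V F w"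
    by (simp add: mass_def del: of_real_power)
  from arg_cong[OF eq, of Im] have "Im (fibre_trace V F (\<lambda>_. 1) w) = 0"
    using \<rho> by (simp del: of_real_power)
  then show "fibre_trace V F (\<lambda>_. 1) w = complex_of_real (mass V F w)"
    by (simp add: mass_def complex_eq_iff)
  have "?I \<ge> 0" by (intro Bochner_Integration.integral_nonneg) auto
  then show "mass V F w \<ge> 0" using mult_le_cancel_left_pos[of "\<rho> ^ (CARD('n) + 2)" 0 "mass V F w"] \<rho> unfolding 1 by simp
qed

text \<open>The trace is an average against a nonnegative density of total mass
  \<open>\<rho> ^ (CARD('n) + 2) * mass V F w\<close>, so a uniform bound on \<open>h z - a\<close>
  near the fibre survives integration.\<close>

lemma fibre_trace_bound:
  fixes F :: "complex ^ 'n \<Rightarrow> complex ^ 'n"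
  assumes pa: "proper_at V F w r" and h: "holomorphic_Cn h V" and d: "\<delta> > 0"
    and le: "\<And>z. z \<in> V \<Longrightarrow> dist w (F z) < \<delta> \<Longrightarrow> norm (h z - a) \<le> \<epsilon>"
  shows "norm (fibre_trace V F h w - a * mass V F w) \<le> \<epsilon> * mass V F w"
proof -
  have r: "r > 0" using pa by (simp add: proper_at_def)
  \<comment> \<open>Half the minimum: \<rho> = s^2 is then strictly below \<open>r\<^sup>2\<close>,
    and the kernel sees only points with \<open>F z\<close> within \<delta> of
    \<open>w\<close>.\<close>
  define s where "s = min r \<delta> / 2"
  have s: "s > 0" "s < r" "s < \<delta>" using r d by (auto simp: s_def min_def)
  define \<rho> where "\<rho> = s\<^sup>2"
  let ?N = "CARD('n) + 2"
  have \<rho>: "0 < \<rho>" "\<rho> < r\<^sup>2" using s unfolding \<rho>_def by (auto intro!: power_strict_mono)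
  have \<rho>': "\<rho> \<le> \<delta>\<^sup>2" using s unfolding \<rho>_def by (intro power_mono) auto
  let ?wt = "\<lambda>z. (cmod (jac F z))\<^sup>2 * bump (\<rho> - sqdist F w z)"
  have pa0: "dist w w + r \<le> r" "r \<ge> 0" "\<rho> \<le> r\<^sup>2" using r \<rho> by auto
  have h1: "holomorphic_Cn (\<lambda>_. 1) V" by simp
  have int_h: "integrable lborel (\<lambda>z. indicator V z *\<^sub>R (h z * complex_of_real (?wt z)))"
    by (rule integrable_trace_int[OF pa h pa0(3,2,1) holomorphic_Cn_continuous_on[OF h]])
  have int_1: "integrable lborel (\<lambda>z. indicator V z *\<^sub>R (1 * complex_of_real (?wt z)))"
    by (rule integrable_trace_int[OF pa h1 pa0(3,2,1)]) simp
  have int_r: "integrable lborel (\<lambda>z. indicator V z * ?wt z)"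
    using integrable_Re[OF int_1] by (simp del: of_real_power)
  have "complex_of_real (\<rho> ^ ?N) * (fibre_trace V F h w - a * mass V F w)
      = trace_int V F h \<rho> w - a * trace_int V F (\<lambda>_. 1) \<rho> w"
    unfolding trace_int_eq[OF pa h \<rho>] trace_int_eq[OF pa h1 \<rho>] mass_eq(2)[OF pa \<rho>]
    by (simp only: right_diff_distrib mult.left_commute)
  also have "\<dots> = (LINT z|lborel. indicator V z *\<^sub>R (h z * complex_of_real (?wt z))
      - a * (indicator V z *\<^sub>R (1 * complex_of_real (?wt z))))"
    unfolding trace_int_def
    by (rule Bochner_Integration.integral_diff[OF int_h Bochner_Integration.integrable_mult_right[OF int_1],
        unfolded integral_mult_right_zero, symmetric])
  finally have eq: "complex_of_real (\<rho> ^ ?N) * (fibre_trace V F h w - a * mass V F w)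
      = (LINT z|lborel. indicator V z *\<^sub>R (h z * complex_of_real (?wt z))
      - a * (indicator V z *\<^sub>R (1 * complex_of_real (?wt z))))" .
  have "norm (complex_of_real (\<rho> ^ ?N) * (fibre_trace V F h w - a * mass V F w))
      \<le> (LINT z|lborel. \<epsilon> * (indicator V z * ?wt z))"
    unfolding eq
  proof (rule Bochner_Integration.integral_norm_bound_integral)
    fix z
    show "norm (indicator V z *\<^sub>R (h z * complex_of_real (?wt z))
      - a * (indicator V z *\<^sub>R (1 * complex_of_real (?wt z)))) \<le> \<epsilon> * (indicator V z * ?wt z)"
    proof (cases "z \<in> V \<and> sqdist F w z < \<rho>")
      case True
      have "dist w (F z) < \<delta>"
      proof (rule ccontr)
        assume "\<not> ?thesis"
        then have "\<delta>\<^sup>2 \<le> sqdist F w z"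
          unfolding sqdist_def using d by (intro power_mono) (auto simp: dist_norm norm_minus_commute)
        then show False using True \<rho>' by simp
      qed
      then have "norm (h z - a) * ?wt z \<le> \<epsilon> * ?wt z" using le True by (intro mult_right_mono) auto
      moreover have "indicator V z *\<^sub>R (h z * complex_of_real (?wt z))
        - a * (indicator V z *\<^sub>R (1 * complex_of_real (?wt z))) = (h z - a) * complex_of_real (?wt z)"
        using True by (simp add: left_diff_distrib)
      ultimately show ?thesis using True by (simp add: norm_mult norm_power)
    next
      case False
      then have "indicator V z *\<^sub>R complex_of_real (?wt z) = 0" "indicator V z * ?wt z = 0"
        by (auto simp: indicator_def)
      then show ?thesis by auto
    qed
  next
    show "integrable lborel (\<lambda>z. indicator V z *\<^sub>R (h z * complex_of_real (?wt z))
      - a * (indicator V z *\<^sub>R (1 * complex_of_real (?wt z))))"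
      by (rule Bochner_Integration.integrable_diff[OF int_h Bochner_Integration.integrable_mult_right[OF int_1]])
    show "integrable lborel (\<lambda>z. \<epsilon> * (indicator V z * ?wt z))"
      by (rule Bochner_Integration.integrable_mult_right[OF int_r])
  qed
  also have "(LINT z|lborel. \<epsilon> * (indicator V z * ?wt z)) = \<epsilon> * (\<rho> ^ ?N * mass V F w)"
    unfolding integral_mult_right_zero mass_eq(1)[OF pa \<rho>] ..
  finally have "norm (complex_of_real (\<rho> ^ ?N) * (fibre_trace V F h w - a * mass V F w)) \<le> \<epsilon> * (\<rho> ^ ?N * mass V F w)" .
  moreover have "norm (complex_of_real (\<rho> ^ ?N)) = \<rho> ^ ?N"
    unfolding norm_of_real using \<rho>(1) by (intro abs_of_nonneg) simp
  ultimately have "\<rho> ^ ?N * norm (fibre_trace V F h w - a * mass V F w) \<le> \<rho> ^ ?N * (\<epsilon> * mass V F w)"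
    unfolding norm_mult by (simp only: mult.left_commute)
  moreover have "\<rho> ^ ?N > 0" using \<rho>(1) by (rule zero_less_power)
  ultimately show ?thesis by (rule mult_left_le_imp_le)
qed

lemma mass_constant:
  assumes W: "open W" "connected W" and pa: "\<And>w. w \<in> W \<Longrightarrow> \<exists>r. proper_at V F w r" and w: "w1 \<in> W" "w2 \<in> W"
  shows "mass V F w1 = mass V F w2"
proof (rule has_derivative_zero_unique_connected[where f = "mass V F", OF W _ w])
  fix w assume "w \<in> W"
  let ?T = "fibre_trace V F (\<lambda>_. 1)"
  have T: "(?T has_derivative (\<lambda>v. \<Sum>j\<in>UNIV. pd j ?T w * v $ j)) (at w)"
    by (rule holomorphic_Cn_D[OF fibre_trace_holomorphic[OF pa holomorphic_Cn_const] \<open>w \<in> W\<close>])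
  have "Im (?T w) = 0" if "w \<in> W" for w
  proof -
    obtain r where r: "proper_at V F w r" using pa \<open>w \<in> W\<close> by blast
    then have "0 < (r / 2)\<^sup>2" "(r / 2)\<^sup>2 < r\<^sup>2" by (auto simp: proper_at_def power_divide)
    from mass_eq(2)[OF r this] show ?thesis by simp
  qed
  then have "((\<lambda>w. Im (?T w)) has_derivative (\<lambda>_. 0)) (at w)"
    by (intro has_derivative_transform_within_open[OF has_derivative_const W(1) \<open>w \<in> W\<close>]) auto
  from has_derivative_unique[OF has_derivative_Im[OF T] this]
  have Im0: "Im (\<Sum>j\<in>UNIV. pd j ?T w * v $ j) = 0" for v by metis
  have "(\<Sum>j\<in>UNIV. pd j ?T w * v $ j) = 0" for v
  proof -
    \<comment> \<open>Replacing \<open>v\<close> by \<i> times \<open>v\<close> turns the vanishing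
      imaginary part of the complex linear derivative into a vanishing real part.\<close>
    have "Im (\<Sum>j\<in>UNIV. pd j ?T w * (\<i> *s v) $ j) = Re (\<Sum>j\<in>UNIV. pd j ?T w * v $ j)"
      by (simp add: Im_sum Re_sum mult.commute)
    then show ?thesis using Im0[of v] Im0[of "\<i> *s v"] by (simp add: complex_eq_iff)
  qed
  then have "(?T has_derivative (\<lambda>_. 0)) (at w)" using T by simp
  from has_derivative_Re[OF this] show "(mass V F has_derivative (\<lambda>_. 0)) (at w)"
    by (simp add: mass_def[abs_def])
qed

lemma finite_common_radius:
  assumes "finite X" "\<And>x. x \<in> X \<Longrightarrow> \<exists>e>0. \<forall>e'. 0 < e' \<and> e' \<le> e \<longrightarrow> P x e'"
  shows "\<exists>e>0::real. \<forall>x\<in>X. \<forall>e'. 0 < e' \<and> e' \<le> e \<longrightarrow> P x e'"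
  using assms
proof (induction X rule: finite_induct)
  case empty then show ?case by (auto intro: exI[of _ 1])
next
  case (insert x X)
  obtain e1 where e1: "e1 > 0" "\<forall>x\<in>X. \<forall>e'. 0 < e' \<and> e' \<le> e1 \<longrightarrow> P x e'" using insert by auto
  obtain e2 where e2: "e2 > 0" "\<forall>e'. 0 < e' \<and> e' \<le> e2 \<longrightarrow> P x e'" using insert(4)[of x] by auto
  show ?case by (rule exI[of _ "min e1 e2"]) (use e1 e2 in auto)
qed

text \<open>For one \<rho> admissible for all pieces at once the kernel lives on the disjoint union
  of the \<open>V i\<close>, so the integral splits; dividing by the common power of \<rho> gives
  additivity of traces.\<close>

lemma fibre_trace_disjoint:
  fixes F :: "complex ^ 'n \<Rightarrow> complex ^ 'n"
  assumes I: "finite I" and pa: "proper_at W F w r" and pai: "\<And>i. i \<in> I \<Longrightarrow> \<exists>r. proper_at (V i) F w r"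
    and h: "holomorphic_Cn h W" "\<And>i. i \<in> I \<Longrightarrow> holomorphic_Cn h (V i)"
    and disj: "disjoint_family_on V I"
    and d: "\<delta> > 0" "\<And>z. dist w (F z) < \<delta> \<Longrightarrow> z \<in> W \<longleftrightarrow> (\<exists>i\<in>I. z \<in> V i)"
  shows "fibre_trace W F h w = (\<Sum>i\<in>I. fibre_trace (V i) F h w)"
proof -
  let ?N = "CARD('n) + 2"
  have "\<exists>e>0. \<forall>e'. 0 < e' \<and> e' \<le> e \<longrightarrow> proper_at (V i) F w e'" if i: "i \<in> I" for i
  proof -
    obtain r' where r': "proper_at (V i) F w r'" using pai[OF i] ..
    then have "r' > 0" by (simp add: proper_at_def)
    then show ?thesis using proper_at_mono[OF r', of w] by auto
  qed
  from finite_common_radius[where P = "\<lambda>i e'. proper_at (V i) F w e'", OF I this] obtain e where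
    e: "e > 0" "\<And>i e'. i \<in> I \<Longrightarrow> 0 < e' \<Longrightarrow> e' \<le> e \<Longrightarrow> proper_at (V i) F w e'" by blast
  define s where "s = min (min r e) \<delta>"
  have r: "r > 0" using pa by (simp add: proper_at_def)
  have s: "s > 0" "s \<le> r" "s \<le> e" "s \<le> \<delta>" using r e d by (auto simp: s_def)
  define \<rho> where "\<rho> = (s / 2)\<^sup>2"
  have \<rho>: "0 < \<rho>" "\<rho> < s\<^sup>2" "\<rho> \<le> s\<^sup>2" using s by (auto simp: \<rho>_def power_divide)
  have pas: "proper_at W F w s" using proper_at_mono[OF pa, of w s] s by simp
  have pasi: "proper_at (V i) F w s" if "i \<in> I" for i using e(2)[OF that s(1,3)] .
  let ?g = "\<lambda>z. h z * complex_of_real ((cmod (jac F z))\<^sup>2 * bump (\<rho> - sqdist F w z))"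
  have "trace_int W F h \<rho> w = (LINT z|lborel. (\<Sum>i\<in>I. indicator (V i) z *\<^sub>R ?g z))"
    unfolding trace_int_def
  proof (rule Bochner_Integration.integral_cong[OF refl])
    fix z
    show "indicator W z *\<^sub>R ?g z = (\<Sum>i\<in>I. indicator (V i) z *\<^sub>R ?g z)"
    proof (cases "sqdist F w z < \<rho>")
      case True
      have "dist w (F z) < \<delta>"
      proof (rule ccontr)
        assume "\<not> ?thesis"
        then have "s \<le> norm (F z - w)" using s(4) by (simp add: dist_norm norm_minus_commute)
        then have "s\<^sup>2 \<le> sqdist F w z" unfolding sqdist_def using s by (intro power_mono) auto
        then show False using True \<rho> by simp
      qed
      then have "indicator W z = (indicator (\<Union>i\<in>I. V i) z :: real)" using d(2) by (auto simp: indicator_def)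
      also have "\<dots> = (\<Sum>i\<in>I. indicator (V i) z)" by (rule indicator_UN_disjoint[OF I disj])
      finally show ?thesis by (simp add: scaleR_sum_left)
    qed simp
  qed
  also have "\<dots> = (\<Sum>i\<in>I. trace_int (V i) F h \<rho> w)"
    unfolding trace_int_def
  proof (rule Bochner_Integration.integral_sum)
    fix i assume i: "i \<in> I"
    show "integrable lborel (\<lambda>z. indicator (V i) z *\<^sub>R ?g z)"
      by (rule integrable_trace_int[OF pasi[OF i] h(2)[OF i] \<rho>(3) _ _ holomorphic_Cn_continuous_on[OF h(2)[OF i]]])
        (use s in auto)
  qed
  finally have "complex_of_real (\<rho> ^ ?N) * fibre_trace W F h w
      = (\<Sum>i\<in>I. complex_of_real (\<rho> ^ ?N) * fibre_trace (V i) F h w)"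
    using trace_int_eq[OF pas h(1) \<rho>(1,2)] trace_int_eq[OF pasi h(2) \<rho>(1,2)] by simp
  then have "complex_of_real (\<rho> ^ ?N) * fibre_trace W F h w
      = complex_of_real (\<rho> ^ ?N) * (\<Sum>i\<in>I. fibre_trace (V i) F h w)"
    by (simp only: sum_distrib_left)
  then show ?thesis using \<rho>(1) by (simp del: of_real_power)
qed

section \<open>Isolated fibre points and their weights\<close>

text \<open>The closed ball keeps the bounding sphere inside the domain and off the fibre; this
  makes the restriction to the open ball proper over a small ball about
  \<open>F \<zeta>\<close>.\<close>

definition isolating :: "(complex ^ 'n \<Rightarrow> complex ^ 'n) \<Rightarrow> complex ^ 'n \<Rightarrow> real \<Rightarrow> bool" where
  "isolating F \<zeta> e \<longleftrightarrow> e > 0 \<and> (\<exists>V. open V \<and> cball \<zeta> e \<subseteq> V \<and> holomorphic_map_Cn F V) \<and>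
     (\<forall>z\<in>cball \<zeta> e. F z = F \<zeta> \<longrightarrow> z = \<zeta>)"

text \<open>The local multiplicity of \<open>F\<close> at \<zeta>, in the same unspecified unit as
  \<open>mass\<close>. The choice of the radius is harmless by \<open>weight_eq\<close>.\<close>

definition weight :: "(complex ^ 'n \<Rightarrow> complex ^ 'n) \<Rightarrow> complex ^ 'n \<Rightarrow> real" where
  "weight F \<zeta> = mass (ball \<zeta> (SOME e. isolating F \<zeta> e)) F (F \<zeta>)"

lemma isolating_smaller: "isolating F \<zeta> e \<Longrightarrow> 0 < e' \<Longrightarrow> e' \<le> e \<Longrightarrow> isolating F \<zeta> e'"
  unfolding isolating_def by (meson cball_subset_cball_iff order_trans subsetD subset_cball)

lemma holomorphic_map_subset: "holomorphic_map_Cn F V \<Longrightarrow> W \<subseteq> V \<Longrightarrow> holomorphic_map_Cn F W"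
  unfolding holomorphic_map_Cn_def by (blast intro: holomorphic_Cn_subset)

text \<open>On the compact sphere \<open>F\<close> stays farther than some \<open>r\<close> from
  \<open>F \<zeta>\<close>. Over the closed ball of radius \<open>r\<close> the preimages in the
  open and in the closed ball therefore agree, and the latter is compact.\<close>

lemma isolating_proper:
  assumes "isolating F \<zeta> e"
  shows "\<exists>r. proper_at (ball \<zeta> e) F (F \<zeta>) r"
proof -
  obtain V where V: "open V" "cball \<zeta> e \<subseteq> V" "holomorphic_map_Cn F V" and e: "e > 0"
    and iso: "\<And>z. z \<in> cball \<zeta> e \<Longrightarrow> F z = F \<zeta> \<Longrightarrow> z = \<zeta>"
    using assms unfolding isolating_def by blast
  have cont: "continuous_on (cball \<zeta> e) F"
    by (rule continuous_on_subset[OF holomorphic_map_continuous_on[OF V(3)] V(2)])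
  obtain r where r: "r > 0" "\<And>z. z \<in> sphere \<zeta> e \<Longrightarrow> r < dist (F \<zeta>) (F z)"
  proof (cases "sphere \<zeta> e = {}")
    case True then show thesis using that[of 1] by simp
  next
    case False
    have "continuous_on (sphere \<zeta> e) (\<lambda>z. dist (F \<zeta>) (F z))"
      by (intro continuous_intros continuous_on_subset[OF cont]) auto
    then obtain q where q: "q \<in> sphere \<zeta> e" "\<And>z. z \<in> sphere \<zeta> e \<Longrightarrow> dist (F \<zeta>) (F q) \<le> dist (F \<zeta>) (F z)"
      using continuous_attains_inf[OF compact_sphere False] by blast
    have "F q \<noteq> F \<zeta>" using iso[of q] q(1) e by auto
    then have pos: "dist (F \<zeta>) (F q) > 0" by simp
    have "dist (F \<zeta>) (F q) / 2 < dist (F \<zeta>) (F z)" if z: "z \<in> sphere \<zeta> e" for z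
      using q(2)[OF z] pos by linarith
    then show thesis using that[of "dist (F \<zeta>) (F q) / 2"] pos by simp
  qed
  have "closed (cball \<zeta> e \<inter> F -` cball (F \<zeta>) r)"
    by (rule continuous_closed_preimage[OF cont]) auto
  then have "compact (cball \<zeta> e \<inter> (cball \<zeta> e \<inter> F -` cball (F \<zeta>) r))"
    by (rule compact_Int_closed[OF compact_cball])
  moreover have "cball \<zeta> e \<inter> (cball \<zeta> e \<inter> F -` cball (F \<zeta>) r) = ball \<zeta> e \<inter> F -` cball (F \<zeta>) r"
    using r(2) by (force simp: less_le)
  ultimately have "proper_at (ball \<zeta> e) F (F \<zeta>) r"
    unfolding proper_at_def using r(1) holomorphic_map_subset[OF V(3), of "ball \<zeta> e"] V(2)
    by (metis ball_subset_cball open_ball order_trans)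
  then show ?thesis ..
qed

lemma isolating_mass_le:
  assumes "isolating F \<zeta> e" "0 < e'" "e' \<le> e"
  shows "mass (ball \<zeta> e) F (F \<zeta>) = mass (ball \<zeta> e') F (F \<zeta>)"
proof -
  obtain r where r: "proper_at (ball \<zeta> e) F (F \<zeta>) r" using isolating_proper[OF assms(1)] ..
  have "ball \<zeta> e \<inter> F -` {F \<zeta>} \<subseteq> ball \<zeta> e'"
    using assms by (auto simp: isolating_def)
  then obtain \<delta> where d: "\<delta> > 0" "\<And>z. z \<in> ball \<zeta> e \<Longrightarrow> dist (F \<zeta>) (F z) \<le> \<delta> \<Longrightarrow> z \<in> ball \<zeta> e'"
    using fibre_nearby[OF r open_ball] by metis
  show ?thesis
    by (rule mass_cong[OF _ d(1)]) (use d(2) assms(3) in \<open>auto simp: less_imp_le\<close>)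
qed

lemma weight_eq:
  assumes "isolating F \<zeta> e"
  shows "mass (ball \<zeta> e) F (F \<zeta>) = weight F \<zeta>"
proof -
  let ?e = "SOME e. isolating F \<zeta> e"
  have iso: "isolating F \<zeta> ?e" using assms by (rule someI)
  have pos: "min e ?e > 0" using assms iso by (simp add: isolating_def)
  show ?thesis
    unfolding weight_def using isolating_mass_le[OF assms pos] isolating_mass_le[OF iso pos] by simp
qed

text \<open>Near the fibre \<open>h\<close> is arbitrarily close to its value at the only fibre
  point \<zeta>, so \<open>fibre_trace_bound\<close> squeezes the difference to zero.\<close>

lemma fibre_trace_isolating:
  assumes iso: "isolating F \<zeta> e" and h: "holomorphic_Cn h (ball \<zeta> e)"
  shows "fibre_trace (ball \<zeta> e) F h (F \<zeta>) = h \<zeta> * weight F \<zeta>"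
proof -
  obtain r where r: "proper_at (ball \<zeta> e) F (F \<zeta>) r" using isolating_proper[OF iso] ..
  have e: "e > 0" using iso by (simp add: isolating_def)
  let ?d = "norm (fibre_trace (ball \<zeta> e) F h (F \<zeta>) - h \<zeta> * weight F \<zeta>)"
  have le: "?d \<le> \<epsilon> * weight F \<zeta>" if "\<epsilon> > 0" for \<epsilon>
  proof -
    have "isCont h \<zeta>"
      using holomorphic_Cn_continuous_on[OF h] e by (simp add: continuous_on_eq_continuous_at)
    then obtain \<eta> where eta: "\<eta> > 0" "\<And>z. dist z \<zeta> < \<eta> \<Longrightarrow> dist (h z) (h \<zeta>) < \<epsilon>"
      using \<open>\<epsilon> > 0\<close> unfolding continuous_at_eps_delta by blast
    have "ball \<zeta> e \<inter> F -` {F \<zeta>} \<subseteq> ball \<zeta> \<eta>" using iso eta by (auto simp: isolating_def)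
    then obtain \<delta> where d: "\<delta> > 0" "\<And>z. z \<in> ball \<zeta> e \<Longrightarrow> dist (F \<zeta>) (F z) \<le> \<delta> \<Longrightarrow> z \<in> ball \<zeta> \<eta>"
      using fibre_nearby[OF r open_ball] by metis
    have "norm (fibre_trace (ball \<zeta> e) F h (F \<zeta>) - h \<zeta> * mass (ball \<zeta> e) F (F \<zeta>)) \<le> \<epsilon> * mass (ball \<zeta> e) F (F \<zeta>)"
    proof (rule fibre_trace_bound[OF r h d(1)])
      fix z assume "z \<in> ball \<zeta> e" "dist (F \<zeta>) (F z) < \<delta>"
      then have "dist z \<zeta> < \<eta>" using d(2)[of z] by (simp add: dist_commute)
      from eta(2)[OF this] show "norm (h z - h \<zeta>) \<le> \<epsilon>" by (simp add: dist_norm)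
    qed
    then show ?thesis unfolding weight_eq[OF iso] .
  qed
  have nn: "weight F \<zeta> \<ge> 0"
    using mass_eq(3)[OF r, of "(r / 2)\<^sup>2"] r unfolding weight_eq[OF iso]
    by (auto simp: proper_at_def power_divide)
  have "?d \<le> 0"
  proof (rule field_le_epsilon)
    fix \<epsilon> :: real assume "\<epsilon> > 0"
    \<comment> \<open>Adding 1 keeps the quotient meaningful when the weight is 0.\<close>
    have "?d \<le> \<epsilon> / (weight F \<zeta> + 1) * weight F \<zeta>" by (rule le) (use \<open>\<epsilon> > 0\<close> nn in auto)
    also have "\<dots> \<le> \<epsilon>" using \<open>\<epsilon> > 0\<close> nn by (simp add: divide_le_eq mult_left_mono)
    finally show "?d \<le> 0 + \<epsilon>" by simp
  qed
  then show ?thesis by simp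
qed

lemma finite_fibre_radius:
  assumes V: "open V" "holomorphic_map_Cn F V" and fin: "finite (V \<inter> F -` {w})"
  obtains e where "e > 0" "\<And>\<zeta>. \<zeta> \<in> V \<inter> F -` {w} \<Longrightarrow> isolating F \<zeta> e \<and> cball \<zeta> e \<subseteq> V"
    "disjoint_family_on (\<lambda>\<zeta>. ball \<zeta> e) (V \<inter> F -` {w})"
proof -
  let ?X = "V \<inter> F -` {w}"
  have "\<exists>e>0. \<forall>e'. 0 < e' \<and> e' \<le> e \<longrightarrow> cball \<zeta> e' \<subseteq> V \<and> (\<forall>\<xi>\<in>?X. \<xi> \<noteq> \<zeta> \<longrightarrow> 2 * e' < dist \<zeta> \<xi>)" if z: "\<zeta> \<in> ?X" for \<zeta>
  proof -
    have "\<zeta> \<in> V" using z by blast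
    then obtain e1 where e1: "e1 > 0" "cball \<zeta> e1 \<subseteq> V" using V(1) unfolding open_contains_cball by blast
    obtain d where d: "d > 0" "\<forall>x\<in>?X. x \<noteq> \<zeta> \<longrightarrow> d \<le> dist \<zeta> x"
      using finite_set_avoid[OF fin] by blast
    show ?thesis
    proof (rule exI[of _ "min e1 (d / 3)"], intro conjI allI impI ballI)
      fix e' assume e': "0 < e' \<and> e' \<le> min e1 (d / 3)"
      then have "cball \<zeta> e' \<subseteq> cball \<zeta> e1" by (intro subset_cball) auto
      then show "cball \<zeta> e' \<subseteq> V" using e1 by blast
      fix \<xi> assume "\<xi> \<in> ?X" "\<xi> \<noteq> \<zeta>"
      then have "d \<le> dist \<zeta> \<xi>" using d(2) by blast
      then show "2 * e' < dist \<zeta> \<xi>" using e' d(1) by auto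
    qed (use e1 d in auto)
  qed
  from finite_common_radius[where P = "\<lambda>\<zeta> e'. cball \<zeta> e' \<subseteq> V \<and> (\<forall>\<xi>\<in>?X. \<xi> \<noteq> \<zeta> \<longrightarrow> 2 * e' < dist \<zeta> \<xi>)", OF fin this]
  obtain e where e: "e > 0"
    "\<forall>\<zeta>\<in>?X. \<forall>e'. 0 < e' \<and> e' \<le> e \<longrightarrow> cball \<zeta> e' \<subseteq> V \<and> (\<forall>\<xi>\<in>?X. \<xi> \<noteq> \<zeta> \<longrightarrow> 2 * e' < dist \<zeta> \<xi>)"
    by blast
  have eV: "cball \<zeta> e \<subseteq> V" and sep: "\<And>\<xi>. \<xi> \<in> ?X \<Longrightarrow> \<xi> \<noteq> \<zeta> \<Longrightarrow> 2 * e < dist \<zeta> \<xi>" if "\<zeta> \<in> ?X" for \<zeta>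
    using e that by (meson order_refl)+
  show thesis
  proof (rule that[OF e(1)])
    fix \<zeta> assume z: "\<zeta> \<in> ?X"
    have "\<xi> = \<zeta>" if x: "\<xi> \<in> cball \<zeta> e" "F \<xi> = F \<zeta>" for \<xi>
    proof (rule ccontr)
      assume "\<xi> \<noteq> \<zeta>"
      moreover have "\<xi> \<in> ?X" using x z eV[OF z] by auto
      ultimately have "2 * e < dist \<zeta> \<xi>" using sep[OF z] by blast
      then show False using x(1) e(1) by simp
    qed
    then show "isolating F \<zeta> e \<and> cball \<zeta> e \<subseteq> V"
      unfolding isolating_def using e(1) V eV[OF z] by blast
  next
    show "disjoint_family_on (\<lambda>\<zeta>. ball \<zeta> e) ?X"
      unfolding disjoint_family_on_def
    proof (intro ballI impI)
      fix \<zeta> \<xi> assume zx: "\<zeta> \<in> ?X" "\<xi> \<in> ?X" "\<zeta> \<noteq> \<xi>"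
      have "2 * e < dist \<zeta> \<xi>" using sep[OF zx(1,2)] zx(3) by blast
      then show "ball \<zeta> e \<inter> ball \<xi> e = {}" by (intro disjoint_ballI) simp
    qed
  qed
qed

text \<open>Over a small neighbourhood of \<open>w\<close> only the disjoint balls about the fibre
  points matter, and each contributes the value of \<open>h\<close> at its centre times the weight
  there.\<close>

lemma fibre_trace_finite:
  assumes pa: "proper_at V F w r" and h: "holomorphic_Cn h V" and fin: "finite (V \<inter> F -` {w})"
  shows "fibre_trace V F h w = (\<Sum>\<zeta>\<in>V \<inter> F -` {w}. h \<zeta> * weight F \<zeta>)"
proof -
  let ?X = "V \<inter> F -` {w}"
  have V: "open V" "holomorphic_map_Cn F V" using pa by (auto simp: proper_at_def)
  obtain e where e: "e > 0" and iso: "\<And>\<zeta>. \<zeta> \<in> ?X \<Longrightarrow> isolating F \<zeta> e \<and> cball \<zeta> e \<subseteq> V"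
    and disj: "disjoint_family_on (\<lambda>\<zeta>. ball \<zeta> e) ?X"
    using finite_fibre_radius[OF V fin] by metis
  have sub: "ball \<zeta> e \<subseteq> V" if "\<zeta> \<in> ?X" for \<zeta> using iso[OF that] ball_subset_cball by blast
  have hb: "holomorphic_Cn h (ball \<zeta> e)" if "\<zeta> \<in> ?X" for \<zeta>
    by (rule holomorphic_Cn_subset[OF h sub[OF that]])
  have Fw: "F \<zeta> = w" if "\<zeta> \<in> ?X" for \<zeta> using that by simp
  have "open (\<Union>\<zeta>\<in>?X. ball \<zeta> e)" "?X \<subseteq> (\<Union>\<zeta>\<in>?X. ball \<zeta> e)" using e by auto
  from fibre_nearby[OF pa this] obtain \<delta> where
    d: "\<delta> > 0" "\<And>z. z \<in> V \<Longrightarrow> dist w (F z) \<le> \<delta> \<Longrightarrow> z \<in> (\<Union>\<zeta>\<in>?X. ball \<zeta> e)" by metis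
  have "fibre_trace V F h w = (\<Sum>\<zeta>\<in>?X. fibre_trace (ball \<zeta> e) F h w)"
  proof (rule fibre_trace_disjoint[OF fin pa _ h hb disj d(1)])
    show "\<exists>r. proper_at (ball \<zeta> e) F w r" if "\<zeta> \<in> ?X" for \<zeta>
      using isolating_proper[of F \<zeta> e] iso[OF that] Fw[OF that] by simp
    show "z \<in> V \<longleftrightarrow> (\<exists>\<zeta>\<in>?X. z \<in> ball \<zeta> e)" if "dist w (F z) < \<delta>" for z
      using d(2)[of z] that sub by force
  qed
  also have "\<dots> = (\<Sum>\<zeta>\<in>?X. h \<zeta> * weight F \<zeta>)"
  proof (rule sum.cong[OF refl])
    fix \<zeta> assume z: "\<zeta> \<in> ?X"
    show "fibre_trace (ball \<zeta> e) F h w = h \<zeta> * weight F \<zeta>"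
      using fibre_trace_isolating[of F \<zeta> e h] iso[OF z] hb[OF z] Fw[OF z] by simp
  qed
  finally show ?thesis .
qed

section \<open>Positive mass and solvability\<close>

lemma mass_pos:
  fixes F :: "complex ^ 'n \<Rightarrow> complex ^ 'n"
  assumes pa: "proper_at V F w r" and z0: "z0 \<in> V" "F z0 = w"
    and nz: "\<And>W. open W \<Longrightarrow> z0 \<in> W \<Longrightarrow> W \<subseteq> V \<Longrightarrow> \<exists>z\<in>W. jac F z \<noteq> 0"
  shows "mass V F w > 0"
proof -
  have r: "r > 0" and V: "open V" and F: "holomorphic_map_Cn F V" using pa by (auto simp: proper_at_def)
  define \<rho> where "\<rho> = (r / 2)\<^sup>2"
  have \<rho>: "0 < \<rho>" "\<rho> < r\<^sup>2" using r by (auto simp: \<rho>_def power_divide)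
  let ?wt = "\<lambda>z. (cmod (jac F z))\<^sup>2 * bump (\<rho> - sqdist F w z)"
  have h1: "holomorphic_Cn (\<lambda>_. 1) V" by simp
  have cont: "continuous_on V (\<lambda>z. \<rho> - sqdist F w z)"
    unfolding sqdist_def by (intro continuous_intros holomorphic_map_continuous_on[OF F])
  define W where "W = V \<inter> (\<lambda>z. \<rho> - sqdist F w z) -` {0<..}"
  have oW: "open W" unfolding W_def by (rule continuous_open_preimage[OF cont V]) simp
  have "z0 \<in> W" using z0 \<rho> by (simp add: W_def sqdist_def)
  then obtain z1 where z1: "z1 \<in> W" "jac F z1 \<noteq> 0" using nz[OF oW] by (auto simp: W_def)
  have oS: "open (W \<inter> jac F -` (- {0}))"
    by (rule continuous_open_preimage[OF continuous_on_subset[OF holomorphic_Cn_continuous_on[OF jac_holomorphic[OF F V]]] oW])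
      (auto simp: W_def)
  have "z1 \<in> W \<inter> jac F -` (- {0})" using z1 by simp
  then obtain e where e: "e > 0" "ball z1 e \<subseteq> W \<inter> jac F -` (- {0})" by (rule openE[OF oS])
  have pos: "indicator V z * ?wt z > 0" if "z \<in> ball z1 e" for z
    using subsetD[OF e(2) that] by (auto simp: W_def bump_pos)
  have int: "integrable lborel (\<lambda>z. indicator V z * ?wt z)"
  proof -
    have "integrable lborel (\<lambda>z. indicator V z *\<^sub>R (1 * complex_of_real (?wt z)))"
      by (rule integrable_trace_int[OF pa h1, of _ r]) (use \<rho> r in auto)
    from integrable_Re[OF this] show ?thesis by (simp del: of_real_power)
  qed
  have "(LINT z|lborel. indicator V z * ?wt z) \<noteq> 0"
  proof
    assume "(LINT z|lborel. indicator V z * ?wt z) = 0"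
    then have "AE z in lborel. indicator V z * ?wt z = 0"
      using integral_nonneg_eq_0_iff_AE[OF int] by simp
    then obtain N where N: "{z \<in> space lborel. \<not> indicator V z * ?wt z = 0} \<subseteq> N" "emeasure lborel N = 0" "N \<in> sets lborel"
      by (rule AE_E)
    have "ball z1 e \<subseteq> N" using N(1) pos by force
    then have "emeasure lborel (ball z1 e) \<le> emeasure lborel N" by (rule emeasure_mono[OF _ N(3)])
    then have "measure lborel (ball z1 e) = 0" using N(2) by (simp add: measure_def)
    then show False using content_ball_pos[OF e(1), of z1] by simp
  qed
  then show ?thesis
    using mass_eq(1)[OF pa \<rho>] mass_eq(3)[OF pa \<rho>] \<rho> by (auto simp: less_le)
qed

text \<open>If the fibre is empty, so are the nearby ones, and the mass agrees with that of the
  empty domain. Together with \<open>mass_constant\<close> this carries solvability from one value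
  to a whole connected set.\<close>

lemma mass_nonzero_imp_fibre:
  assumes pa: "proper_at V F w r" and nz: "mass V F w \<noteq> 0"
  shows "\<exists>z\<in>V. F z = w"
proof (rule ccontr)
  assume "\<not> ?thesis"
  then have "V \<inter> F -` {w} \<subseteq> {}" by blast
  then obtain \<delta> where d: "\<delta> > 0" "\<And>z. z \<in> V \<Longrightarrow> dist w (F z) \<le> \<delta> \<Longrightarrow> z \<in> {}"
    using fibre_nearby[OF pa open_empty] by metis
  have r: "r > 0" using pa by (simp add: proper_at_def)
  have "mass V F w = mass {} F w" by (rule mass_cong[OF _ d(1)]) (use d(2) in force)
  moreover have pa0: "proper_at {} F w r" using r by (simp add: proper_at_def holomorphic_map_Cn_def holomorphic_Cn_def)
  have "0 < (r / 2)\<^sup>2" "(r / 2)\<^sup>2 < r\<^sup>2" using r by (auto simp: power_divide)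
  from mass_eq(1)[OF pa0 this] have "mass {} F w = 0" using r by simp
  ultimately show False using nz by simp
qed

text \<open>By injectivity each nearby \<open>z\<close> is alone in its fibre within
  \<open>ball \<zeta> e\<close>. Its weight is thus the mass of that same ball over another value,
  and this mass is constant.\<close>

lemma isolating_weight_near:
  assumes iso: "isolating F \<zeta> e" and inj: "inj_on F (ball \<zeta> e)"
  obtains d where "d > 0" "d < e" "\<And>z. z \<in> ball \<zeta> d \<Longrightarrow> weight F z = weight F \<zeta>"
proof -
  obtain r where r: "proper_at (ball \<zeta> e) F (F \<zeta>) r" using isolating_proper[OF iso] ..
  have e: "e > 0" and r0: "r > 0" using iso r by (auto simp: isolating_def proper_at_def)
  obtain V where V: "open V" "cball \<zeta> e \<subseteq> V" "holomorphic_map_Cn F V"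
    using iso unfolding isolating_def by blast
  have pa: "proper_at (ball \<zeta> e) F w (r - dist (F \<zeta>) w)" if "w \<in> ball (F \<zeta>) r" for w
    by (rule proper_at_mono[OF r]) (use that in auto)
  have "open (ball \<zeta> e \<inter> F -` ball (F \<zeta>) r)"
    by (rule continuous_open_preimage[OF holomorphic_map_continuous_on]) (use r in \<open>auto simp: proper_at_def\<close>)
  moreover have "\<zeta> \<in> ball \<zeta> e \<inter> F -` ball (F \<zeta>) r" using e r0 by simp
  ultimately obtain d where d: "d > 0" "ball \<zeta> d \<subseteq> ball \<zeta> e \<inter> F -` ball (F \<zeta>) r" by (rule openE)
  define d' where "d' = min d (e / 2)"
  show thesis
  proof (rule that[of d'])
    fix z assume "z \<in> ball \<zeta> d'"
    then have z: "z \<in> ball \<zeta> e" "F z \<in> ball (F \<zeta>) r" using d(2) by (auto simp: d'_def)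
    obtain s0 where s0: "s0 > 0" "ball z s0 \<subseteq> ball \<zeta> e" by (rule openE[OF open_ball z(1)])
    define s where "s = s0 / 2"
    have "cball z s \<subseteq> ball z s0" using s0(1) by (auto simp: s_def)
    then have s: "s > 0" "cball z s \<subseteq> ball \<zeta> e" using s0 by (auto simp: s_def)
    have isoz: "isolating F z s"
      unfolding isolating_def
    proof (intro conjI exI[of _ V] ballI impI)
      show "cball z s \<subseteq> V" using s(2) V(2) ball_subset_cball by blast
      fix y assume "y \<in> cball z s" "F y = F z"
      then show "y = z" using inj_onD[OF inj] s(2) z(1) by blast
    qed (use s V in auto)
    have "ball \<zeta> e \<inter> F -` {F z} \<subseteq> ball z s"
    proof
      fix y assume "y \<in> ball \<zeta> e \<inter> F -` {F z}"
      then have "y = z" using inj_onD[OF inj _ _ z(1)] by blast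
      then show "y \<in> ball z s" using s(1) by simp
    qed
    then obtain \<delta> where de: "\<delta> > 0" "\<And>y. y \<in> ball \<zeta> e \<Longrightarrow> dist (F z) (F y) \<le> \<delta> \<Longrightarrow> y \<in> ball z s"
      using fibre_nearby[OF pa[OF z(2)] open_ball] by metis
    have "weight F z = mass (ball z s) F (F z)" by (rule weight_eq[OF isoz, symmetric])
    also have "\<dots> = mass (ball \<zeta> e) F (F z)"
      by (rule mass_cong[OF _ de(1)]) (use de(2) s(2) ball_subset_cball in force)
    also have "\<dots> = mass (ball \<zeta> e) F (F \<zeta>)"
      by (rule mass_constant[of "ball (F \<zeta>) r"]) (use pa z r0 in \<open>auto intro: convex_connected\<close>)
    also have "\<dots> = weight F \<zeta>" by (rule weight_eq[OF iso])
    finally show "weight F z = weight F \<zeta>" .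
  qed (use d e in \<open>auto simp: d'_def\<close>)
qed

section \<open>Proper holomorphic maps\<close>

text \<open>The determinant is a polynomial in \<open>t\<close> with value 1 at t = 1, so it cannot
  vanish on a neighbourhood of 0.\<close>

lemma det_affine_nonzero:
  fixes A :: "complex ^ 'n ^ 'n"
  assumes "\<delta> > 0"
  shows "\<exists>t. norm t < \<delta> \<and> det (\<chi> k j. (1 - t) * A $ k $ j + t * (if j = k then 1 else 0)) \<noteq> 0"
proof (rule ccontr)
  assume neg: "\<not> ?thesis"
  let ?p = "\<lambda>t. det (\<chi> k j. (1 - t) * A $ k $ j + t * (if j = k then 1 else 0))"
  have hol: "?p holomorphic_on UNIV"
    unfolding det_def by (intro holomorphic_intros holomorphic_on_prod) (auto intro!: holomorphic_intros)
  have lim: "0 islimpt ball (0::complex) \<delta>" using assms by (simp add: islimpt_ball)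
  have "?p 1 = 0"
    by (rule analytic_continuation[OF hol open_UNIV connected_UNIV _ UNIV_I lim]) (use neg in auto)
  moreover have "(\<chi> k j. (1 - 1) * A $ k $ j + 1 * (if j = k then 1 else 0)) = (mat 1 :: complex ^ 'n ^ 'n)"
    by (simp add: mat_def vec_eq_iff)
  ultimately show False by (simp add: det_I)
qed

text \<open>
  A fibre is nonempty stably: for generic small \<open>t\<close> the map \<open>(1 - t) f + t id\<close> has a regular
  point near the given one, so the masses of its fibres are positive on a whole ball; then \<open>t \<rightarrow> 0\<close>.
\<close>

lemma proper_at_image_ball:
  fixes f :: "complex ^ 'n \<Rightarrow> complex ^ 'n"
  assumes pa: "proper_at D f w0 R" and z0: "z0 \<in> D" "f z0 = w0"
  shows "ball w0 (R / 2) \<subseteq> f ` D"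
proof
  fix w assume w: "w \<in> ball w0 (R / 2)"
  have R: "R > 0" and D: "open D" and f: "holomorphic_map_Cn f D" using pa by (auto simp: proper_at_def)
  define X where "X = D \<inter> f -` cball w0 R"
  have cX: "compact X" using pa by (simp add: proper_at_def X_def)
  have cf: "continuous_on X f"
    by (rule continuous_on_subset[OF holomorphic_map_continuous_on[OF f]]) (auto simp: X_def)
  have "bounded ((\<lambda>z. z - f z) ` X)"
    by (intro compact_imp_bounded compact_continuous_image continuous_intros cf cX)
  then obtain M where M: "M > 0" "\<And>z. z \<in> X \<Longrightarrow> norm (z - f z) \<le> M"
    unfolding bounded_pos by auto
  define V where "V = D \<inter> f -` ball w0 R"
  have V: "open V" unfolding V_def
    by (rule continuous_open_preimage[OF holomorphic_map_continuous_on[OF f] D open_ball])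
  have VX: "V \<subseteq> X" and VD: "V \<subseteq> D" by (auto simp: V_def X_def)
  have z0V: "z0 \<in> V" using z0 R by (simp add: V_def)
  \<comment> \<open>Solving up to \<eta> is enough because the image of the compact set
    \<open>X\<close> is closed.\<close>
  have approx: "\<exists>z\<in>X. norm (f z - w) < \<eta>" if eta: "\<eta> > 0" for \<eta>
  proof -
    \<comment> \<open>Since g(z) - f(z) = t (z - f(z)) and \<open>M\<close> bounds the norm of z -
      f(z) on \<open>X\<close>, such a \<open>t\<close> moves the values by less than both \<eta>
      and R/8.\<close>
    define \<delta> where "\<delta> = min \<eta> (R / 8) / M"
    have d: "\<delta> > 0" using eta R M by (simp add: \<delta>_def)
    obtain t where t: "norm t < \<delta>"
      "det (\<chi> k j. (1 - t) * jac_matrix f z0 $ k $ j + t * (if j = k then 1 else 0)) \<noteq> 0"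
      using det_affine_nonzero[OF d] by blast
    have tM: "norm t * M < \<eta>" "norm t * M < R / 8"
      using t(1) M by (auto simp: \<delta>_def pos_less_divide_eq)
    define g where "g z = (1 - t) *s f z + t *s z" for z
    have g_f: "g z - f z = t *s (z - f z)" for z by (simp add: g_def vec_eq_iff algebra_simps)
    have norm_ts: "norm (t *s x) = norm t * norm x" for x :: "complex ^ 'n"
      by (simp add: norm_vec_def norm_mult L2_set_right_distrib)
    have near: "norm (g z - f z) < \<eta>" "norm (g z - f z) < R / 8" if "z \<in> X" for z
    proof -
      have "norm (g z - f z) \<le> norm t * M"
        unfolding g_f norm_ts using M(2)[OF that] by (intro mult_left_mono) auto
      then show "norm (g z - f z) < \<eta>" "norm (g z - f z) < R / 8" using tM by linarith+
    qed
    have hol_g: "holomorphic_map_Cn g D"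
      unfolding holomorphic_map_Cn_def g_def
      by (simp only: vector_add_component vector_smult_component, intro allI holomorphic_Cn_add
          holomorphic_Cn_mult holomorphic_Cn_const holomorphic_Cn_coord holomorphic_map_component[OF f])
    have hol_gV: "holomorphic_map_Cn g V" by (rule holomorphic_map_subset[OF hol_g VD])
    have pd_g: "pd j (\<lambda>z. g z $ k) z0 = (1 - t) * pd j (\<lambda>z. f z $ k) z0 + t * (if j = k then 1 else 0)" for j k
    proof (rule pd_eq)
      have "((\<lambda>z. (1 - t) * (f z $ k) + t * z $ k) has_derivative
          (\<lambda>v. (1 - t) * (\<Sum>j\<in>UNIV. pd j (\<lambda>z. f z $ k) z0 * v $ j) + t * v $ k)) (at z0)"
        by (intro has_derivative_add has_derivative_mult_right
            holomorphic_Cn_D[OF holomorphic_map_component[OF f] z0(1)]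
            bounded_linear_imp_has_derivative bounded_linear_vec_nth)
      moreover have "(1 - t) * (\<Sum>j\<in>UNIV. pd j (\<lambda>z. f z $ k) z0 * v $ j) + t * v $ k
          = (\<Sum>j\<in>UNIV. ((1 - t) * pd j (\<lambda>z. f z $ k) z0 + t * (if j = k then 1 else 0)) * v $ j)"
        for v :: "complex ^ 'n"
        by (simp add: distrib_right sum.distrib sum_distrib_left mult.assoc if_distrib[of "\<lambda>x. _ * x"]
            if_distrib[of "\<lambda>x. x * _"] cong: if_cong)
      ultimately show "((\<lambda>z. g z $ k) has_derivative
          (\<lambda>v. \<Sum>j\<in>UNIV. ((1 - t) * pd j (\<lambda>z. f z $ k) z0 + t * (if j = k then 1 else 0)) * v $ j)) (at z0)"
        by (simp only: g_def vector_add_component vector_smult_component)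
    qed
    have jac: "jac g z0 \<noteq> 0"
      using t(2) by (simp add: jac_def jac_matrix_def pd_g)
    \<comment> \<open>As R/2 + R/4 + R/8 < R, points of \<open>X\<close> with \<open>g z\<close> in
      \<open>cball w' (R / 4)\<close> have \<open>f z\<close> in the open ball of radius
      \<open>R\<close>. The preimage under \<open>g\<close> thus stays inside \<open>V\<close> while
      being closed in the compact set \<open>X\<close>.\<close>
    have pag: "proper_at V g w' (R / 4)" if w': "w' \<in> ball w0 (R / 2)" for w'
    proof -
      have eq: "V \<inter> g -` cball w' (R / 4) = X \<inter> g -` cball w' (R / 4)"
      proof
        show "X \<inter> g -` cball w' (R / 4) \<subseteq> V \<inter> g -` cball w' (R / 4)"
        proof
          fix z assume z: "z \<in> X \<inter> g -` cball w' (R / 4)"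
          have "dist w0 (f z) \<le> dist w0 w' + (dist w' (g z) + dist (g z) (f z))"
            using dist_triangle[of w0 "f z" w'] dist_triangle[of w' "f z" "g z"] by linarith
          also have "\<dots> < R / 2 + (R / 4 + R / 8)"
            using z w' near(2)[of z] by (intro add_less_le_mono add_mono) (auto simp: dist_norm[of "g z"])
          also have "\<dots> < R" using R by simp
          finally show "z \<in> V \<inter> g -` cball w' (R / 4)" using z by (auto simp: V_def X_def)
        qed
      qed (use VX in auto)
      have "continuous_on X g"
        by (rule continuous_on_subset[OF holomorphic_map_continuous_on[OF hol_g]]) (auto simp: X_def)
      then have "closed (X \<inter> g -` cball w' (R / 4))"
        by (rule continuous_closed_preimage[OF _ compact_imp_closed[OF cX] closed_cball])
      then have "compact (X \<inter> (X \<inter> g -` cball w' (R / 4)))" by (rule compact_Int_closed[OF cX])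
      moreover have "X \<inter> (X \<inter> g -` cball w' (R / 4)) = V \<inter> g -` cball w' (R / 4)" unfolding eq by blast
      ultimately show ?thesis using V hol_gV R by (simp add: proper_at_def)
    qed
    have "norm (g z0 - w0) < R / 8" using near(2)[of z0] z0V VX z0(2) by auto
    then have gz0: "g z0 \<in> ball w0 (R / 2)" using R by (simp add: dist_norm norm_minus_commute)
    have "mass V g (g z0) > 0"
      by (rule mass_pos[OF pag[OF gz0] z0V refl]) (use jac in blast)
    moreover have "mass V g w = mass V g (g z0)"
    proof (rule mass_constant[OF open_ball convex_connected[OF convex_ball] _ w gz0])
      show "\<exists>r. proper_at V g w' r" if "w' \<in> ball w0 (R / 2)" for w'
        using pag[OF that] ..
    qed
    ultimately obtain z where z: "z \<in> V" "g z = w"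
      using mass_nonzero_imp_fibre[OF pag[OF w]] by auto
    have "z \<in> X" using z(1) VX by blast
    moreover have "norm (f z - w) < \<eta>" using near(1)[OF \<open>z \<in> X\<close>] z(2) by (simp add: norm_minus_commute)
    ultimately show ?thesis by blast
  qed
  have "w \<in> closure (f ` X)"
    unfolding closure_approachable using approx by (auto simp: dist_norm)
  moreover have "closed (f ` X)" by (intro compact_imp_closed compact_continuous_image cf cX)
  ultimately show "w \<in> f ` D" by (auto simp: X_def)
qed

section \<open>Critical values\<close>

lemma singular_not_inj:
  fixes A :: "complex ^ 'n ^ 'n"
  assumes "det A = 0" shows "\<not> inj (\<lambda>v. A *v v)"
proof
  assume inj: "inj (\<lambda>v. A *v v)"
  have "x = 0" if "A *v x = 0" for x using injD[OF inj, of x 0] that by simp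
  then obtain B where "B ** A = mat 1" using matrix_left_invertible_ker[of A] by blast
  then have "det B * det A = 1" by (metis det_I det_mul)
  then show False using assms by simp
qed

text \<open>Sard's theorem in equal dimensions, transported to \<open>real ^ 'n bit0\<close>, whose
  index type has twice as many elements. A singular complex matrix is not injective, hence neither
  is the conjugated real linear map, and its real rank drops.\<close>

lemma critical_values_negligible:
  fixes f :: "complex ^ 'n \<Rightarrow> complex ^ 'n"
  assumes f: "holomorphic_map_Cn f D"
  shows "negligible (f ` {z \<in> D. jac f z = 0})"
proof -
  let ?S = "{z \<in> D. jac f z = 0}"
  have dim: "DIM(complex ^ 'n) = DIM(real ^ 'n bit0)" by simp
  obtain \<phi> :: "complex ^ 'n \<Rightarrow> real ^ 'n bit0" and \<psi> where lin: "linear \<phi>" "linear \<psi>"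
    and inv: "\<And>x. \<psi> (\<phi> x) = x" "\<And>y. \<phi> (\<psi> y) = y"
    using isomorphisms_UNIV_UNIV[OF dim] by metis
  note bl = lin[THEN linear_conv_bounded_linear[THEN iffD1]]
  let ?f = "\<lambda>y. \<phi> (f (\<psi> y))" and ?f' = "\<lambda>y v. \<phi> (jac_matrix f (\<psi> y) *v \<psi> v)"
  have linf': "linear (?f' y)" for y
    using linear_compose[OF linear_compose[OF lin(2) bounded_linear.linear[OF matrix_vector_mul_bounded_linear]] lin(1)]
    by (simp add: o_def)
  have "negligible (?f ` (\<phi> ` ?S))"
  proof (rule baby_Sard[where f' = ?f'])
    fix y assume "y \<in> \<phi> ` ?S"
    then have y: "\<psi> y \<in> D" "jac f (\<psi> y) = 0" using inv by auto
    have 1: "(\<psi> has_derivative \<psi>) (at y)" by (rule bounded_linear_imp_has_derivative[OF bl(2)])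
    have 2: "(\<phi> has_derivative \<phi>) (at x)" for x by (rule bounded_linear_imp_has_derivative[OF bl(1)])
    show "(?f has_derivative ?f' y) (at y within \<phi> ` ?S)"
      by (rule has_derivative_at_withinI[OF has_derivative_compose[OF has_derivative_compose[OF 1
            holomorphic_map_has_derivative[OF f y(1)]] 2]])
    have "\<not> inj (?f' y)"
    proof
      assume inj: "inj (?f' y)"
      have "inj (\<lambda>v. jac_matrix f (\<psi> y) *v v)"
      proof (rule injI)
        fix u v assume "jac_matrix f (\<psi> y) *v u = jac_matrix f (\<psi> y) *v v"
        then have "?f' y (\<phi> u) = ?f' y (\<phi> v)" by (simp add: inv)
        then have "\<phi> u = \<phi> v" by (rule injD[OF inj])
        then show "u = v" by (metis inv(1))
      qed
      then show False using singular_not_inj[of "jac_matrix f (\<psi> y)"] y(2) by (simp add: jac_def)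
    qed
    moreover have "(\<lambda>v. matrix (?f' y) *v v) = ?f' y"
 by (rule matrix_vector_mul(2)[OF linf'])
    ultimately show "rank (matrix (?f' y)) < CARD('n bit0)"
      unfolding less_rank_noninjective by simp
  qed simp
  then have "negligible (\<psi> ` ?f ` \<phi> ` ?S)"
    by (rule negligible_differentiable_image_negligible[rotated])
      (use lin dim in \<open>auto intro: linear_imp_differentiable_on\<close>)
  moreover have "\<psi> ` ?f ` \<phi> ` ?S = f ` ?S" by (simp add: image_image inv)
  ultimately show ?thesis by simp
qed

lemma open_nonempty_not_negligible:
  fixes S :: "'a::euclidean_space set"
  assumes "open S" "S \<noteq> {}" shows "\<not> negligible S"
proof
  assume "negligible S"
  obtain x where "x \<in> S" using assms by blast
  then obtain e where e: "e > 0" "ball x e \<subseteq> S" by (rule openE[OF assms(1)])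
  have "negligible (ball x e)" by (rule negligible_subset[OF \<open>negligible S\<close> e(2)])
  then have "measure lebesgue (ball x e) = 0" by (rule negligible_imp_measure0)
  then show False using content_ball_pos[OF e(1), of x] by simp
qed

section \<open>Power sums and convergent subsequences\<close>

text \<open>Induction by elimination: the combination \<open>of_real M * s (Suc m) - u * s m\<close>
  multiplies each coefficient by \<open>v - u\<close> and so removes the base \<open>u\<close>. The
  single term left at the end cannot decay because its base has norm at least
  \<open>M\<close>.\<close>

lemma exponential_sum_zero:
  fixes c :: "complex \<Rightarrow> complex"
  assumes "finite V" "M > 0" "\<And>v. v \<in> V \<Longrightarrow> norm v \<ge> M"
    and "(\<lambda>m. (\<Sum>v\<in>V. c v * v ^ m) / of_real (M ^ m)) \<longlonglongrightarrow> 0"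
  shows "\<forall>v\<in>V. c v = 0"
  using assms(1,3,4)
proof (induction V arbitrary: c rule: finite_induct)
  case empty then show ?case by simp
next
  case (insert u V)
  define s where "s m = (\<Sum>v\<in>insert u V. c v * v ^ m) / of_real (M ^ m)" for m
  have s: "s \<longlonglongrightarrow> 0" using insert.prems(2) unfolding s_def .
  have "(\<Sum>v\<in>V. (c v * (v - u)) * v ^ m) / of_real (M ^ m) = of_real M * s (Suc m) - u * s m" for m
  proof -
    have "(\<Sum>v\<in>V. (c v * (v - u)) * v ^ m)
        = (\<Sum>v\<in>insert u V. c v * v ^ Suc m) - u * (\<Sum>v\<in>insert u V. c v * v ^ m)"
      using insert.hyps by (simp add: sum_distrib_left sum_subtractf algebra_simps)
    then show ?thesis using assms(2) by (simp add: s_def diff_divide_distrib)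
  qed
  moreover have "(\<lambda>m. of_real M * s (Suc m) - u * s m) \<longlonglongrightarrow> of_real M * 0 - u * 0"
    by (intro tendsto_intros s LIMSEQ_Suc)
  ultimately have "(\<lambda>m. (\<Sum>v\<in>V. (c v * (v - u)) * v ^ m) / of_real (M ^ m)) \<longlonglongrightarrow> 0" by simp
  then have "\<forall>v\<in>V. c v * (v - u) = 0"
    by (intro insert.IH) (use insert.prems in auto)
  then have V0: "\<forall>v\<in>V. c v = 0" using insert.hyps(2) by auto
  then have su: "s m = c u * u ^ m / of_real (M ^ m)" for m
    using insert.hyps by (simp add: s_def)
  have "norm (c u) \<le> norm (s m)" for m
  proof -
    have "M ^ m \<le> norm u ^ m" by (rule power_mono) (use insert.prems(1)[of u] assms(2) in auto)
    then have "1 \<le> norm u ^ m / M ^ m" using assms(2) by simp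
    then have "norm (c u) * 1 \<le> norm (c u) * (norm u ^ m / M ^ m)" by (intro mult_left_mono) auto
    then show ?thesis using assms(2) by (simp add: su norm_mult norm_divide norm_power)
  qed
  moreover have "(\<lambda>m. norm (s m)) \<longlonglongrightarrow> 0" using s by (rule tendsto_norm_zero)
  ultimately have "norm (c u) \<le> 0" by (intro LIMSEQ_le_const) auto
  then show ?case using V0 by simp
qed

text \<open>With \<open>M\<close> the norm of \<open>a k0\<close>, assumed larger than
  \<open>R\<close>, the normalised sums tend to 0 and so does the part with norms below
  \<open>M\<close>. The remaining exponential sum has the multiplicities as coefficients; these are
  positive integers, contradicting \<open>exponential_sum_zero\<close>. Exponent 0 is excluded so
  that the lemma also serves with R = 0 and C = 0.\<close>

lemma power_sum_bound:
  fixes a :: "'a \<Rightarrow> complex"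
  assumes I: "finite I" "k0 \<in> I" and R: "R \<ge> 0"
    and le: "\<And>m. m \<ge> 1 \<Longrightarrow> norm (\<Sum>k\<in>I. a k ^ m) \<le> C * R ^ m"
  shows "norm (a k0) \<le> R"
proof (rule ccontr)
  assume neg: "\<not> norm (a k0) \<le> R"
  define M where "M = norm (a k0)"
  have M: "M > R" "M > 0" using neg R by (auto simp: M_def)
  let ?I1 = "{k \<in> I. norm (a k) \<ge> M}" and ?I2 = "{k \<in> I. norm (a k) < M}"
  define c where "c v = complex_of_nat (card {k \<in> ?I1. a k = v})" for v
  have grp: "(\<Sum>v\<in>a ` ?I1. c v * v ^ m) = (\<Sum>k\<in>?I1. a k ^ m)" for m
  proof -
    have "(\<Sum>v\<in>a ` ?I1. c v * v ^ m) = (\<Sum>v\<in>a ` ?I1. \<Sum>k\<in>{k \<in> ?I1. a k = v}. a k ^ m)"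
      by (intro sum.cong refl) (simp add: c_def)
    also have "\<dots> = (\<Sum>k\<in>?I1. a k ^ m)" by (rule sum.group) (use I in auto)
    finally show ?thesis .
  qed
  have split: "(\<Sum>k\<in>?I1. a k ^ m) / of_real (M ^ m)
      = (\<Sum>k\<in>I. a k ^ m) / of_real (M ^ m) - (\<Sum>k\<in>?I2. (a k / of_real M) ^ m)" for m
  proof -
    have "(\<Sum>k\<in>I. a k ^ m) = (\<Sum>k\<in>?I1. a k ^ m) + (\<Sum>k\<in>?I2. a k ^ m)"
      using I by (subst sum.union_disjoint[symmetric]) (auto intro!: sum.cong)
    then show ?thesis by (simp add: power_divide sum_divide_distrib[symmetric] diff_divide_distrib add_divide_distrib)
  qed
  have "(\<lambda>m. (\<Sum>k\<in>I. a k ^ m) / of_real (M ^ m)) \<longlonglongrightarrow> 0"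
  proof (rule Lim_null_comparison)
    show "\<forall>\<^sub>F m in sequentially. norm ((\<Sum>k\<in>I. a k ^ m) / of_real (M ^ m)) \<le> C * (R / M) ^ m"
      using eventually_ge_at_top[of 1]
    proof eventually_elim
      case (elim m)
      then have "norm (\<Sum>k\<in>I. a k ^ m) / M ^ m \<le> (C * R ^ m) / M ^ m"
        using M by (intro divide_right_mono le) auto
      then show ?case using M by (simp add: norm_divide norm_power power_divide)
    qed
    show "(\<lambda>m. C * (R / M) ^ m) \<longlonglongrightarrow> 0"
      by (intro tendsto_mult_right_zero LIMSEQ_power_zero) (use M R in simp)
  qed
  moreover have "(\<lambda>m. \<Sum>k\<in>?I2. (a k / of_real M) ^ m) \<longlonglongrightarrow> 0"
    by (intro tendsto_null_sum LIMSEQ_power_zero) (use M in \<open>auto simp: norm_divide\<close>)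
  ultimately have "(\<lambda>m. (\<Sum>k\<in>?I1. a k ^ m) / of_real (M ^ m)) \<longlonglongrightarrow> 0"
    unfolding split using tendsto_diff by fastforce
  then have "(\<lambda>m. (\<Sum>v\<in>a ` ?I1. c v * v ^ m) / of_real (M ^ m)) \<longlonglongrightarrow> 0" unfolding grp .
  then have "\<forall>v\<in>a ` ?I1. c v = 0"
    by (intro exponential_sum_zero[OF _ M(2)]) (use I in auto)
  then have "card {k \<in> ?I1. a k = a k0} = 0" using I by (simp add: c_def M_def)
  then show False using I by (auto simp: M_def)
qed

lemma common_convergent_subsequence:
  fixes y :: "nat \<Rightarrow> nat \<Rightarrow> 'a::metric_space"
  assumes Q: "compact Q" and y: "\<And>n k. k < N \<Longrightarrow> y n k \<in> Q"
  shows "\<exists>s l. strict_mono s \<and> (\<forall>k<N. l k \<in> Q \<and> (\<lambda>n. y (s n) k) \<longlonglongrightarrow> l k)"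
  using y
proof (induction N)
  case 0
  show ?case by (rule exI[of _ id]) (auto simp: strict_mono_def)
next
  case (Suc N)
  then obtain s l where s: "strict_mono s" "\<And>k. k < N \<Longrightarrow> l k \<in> Q \<and> (\<lambda>n. y (s n) k) \<longlonglongrightarrow> l k"
    by (metis less_SucI)
  have "\<And>n. y (s n) N \<in> Q" using Suc.prems by simp
  then obtain q t where t: "q \<in> Q" "strict_mono t" "((\<lambda>n. y (s n) N) \<circ> t) \<longlonglongrightarrow> q"
    using seq_compactE[OF compact_imp_seq_compact[OF Q], of "\<lambda>n. y (s n) N"] by metis
  show ?case
  proof (rule exI[of _ "s \<circ> t"], rule exI[of _ "l(N := q)"], intro conjI allI impI)
    show "strict_mono (s \<circ> t)" by (rule strict_mono_o[OF s(1) t(2)])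
    fix k assume k: "k < Suc N"
    show "(l(N := q)) k \<in> Q" using k s(2)[of k] t(1) by auto
    show "(\<lambda>n. y ((s \<circ> t) n) k) \<longlonglongrightarrow> (l(N := q)) k"
    proof (cases "k = N")
      case True
      then show ?thesis using t(3) by (simp add: o_def)
    next
      case False
      then have "(\<lambda>n. y (s n) k) \<longlonglongrightarrow> l k" using s(2)[of k] k by auto
      from LIMSEQ_subseq_LIMSEQ[OF this t(2)] False show ?thesis by (simp add: o_def)
    qed
  qed
qed

section \<open>Regular fibres of a proper map\<close>

locale proper_map =
  fixes f :: "complex ^ 'n \<Rightarrow> complex ^ 'n" and D G :: "(complex ^ 'n) set"
  assumes D: "domain_Cn D" and G: "domain_Cn G" and f: "proper_holomorphic_map f D G"
begin

lemma oD: "open D" and cD: "connected D" and neD: "D \<noteq> {}" and oG: "open G" and cG: "connected G"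
  and hol: "holomorphic_map_Cn f D" and maps: "\<And>z. z \<in> D \<Longrightarrow> f z \<in> G"
  and proper: "\<And>C. compact C \<Longrightarrow> C \<subseteq> G \<Longrightarrow> compact (D \<inter> f -` C)"
  using D G f by (auto simp: domain_Cn_def proper_holomorphic_map_def)

lemma cont: "continuous_on D f" by (rule holomorphic_map_continuous_on[OF hol])

lemma proper_atI: "r > 0 \<Longrightarrow> cball w r \<subseteq> G \<Longrightarrow> proper_at D f w r"
  using oD hol proper[of "cball w r"] by (simp add: proper_at_def)

lemma proper_at_G:
  assumes "w \<in> G"
  obtains r where "r > 0" "cball w r \<subseteq> G" "proper_at D f w r"
  using assms oG proper_atI unfolding open_contains_cball by blast

text \<open>Openness of the image comes from \<open>proper_at_image_ball\<close>, openness of its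
  complement in \<open>G\<close> from the stability of empty fibres; connectedness of
  \<open>G\<close> does the rest.\<close>

lemma image_eq: "f ` D = G"
proof -
  have op: "open (f ` D)"
    unfolding open_contains_ball
  proof
    fix w assume w: "w \<in> f ` D"
    then have "w \<in> G" using maps by blast
    then obtain r where r: "r > 0" "proper_at D f w r" using proper_at_G by metis
    obtain z where "z \<in> D" "f z = w" using w by blast
    from proper_at_image_ball[OF r(2) this] show "\<exists>e>0. ball w e \<subseteq> f ` D" using r(1) half_gt_zero by blast
  qed
  have op': "open (G - f ` D)"
    unfolding open_contains_ball
  proof
    fix w assume w: "w \<in> G - f ` D"
    then obtain r where r: "r > 0" "cball w r \<subseteq> G" "proper_at D f w r" using proper_at_G by (metis Diff_iff)
    have "D \<inter> f -` {w} \<subseteq> {}" using w by auto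
    then obtain \<delta> where d: "\<delta> > 0" "\<delta> \<le> r" "\<And>z. z \<in> D \<Longrightarrow> dist w (f z) \<le> \<delta> \<Longrightarrow> z \<in> {}"
      using fibre_nearby[OF r(3) open_empty] by metis
    have "ball w \<delta> \<inter> f ` D = {}" using d(3) by force
    moreover have "ball w \<delta> \<subseteq> G" using r(2) d(2) by (auto simp: subset_eq)
    ultimately show "\<exists>e>0. ball w e \<subseteq> G - f ` D" using d(1) by blast
  qed
  have "f ` D \<subseteq> G" using maps by blast
  then have "f ` D \<inter> G = {} \<or> (G - f ` D) \<inter> G = {}"
    by (intro connectedD[OF cG op op']) auto
  then show ?thesis using \<open>f ` D \<subseteq> G\<close> neD by blast
qed

definition crit_values :: "(complex ^ 'n) set" where "crit_values = f ` {z \<in> D. jac f z = 0}"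

lemma hol_jac: "holomorphic_Cn (jac f) D" by (rule jac_holomorphic[OF hol oD])

text \<open>Surjectivity enters here: an identically vanishing Jacobian would make all of
  \<open>G\<close> a set of critical values, hence negligible.\<close>

lemma jac_nonzero: "\<exists>z\<in>D. jac f z \<noteq> 0"
proof (rule ccontr)
  assume "\<not> ?thesis"
  then have "{z \<in> D. jac f z = 0} = D" by blast
  then have "negligible G" using critical_values_negligible[OF hol] image_eq by simp
  moreover have "G \<noteq> {}" using neD maps by blast
  ultimately show False using open_nonempty_not_negligible[OF oG] by blast
qed

lemma jac_nonzero_open:
  assumes "open W" "W \<noteq> {}" "W \<subseteq> D" shows "\<exists>z\<in>W. jac f z \<noteq> 0"
proof -
  obtain z0 where "z0 \<in> D" "jac f z0 \<noteq> 0" using jac_nonzero by blast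
  from exists_nonzero_in_open[OF oD cD hol_jac this assms] show ?thesis .
qed

lemma isolating_regular:
  assumes z: "z \<in> D" "jac f z \<noteq> 0" and W: "open W" "z \<in> W"
  obtains e where "isolating f z e" "inj_on f (ball z e)" "ball z e \<subseteq> W"
proof -
  have "z \<in> D \<inter> W" "open (D \<inter> W)" using z W oD by auto
  then obtain e where e: "e > 0" "ball z e \<subseteq> D \<inter> W" "inj_on f (ball z e)"
    using jac_locally_injective[of "D \<inter> W" f z] holomorphic_map_subset[OF hol, of "D \<inter> W"] z(2) by blast
  have sub: "cball z (e / 2) \<subseteq> ball z e" using e(1) by auto
  show thesis
  proof (rule that[of "e / 2"])
    show "isolating f z (e / 2)"
      unfolding isolating_def
    proof (intro conjI ballI impI exI[of _ D])
      show "cball z (e / 2) \<subseteq> D" using sub e(2) by blast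
      fix y assume "y \<in> cball z (e / 2)" "f y = f z"
      then show "y = z" using inj_onD[OF e(3), of y z] sub e(1) by auto
    qed (use e oD hol in auto)
    have "ball z (e / 2) \<subseteq> ball z e" using e(1) by auto
    then show "inj_on f (ball z (e / 2))" "ball z (e / 2) \<subseteq> W" using e inj_on_subset by blast+
  qed
qed

text \<open>A point with nonzero Jacobian may still lie over a critical value. But the image of a
  small ball around it contains a ball, which the negligible critical values cannot fill.\<close>

lemma regular_dense:
  assumes W: "open W" "W \<noteq> {}" "W \<subseteq> D"
  shows "\<exists>z\<in>W. f z \<notin> crit_values"
proof -
  obtain z1 where z1: "z1 \<in> W" "jac f z1 \<noteq> 0" using jac_nonzero_open[OF W] by blast
  have z1D: "z1 \<in> D" using z1 W by blast
  obtain e where e: "isolating f z1 e" "ball z1 e \<subseteq> W"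
    using isolating_regular[OF z1D z1(2) W(1) z1(1)] by metis
  obtain r where r: "proper_at (ball z1 e) f (f z1) r" using isolating_proper[OF e(1)] ..
  have e0: "e > 0" and r0: "r > 0" using e r by (auto simp: isolating_def proper_at_def)
  have sub: "ball (f z1) (r / 2) \<subseteq> f ` ball z1 e"
    by (rule proper_at_image_ball[OF r]) (use e0 in auto)
  have "\<not> ball (f z1) (r / 2) \<subseteq> crit_values"
    using negligible_subset[OF critical_values_negligible[OF hol]] r0
      open_nonempty_not_negligible[of "ball (f z1) (r / 2)"] unfolding crit_values_def by auto
  then obtain w where w: "w \<in> ball (f z1) (r / 2)" "w \<notin> crit_values" by blast
  then obtain z where "z \<in> ball z1 e" "f z = w" using sub by blast
  then show ?thesis using w e(2) by blast
qed

text \<open>The weight is locally constant where the Jacobian does not vanish, by local injectivity,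
  and the zeros of the Jacobian do not disconnect \<open>D\<close>.\<close>

lemma weight_const: "\<exists>c>0. \<forall>z\<in>D. jac f z \<noteq> 0 \<longrightarrow> weight f z = c"
proof -
  obtain z0 where z0: "z0 \<in> D" "jac f z0 \<noteq> 0" using jac_nonzero by blast
  have "weight f z = weight f z0" if z: "z \<in> D" "jac f z \<noteq> 0" for z
  proof (rule locally_const_off_zeros[where c = "weight f", OF oD cD hol_jac _ z z0])
    fix y assume y: "y \<in> D" "jac f y \<noteq> 0"
    obtain e where e: "isolating f y e" "inj_on f (ball y e)"
      using isolating_regular[OF y oD y(1)] by metis
    obtain d where "d > 0" "\<And>x. x \<in> ball y d \<Longrightarrow> weight f x = weight f y"
      using isolating_weight_near[OF e] by metis
    then show "\<exists>e>0. \<forall>x\<in>ball y e. weight f x = weight f y" by blast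
  qed
  moreover have "weight f z0 > 0"
  proof -
    obtain e where e: "isolating f z0 e" "ball z0 e \<subseteq> D"
      using isolating_regular[OF z0 oD z0(1)] by metis
    obtain r where r: "proper_at (ball z0 e) f (f z0) r" using isolating_proper[OF e(1)] ..
    have "mass (ball z0 e) f (f z0) > 0"
      by (rule mass_pos[OF r, of z0]) (use e z0 in \<open>auto simp: isolating_def\<close>)
    then show ?thesis unfolding weight_eq[OF e(1)] .
  qed
  ultimately show ?thesis by blast
qed

definition sheet_weight :: real where "sheet_weight = (SOME c. c > 0 \<and> (\<forall>z\<in>D. jac f z \<noteq> 0 \<longrightarrow> weight f z = c))"

lemma sheet_weight: "sheet_weight > 0" "\<And>z. z \<in> D \<Longrightarrow> jac f z \<noteq> 0 \<Longrightarrow> weight f z = sheet_weight"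
proof -
  have "sheet_weight > 0 \<and> (\<forall>z\<in>D. jac f z \<noteq> 0 \<longrightarrow> weight f z = sheet_weight)"
    unfolding sheet_weight_def by (rule someI_ex) (use weight_const in blast)
  then show "sheet_weight > 0" "\<And>z. z \<in> D \<Longrightarrow> jac f z \<noteq> 0 \<Longrightarrow> weight f z = sheet_weight" by auto
qed

lemma compact_fibre: "w \<in> G \<Longrightarrow> compact (D \<inter> f -` {w})"
  by (rule proper) auto

text \<open>An infinite compact fibre would accumulate at one of its own points, but regular points
  are isolated in their fibre.\<close>

lemma finite_regular_fibre:
  assumes w: "w \<in> G" "w \<notin> crit_values"
  shows "finite (D \<inter> f -` {w})"
proof (rule ccontr)
  assume inf: "infinite (D \<inter> f -` {w})"
  obtain z where z: "z \<in> D \<inter> f -` {w}" "z islimpt (D \<inter> f -` {w})"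
    using compact_fibre[OF w(1)] inf unfolding compact_eq_Bolzano_Weierstrass by blast
  have zD: "z \<in> D" using z by blast
  have "jac f z \<noteq> 0" using z w(2) by (auto simp: crit_values_def)
  then obtain e where e: "isolating f z e" using isolating_regular[OF zD _ oD zD] by metis
  have "e > 0" using e by (simp add: isolating_def)
  then have "z \<in> ball z e" by simp
  from islimptE[OF z(2) this open_ball] obtain y where y: "y \<in> D \<inter> f -` {w}" "y \<in> ball z e" "y \<noteq> z"
    by blast
  have "f y = f z" using y(1) z(1) by simp
  moreover have "y \<in> cball z e" using y(2) by simp
  ultimately show False using e y(3) unfolding isolating_def by blast
qed

lemma fibre_trace_regular:
  fixes h :: "complex ^ 'n \<Rightarrow> complex"
  assumes w: "w \<in> G" "w \<notin> crit_values" and W: "W \<subseteq> D" "proper_at W f w r" and h: "holomorphic_Cn h W"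
  shows "fibre_trace W f h w = sheet_weight * (\<Sum>z\<in>W \<inter> f -` {w}. h z)"
proof -
  have fin: "finite (W \<inter> f -` {w})"
    by (rule finite_subset[OF _ finite_regular_fibre[OF w]]) (use W in auto)
  have "weight f z = sheet_weight" if "z \<in> W \<inter> f -` {w}" for z
    using that w(2) W(1) by (intro sheet_weight(2)) (auto simp: crit_values_def)
  then show ?thesis
    unfolding fibre_trace_finite[OF W(2) h fin] sum_distrib_left by (intro sum.cong) auto
qed

lemma mass_constant_G: "w \<in> G \<Longrightarrow> w' \<in> G \<Longrightarrow> mass D f w = mass D f w'"
  by (rule mass_constant[OF oG cG]) (use proper_at_G in metis)

definition sheets :: nat where "sheets = card (D \<inter> f -` {SOME w. w \<in> G \<and> w \<notin> crit_values})"

text \<open>Over a regular value the mass is the cardinality times the common positive weight, and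
  the mass does not depend on the value.\<close>

lemma card_regular_fibre:
  assumes w: "w \<in> G" "w \<notin> crit_values"
  shows "card (D \<inter> f -` {w}) = sheets"
proof -
  have m: "mass D f w = sheet_weight * card (D \<inter> f -` {w})" if w: "w \<in> G" "w \<notin> crit_values" for w
  proof -
    obtain r where r: "proper_at D f w r" using proper_at_G[OF w(1)] by metis
    from fibre_trace_regular[OF w order_refl r holomorphic_Cn_const[of 1]]
    have "fibre_trace D f (\<lambda>_. 1) w = complex_of_real (sheet_weight * card (D \<inter> f -` {w}))" by simp
    then show ?thesis unfolding mass_def by simp
  qed
  let ?w = "SOME w. w \<in> G \<and> w \<notin> crit_values"
  have w': "?w \<in> G \<and> ?w \<notin> crit_values" 
    by (rule someI[of "\<lambda>w. w \<in> G \<and> w \<notin> crit_values" w]) (use w in blast)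
  have "sheet_weight * card (D \<inter> f -` {w}) = sheet_weight * card (D \<inter> f -` {?w})"
    by (rule trans[OF m[OF w, symmetric] trans[OF mass_constant_G[OF w(1)] m]]) (use w' in blast)+
  then have "card (D \<inter> f -` {w}) = card (D \<inter> f -` {?w})"
    using sheet_weight(1) by (subst (asm) mult_left_cancel) auto
  then show ?thesis unfolding sheets_def .
qed

text \<open>Equal cardinality lets all regular fibres be listed as tuples of length
  \<open>sheets\<close> in one compact set. Along a subsequence the tuples converge, and sums over
  fibres, being independent of the listing, pass to the limit.\<close>

lemma fibre_subsequence:
  fixes w :: "nat \<Rightarrow> complex ^ 'n"
  assumes r: "cball w0 r \<subseteq> G" and w: "\<And>n. w n \<in> cball w0 r" "\<And>n. w n \<notin> crit_values"
  obtains s l where "strict_mono s" "\<And>k. k < sheets \<Longrightarrow> l k \<in> D"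
    "\<And>h :: complex ^ 'n \<Rightarrow> complex. continuous_on D h \<Longrightarrow>
       (\<lambda>n. \<Sum>z\<in>D \<inter> f -` {w (s n)}. h z) \<longlonglongrightarrow> (\<Sum>k<sheets. h (l k))"
proof -
  let ?X = "\<lambda>n. D \<inter> f -` {w n}"
  have wG: "w n \<in> G" for n using r w(1) by blast
  have "\<exists>y. bij_betw y {..<sheets} (?X n)" for n
    using ex_bij_betw_nat_finite[OF finite_regular_fibre[OF wG w(2)], of n]
    unfolding card_regular_fibre[OF wG w(2)] atLeast0LessThan .
  then obtain y where y: "\<And>n. bij_betw (y n) {..<sheets} (?X n)" by metis
  have Q: "compact (D \<inter> f -` cball w0 r)" by (rule proper[OF compact_cball r])
  have "y n k \<in> D \<inter> f -` cball w0 r" if "k < sheets" for n k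
    using bij_betwE[OF y[of n]] that w(1)[of n] by auto
  from common_convergent_subsequence[OF Q, of sheets y, OF this] obtain s l where
    s: "strict_mono s" "\<And>k. k < sheets \<Longrightarrow> l k \<in> D \<inter> f -` cball w0 r \<and> (\<lambda>n. y (s n) k) \<longlonglongrightarrow> l k"
    by blast
  show thesis
  proof (rule that[OF s(1)])
    show "l k \<in> D" if "k < sheets" for k using s(2)[OF that] by blast
    fix h :: "complex ^ 'n \<Rightarrow> complex" assume h: "continuous_on D h"
    have "(\<lambda>n. \<Sum>k<sheets. h (y (s n) k)) \<longlonglongrightarrow> (\<Sum>k<sheets. h (l k))"
    proof (rule tendsto_sum)
      fix k assume "k \<in> {..<sheets}"
      then have k: "l k \<in> D" "(\<lambda>n. y (s n) k) \<longlonglongrightarrow> l k" using s(2)[of k] by auto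
      have "isCont h (l k)" using h k(1) oD by (simp add: continuous_on_eq_continuous_at)
      then show "(\<lambda>n. h (y (s n) k)) \<longlonglongrightarrow> h (l k)" using k(2) by (rule isCont_tendsto_compose)
    qed
    moreover have "(\<Sum>k<sheets. h (y (s n) k)) = (\<Sum>z\<in>?X (s n). h z)" for n
      by (rule sum.reindex_bij_betw[OF y])
    ultimately show "(\<lambda>n. \<Sum>z\<in>?X (s n). h z) \<longlonglongrightarrow> (\<Sum>k<sheets. h (l k))" by simp
  qed
qed

section \<open>Finiteness of all fibres\<close>

lemma fibre_trace_continuous:
  assumes "holomorphic_Cn h D" "w0 \<in> G" shows "isCont (fibre_trace D f h) w0"
proof -
  have "holomorphic_Cn (fibre_trace D f h) G"
    by (rule fibre_trace_holomorphic[OF _ assms(1)]) (use proper_at_G in metis)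
  from holomorphic_Cn_continuous_on[OF this] show ?thesis
    using assms(2) oG by (simp add: continuous_on_eq_continuous_at)
qed

text \<open>
  Finiteness of a fibre. Let \<open>A\<close> be the set of limits of the points in regular fibres along one
  sequence. A polynomial \<open>g\<close> vanishing on \<open>A\<close> has vanishing power traces over \<open>w0\<close>, hence along
  every other sequence the limiting fibre points are zeros of \<open>g\<close> as well.
\<close>

lemma finite_fibre:
  assumes w0: "w0 \<in> G"
  shows "finite (D \<inter> f -` {w0})"
proof -
  obtain r where r: "r > 0" "cball w0 r \<subseteq> G" using proper_at_G[OF w0] by metis
  have oU: "open (D \<inter> f -` ball w0 e)" for e
    by (rule continuous_open_preimage[OF cont oD open_ball])
  obtain p0 where p0: "p0 \<in> D" "f p0 = w0" using image_eq w0 by blast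
  have "\<exists>z. z \<in> D \<and> f z \<in> ball w0 (r / real (Suc n)) \<and> f z \<notin> crit_values" for n
  proof -
    have "p0 \<in> D \<inter> f -` ball w0 (r / real (Suc n))" using p0 r by simp
    then show ?thesis using regular_dense[OF oU, of "r / real (Suc n)"] by blast
  qed
  then obtain z1 where z1: "\<And>n. z1 n \<in> D" "\<And>n. f (z1 n) \<in> ball w0 (r / real (Suc n))"
    "\<And>n. f (z1 n) \<notin> crit_values" by metis
  have le_r: "r / real (Suc n) \<le> r" for n using r(1) by (simp add: divide_le_eq)
  have w1: "f (z1 n) \<in> cball w0 r" for n using z1(2)[of n] le_r[of n] by simp
  have lim1: "(\<lambda>n. f (z1 n)) \<longlonglongrightarrow> w0"
  proof (rule metric_tendsto_imp_tendsto[where f = "\<lambda>n. r / real (Suc n)" and a = 0])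
    show "(\<lambda>n. r / real (Suc n)) \<longlonglongrightarrow> 0"
      using tendsto_mult_right_zero[OF LIMSEQ_Suc[OF lim_inverse_n'], of r] by simp
    show "\<forall>\<^sub>F n in sequentially. dist (f (z1 n)) w0 \<le> dist (r / real (Suc n)) 0"
      using z1(2) r(1) by (intro always_eventually allI) (simp add: dist_commute less_imp_le)
  qed
  obtain s1 l1 where s1: "strict_mono s1" "\<And>k. k < sheets \<Longrightarrow> l1 k \<in> D"
    and c1: "\<And>h :: complex ^ 'n \<Rightarrow> complex. continuous_on D h \<Longrightarrow>
       (\<lambda>n. \<Sum>z\<in>D \<inter> f -` {f (z1 (s1 n))}. h z) \<longlonglongrightarrow> (\<Sum>k<sheets. h (l1 k))"
    using fibre_subsequence[where w = "\<lambda>n. f (z1 n)", OF r(2) w1 z1(3)] by metis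
  let ?A = "l1 ` {..<sheets}"
  have "D \<inter> f -` {w0} \<subseteq> ?A"
  proof
    fix p assume p: "p \<in> D \<inter> f -` {w0}"
    show "p \<in> ?A"
    proof (rule ccontr)
      assume pA: "p \<notin> ?A"
      have "\<exists>j. p $ j \<noteq> a $ j" if "a \<in> ?A" for a
        using pA that by (metis vec_eq_iff)
      then obtain j where j: "\<And>a. a \<in> ?A \<Longrightarrow> p $ (j a) \<noteq> a $ (j a)" by metis
      \<comment> \<open>One linear factor for each \<open>a\<close> in \<open>?A\<close>, in a
        coordinate where \<open>a\<close> differs from \<open>p\<close>: the product vanishes on
        \<open>?A\<close> but not at \<open>p\<close>.\<close>
      define g where "g z = (\<Prod>a\<in>?A. z $ (j a) - a $ (j a))" for z :: "complex ^ 'n"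
      have hg: "holomorphic_Cn g D"
        unfolding g_def by (intro holomorphic_Cn_prod holomorphic_Cn_diff holomorphic_Cn_coord holomorphic_Cn_const)
      have cg: "continuous_on D g" by (rule holomorphic_Cn_continuous_on[OF hg])
      have gp: "g p \<noteq> 0" using j by (auto simp: g_def)
      have gA: "g a = 0" if "a \<in> ?A" for a
        unfolding g_def by (rule prod_zero) (use that in auto)
      define T where "T m = fibre_trace D f (\<lambda>z. g z ^ m)" for m
      have contT: "isCont (T m) w0" for m
        unfolding T_def by (rule fibre_trace_continuous[OF holomorphic_Cn_power[OF hg] w0])
      have T_reg: "T m w = sheet_weight * (\<Sum>z\<in>D \<inter> f -` {w}. g z ^ m)" if wr: "w \<in> G" "w \<notin> crit_values" for m w
      proof -
        obtain r' where "proper_at D f w r'" using proper_at_G[OF wr(1)] by metis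
        then show ?thesis unfolding T_def
          by (rule fibre_trace_regular[OF wr order_refl _ holomorphic_Cn_power[OF hg]])
      qed
      \<comment> \<open>The left side does not see the sequence. By continuity of the trace, the
        power sums of \<open>g\<close> over the limit points agree for all sequences of regular
        values tending to \<open>w0\<close>.\<close>
      have T_lim: "T m w0 = sheet_weight * (\<Sum>k<sheets. g (l k) ^ m)"
        if "strict_mono s" "\<And>n. w n \<in> cball w0 r" "\<And>n. w n \<notin> crit_values" "w \<longlonglongrightarrow> w0"
          "\<And>h :: complex ^ 'n \<Rightarrow> complex. continuous_on D h \<Longrightarrow>
            (\<lambda>n. \<Sum>z\<in>D \<inter> f -` {w (s n)}. h z) \<longlonglongrightarrow> (\<Sum>k<sheets. h (l k))" for m s w and l :: "nat \<Rightarrow> complex ^ 'n"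
      proof -
        have wG: "w n \<in> G" for n using that(2) r(2) by blast
        have "(\<lambda>n. w (s n)) \<longlonglongrightarrow> w0" using LIMSEQ_subseq_LIMSEQ[OF that(4,1)] by (simp add: o_def)
        then have "(\<lambda>n. T m (w (s n))) \<longlonglongrightarrow> T m w0" by (rule isCont_tendsto_compose[OF contT])
        moreover have "(\<lambda>n. T m (w (s n))) \<longlonglongrightarrow> sheet_weight * (\<Sum>k<sheets. g (l k) ^ m)"
          unfolding T_reg[OF wG that(3)]
          by (intro tendsto_intros that(5)) (intro continuous_intros cg)
        ultimately show ?thesis by (rule LIMSEQ_unique)
      qed
      \<comment> \<open>Exponent 0 is left out since \<open>g z ^ 0\<close> is 1 even at the zeros
        of \<open>g\<close>.\<close>
      have T0: "T m w0 = 0" if "m \<ge> 1" for m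
        using T_lim[where w = "\<lambda>n. f (z1 n)", OF s1(1) w1 z1(3) lim1 c1, of m] gA that by simp
      \<comment> \<open>The second sequence approaches the point \<open>p\<close> itself, not just
        the value \<open>w0\<close>, so its limiting fibre points must account for
        \<open>p\<close>.\<close>
      have "\<exists>z. z \<in> D \<and> z \<in> ball p (1 / real (Suc n)) \<and> f z \<in> ball w0 r \<and> f z \<notin> crit_values" for n
      proof -
        have "p \<in> D \<inter> f -` ball w0 r \<inter> ball p (1 / real (Suc n))" using p r by simp
        moreover have "open (D \<inter> f -` ball w0 r \<inter> ball p (1 / real (Suc n)))" by (intro open_Int oU open_ball)
        ultimately show ?thesis using regular_dense[of "D \<inter> f -` ball w0 r \<inter> ball p (1 / real (Suc n))"] by blast
      qed
      then obtain z2 where z2: "\<And>n. z2 n \<in> D" "\<And>n. z2 n \<in> ball p (1 / real (Suc n))"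
        "\<And>n. f (z2 n) \<in> ball w0 r" "\<And>n. f (z2 n) \<notin> crit_values" by metis
      have w2: "f (z2 n) \<in> cball w0 r" for n using z2(3)[of n] by simp
      have lim_z2: "z2 \<longlonglongrightarrow> p"
      proof (rule metric_tendsto_imp_tendsto[where f = "\<lambda>n. 1 / real (Suc n)" and a = 0])
        show "(\<lambda>n. 1 / real (Suc n)) \<longlonglongrightarrow> 0" by (rule LIMSEQ_Suc[OF lim_inverse_n'])
        show "\<forall>\<^sub>F n in sequentially. dist (z2 n) p \<le> dist (1 / real (Suc n)) 0"
          using z2(2) by (intro always_eventually allI) (simp add: dist_commute less_imp_le)
      qed
      have isf: "isCont f p" using cont oD p by (simp add: continuous_on_eq_continuous_at)
      have lim2: "(\<lambda>n. f (z2 n)) \<longlonglongrightarrow> w0" using isCont_tendsto_compose[OF isf lim_z2] p by simp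
      obtain s2 l2 where s2: "strict_mono s2" "\<And>k. k < sheets \<Longrightarrow> l2 k \<in> D"
        and c2: "\<And>h :: complex ^ 'n \<Rightarrow> complex. continuous_on D h \<Longrightarrow>
           (\<lambda>n. \<Sum>z\<in>D \<inter> f -` {f (z2 (s2 n))}. h z) \<longlonglongrightarrow> (\<Sum>k<sheets. h (l2 k))"
        using fibre_subsequence[where w = "\<lambda>n. f (z2 n)", OF r(2) w2 z2(4)] by metis
      have sum0: "(\<Sum>k<sheets. g (l2 k) ^ m) = 0" if "m \<ge> 1" for m
        using T_lim[where w = "\<lambda>n. f (z2 n)", OF s2(1) w2 z2(4) lim2 c2] T0[OF that] sheet_weight(1) by simp
      have g0: "norm (g (l2 k)) \<le> 0" if "k < sheets" for k
        by (rule power_sum_bound[where I = "{..<sheets}" and a = "\<lambda>k. g (l2 k)" and C = 0]) (use that sum0 in auto)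
      \<comment> \<open>The norm of \<open>g\<close> is embedded into the complex numbers to apply
        \<open>c2\<close> without cancellation; its fibre sums dominate the single term at
        \<open>z2 (s2 n)\<close>, which tends to the norm of \<open>g p\<close>.\<close>
      have "continuous_on D (\<lambda>z. complex_of_real (norm (g z)))" by (intro continuous_intros cg)
      from c2[OF this] have "(\<lambda>n. \<Sum>z\<in>D \<inter> f -` {f (z2 (s2 n))}. complex_of_real (norm (g z))) \<longlonglongrightarrow> 0"
        using g0 by simp
      from tendsto_Re[OF this] have lim0: "(\<lambda>n. \<Sum>z\<in>D \<inter> f -` {f (z2 (s2 n))}. norm (g z)) \<longlonglongrightarrow> 0" by simp
      have "(\<lambda>n. z2 (s2 n)) \<longlonglongrightarrow> p" using LIMSEQ_subseq_LIMSEQ[OF lim_z2 s2(1)] by (simp add: o_def)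
      moreover have "isCont g p" using cg oD p by (simp add: continuous_on_eq_continuous_at)
      ultimately have "(\<lambda>n. g (z2 (s2 n))) \<longlonglongrightarrow> g p" by (intro isCont_tendsto_compose[of p g])
      then have "(\<lambda>n. norm (g (z2 (s2 n)))) \<longlonglongrightarrow> norm (g p)" by (rule tendsto_norm)
      moreover have "norm (g (z2 (s2 n))) \<le> (\<Sum>z\<in>D \<inter> f -` {f (z2 (s2 n))}. norm (g z))" for n
      proof (rule member_le_sum)
        have "f (z2 (s2 n)) \<in> G" using w2 r(2) by blast
        from finite_regular_fibre[OF this z2(4)] show "finite (D \<inter> f -` {f (z2 (s2 n))})" .
      qed (use z2(1) in auto)
      ultimately have "norm (g p) \<le> 0" using lim0 by (intro LIMSEQ_le) auto
      then show False using gp by simp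
    qed
  qed
  then show ?thesis by (rule finite_subset) simp
qed

end

section \<open>Boundaries\<close>

lemma weight_nonneg:
  assumes "isolating f \<zeta> e" shows "weight f \<zeta> \<ge> 0"
proof -
  obtain r where r: "proper_at (ball \<zeta> e) f (f \<zeta>) r" using isolating_proper[OF assms] ..
  then have "0 < (r / 2)\<^sup>2" "(r / 2)\<^sup>2 < r\<^sup>2" by (auto simp: proper_at_def power_divide)
  from mass_eq(3)[OF r this] show ?thesis unfolding weight_eq[OF assms] .
qed

lemma holomorphic_Cn_compose:
  fixes f :: "complex ^ 'n \<Rightarrow> complex ^ 'n"
  assumes h: "holomorphic_Cn h U" and f: "holomorphic_map_Cn f V" and sub: "\<And>z. z \<in> V \<Longrightarrow> f z \<in> U"
  shows "holomorphic_Cn (\<lambda>z. h (f z)) V"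
  unfolding holomorphic_Cn_def
proof
  fix z assume z: "z \<in> V"
  obtain h' where h': "(h has_derivative h') (at (f z))" "\<And>c v. h' (c *s v) = c * h' v"
    using h sub[OF z] unfolding holomorphic_Cn_def by blast
  from has_derivative_compose[OF holomorphic_map_has_derivative[OF f z] h'(1)]
  show "\<exists>h'. ((\<lambda>z. h (f z)) has_derivative h') (at z) \<and> (\<forall>c v. h' (c *s v) = c * h' v)"
    by (intro exI conjI, assumption) (simp add: vec.scale h'(2))
qed

section \<open>The push-forward of functions\<close>

context proper_map
begin

lemma mass_eq_sum:
  assumes V: "V \<subseteq> D" "proper_at V f w r" and w: "w \<in> G"
  shows "mass V f w = (\<Sum>\<zeta>\<in>V \<inter> f -` {w}. weight f \<zeta>)"
proof -
  have "finite (V \<inter> f -` {w})" by (rule finite_subset[OF _ finite_fibre[OF w]]) (use V in auto)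
  from fibre_trace_finite[OF V(2) holomorphic_Cn_const[of 1] this] show ?thesis
    unfolding mass_def by simp
qed

lemma weight_nonneg_fibre: "\<zeta> \<in> D \<Longrightarrow> weight f \<zeta> \<ge> 0"
  using finite_fibre_radius[OF oD hol finite_fibre[OF maps]] weight_nonneg
  by (metis IntI vimage_singleton_eq)

text \<open>A sum of values, so it also makes sense for functions given only over a closed set; the
  trace integral would need them over a neighbourhood. The weights act as multiplicities at critical
  points.\<close>

definition pushforward :: "(complex ^ 'n \<Rightarrow> complex) \<Rightarrow> complex ^ 'n \<Rightarrow> complex" where
  "pushforward g w = (\<Sum>\<zeta>\<in>D \<inter> f -` {w}. g \<zeta> * complex_of_real (weight f \<zeta>))"

text \<open>The nonnegative weights of every fibre add up to the same total mass. Writing it at a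
  fixed \<open>w0\<close> displays a constant independent of \<open>w\<close> and of the
  function.\<close>

lemma pushforward_bound:
  assumes w: "w \<in> G" and w0: "w0 \<in> G" and g: "\<And>\<zeta>. \<zeta> \<in> D \<Longrightarrow> f \<zeta> = w \<Longrightarrow> norm (g \<zeta>) \<le> R"
  shows "norm (pushforward g w) \<le> mass D f w0 * R"
proof -
  obtain r where r: "proper_at D f w r" using proper_at_G[OF w] by metis
  have "norm (pushforward g w) \<le> (\<Sum>\<zeta>\<in>D \<inter> f -` {w}. norm (g \<zeta> * complex_of_real (weight f \<zeta>)))"
    unfolding pushforward_def by (rule norm_sum)
  also have "\<dots> \<le> (\<Sum>\<zeta>\<in>D \<inter> f -` {w}. R * weight f \<zeta>)"
    by (intro sum_mono) (auto simp: norm_mult weight_nonneg_fibre intro!: mult_right_mono g)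
  also have "\<dots> = mass D f w0 * R"
    using mass_eq_sum[OF order_refl r w] mass_constant_G[OF w w0] by (simp add: sum_distrib_left mult.commute)
  finally show ?thesis .
qed

text \<open>Over an open set the fibre trace is available and holomorphic, and finiteness of the
  fibres identifies it with the weighted sum.\<close>

lemma pushforward_holomorphic:
  assumes W: "open W" "W \<subseteq> G" and g: "holomorphic_Cn g (D \<inter> f -` W)"
  shows "holomorphic_Cn (pushforward g) W"
proof -
  let ?V = "D \<inter> f -` W"
  have oV: "open ?V" by (rule continuous_open_preimage[OF cont oD W(1)])
  have pa: "\<exists>r. proper_at ?V f w r" if w: "w \<in> W" for w
  proof -
    obtain r where r: "r > 0" "cball w r \<subseteq> W" using w W(1) unfolding open_contains_cball by blast
    have "?V \<inter> f -` cball w r = D \<inter> f -` cball w r" using r(2) by blast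
    moreover have "compact (D \<inter> f -` cball w r)" by (rule proper) (use r W in auto)
    moreover have "holomorphic_map_Cn f ?V" by (rule holomorphic_map_subset[OF hol]) simp
    ultimately have "proper_at ?V f w r" using oV r(1) by (simp add: proper_at_def)
    then show ?thesis ..
  qed
  show ?thesis
  proof (rule holomorphic_Cn_cong[OF W(1) _ fibre_trace_holomorphic[OF pa g]])
    fix w assume w: "w \<in> W"
    obtain r where r: "proper_at ?V f w r" using pa[OF w] ..
    have eq: "?V \<inter> f -` {w} = D \<inter> f -` {w}" using w by auto
    have "w \<in> G" using w W by blast
    then have "finite (?V \<inter> f -` {w})" unfolding eq by (rule finite_fibre)
    from fibre_trace_finite[OF r g this] show "fibre_trace ?V f g w = pushforward g w"
      unfolding pushforward_def eq .
  qed auto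
qed

text \<open>As \<open>w\<close> leaves \<open>w0\<close>, each fibre point \<zeta> splits into
  nearby points with the same total weight. The change of the push-forward is therefore a weighted
  sum of differences \<open>g \<xi> - g \<zeta>\<close>, small by continuity of \<open>g\<close>
  along the preimage of \<open>Y\<close> alone.\<close>

lemma pushforward_continuous:
  assumes Y: "Y \<subseteq> G" and g: "continuous_on (D \<inter> f -` Y) g"
  shows "continuous_on Y (pushforward g)"
  unfolding continuous_on_iff
proof (intro ballI allI impI)
  fix w0 and \<epsilon> :: real assume w0: "w0 \<in> Y" and eps: "\<epsilon> > 0"
  have w0G: "w0 \<in> G" using w0 Y by blast
  let ?X = "\<lambda>w. D \<inter> f -` {w}"
  define m where "m = mass D f w0"
  obtain r0 where r0: "proper_at D f w0 r0" using proper_at_G[OF w0G] by metis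
  have m0: "m \<ge> 0" unfolding m_def mass_eq_sum[OF order_refl r0 w0G]
    by (intro sum_nonneg weight_nonneg_fibre) auto
  define \<eta> where "\<eta> = \<epsilon> / (m + 1)"
  have eta: "\<eta> > 0" using eps m0 by (simp add: \<eta>_def)
  have fin0: "finite (?X w0)" by (rule finite_fibre[OF w0G])
  obtain e1 where e1: "e1 > 0" "\<And>\<zeta>. \<zeta> \<in> ?X w0 \<Longrightarrow> isolating f \<zeta> e1 \<and> cball \<zeta> e1 \<subseteq> D"
    "disjoint_family_on (\<lambda>\<zeta>. ball \<zeta> e1) (?X w0)"
    using finite_fibre_radius[OF oD hol fin0] by metis
  have "\<exists>e>0. \<forall>e'. 0 < e' \<and> e' \<le> e \<longrightarrow> (\<forall>z\<in>D \<inter> f -` Y. dist z \<zeta> < e' \<longrightarrow> dist (g z) (g \<zeta>) < \<eta>)"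
    if z: "\<zeta> \<in> ?X w0" for \<zeta>
  proof -
    have "\<zeta> \<in> D \<inter> f -` Y" using z w0 by auto
    then obtain e where "e > 0" "\<forall>z\<in>D \<inter> f -` Y. dist z \<zeta> < e \<longrightarrow> dist (g z) (g \<zeta>) < \<eta>"
      using g eta unfolding continuous_on_iff by blast
    then show ?thesis by (intro exI[of _ e]) auto
  qed
  from finite_common_radius[where P = "\<lambda>\<zeta> e'. \<forall>z\<in>D \<inter> f -` Y. dist z \<zeta> < e' \<longrightarrow> dist (g z) (g \<zeta>) < \<eta>",
      OF fin0 this] obtain e2 where e2: "e2 > 0"
      "\<forall>\<zeta>\<in>?X w0. \<forall>e'. 0 < e' \<and> e' \<le> e2 \<longrightarrow> (\<forall>z\<in>D \<inter> f -` Y. dist z \<zeta> < e' \<longrightarrow> dist (g z) (g \<zeta>) < \<eta>)"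
    by blast
  define e where "e = min e1 e2"
  have e: "e > 0" "e \<le> e1" "e \<le> e2" using e1 e2 by (auto simp: e_def)
  have near_g: "dist (g z) (g \<zeta>) < \<eta>" if "\<zeta> \<in> ?X w0" "z \<in> D" "f z \<in> Y" "z \<in> ball \<zeta> e" for \<zeta> z
    using e2(2) that e by (auto simp: dist_commute)
  have iso: "isolating f \<zeta> e" if "\<zeta> \<in> ?X w0" for \<zeta>
    using isolating_smaller[of f \<zeta> e1 e] e1(2)[OF that] e by blast
  have sub1: "ball \<zeta> e \<subseteq> ball \<zeta> e1" for \<zeta> :: "complex ^ 'n" using e by auto
  have subD: "ball \<zeta> e \<subseteq> D" if "\<zeta> \<in> ?X w0" for \<zeta>
    using e1(2)[OF that] sub1[of \<zeta>] ball_subset_cball[of \<zeta> e1] by blast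
  have disj: "ball \<zeta> e \<inter> ball \<xi> e = {}" if "\<zeta> \<in> ?X w0" "\<xi> \<in> ?X w0" "\<zeta> \<noteq> \<xi>" for \<zeta> \<xi>
    using e1(3) that sub1[of \<zeta>] sub1[of \<xi>] unfolding disjoint_family_on_def by blast
  have "\<exists>r>0. \<forall>r'. 0 < r' \<and> r' \<le> r \<longrightarrow> proper_at (ball \<zeta> e) f w0 r'" if z: "\<zeta> \<in> ?X w0" for \<zeta>
  proof -
    obtain r where r: "proper_at (ball \<zeta> e) f w0 r" using isolating_proper[OF iso[OF z]] z by auto
    then have "r > 0" by (simp add: proper_at_def)
    then show ?thesis using proper_at_mono[OF r, of w0] by auto
  qed
  from finite_common_radius[where P = "\<lambda>\<zeta> r'. proper_at (ball \<zeta> e) f w0 r'", OF fin0 this]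
  obtain r where r: "r > 0" and "\<forall>\<zeta>\<in>?X w0. \<forall>r'. 0 < r' \<and> r' \<le> r \<longrightarrow> proper_at (ball \<zeta> e) f w0 r'" by blast
  then have pa_ball: "proper_at (ball \<zeta> e) f w0 r" if "\<zeta> \<in> ?X w0" for \<zeta> using that by simp
  have "open (\<Union>\<zeta>\<in>?X w0. ball \<zeta> e)" "?X w0 \<subseteq> (\<Union>\<zeta>\<in>?X w0. ball \<zeta> e)" using e by auto
  from fibre_nearby[OF r0 this] obtain \<delta> where
    d: "\<delta> > 0" "\<And>z. z \<in> D \<Longrightarrow> dist w0 (f z) \<le> \<delta> \<Longrightarrow> z \<in> (\<Union>\<zeta>\<in>?X w0. ball \<zeta> e)" by metis
  \<comment> \<open>Conservation of weight: over \<open>ball w0 r\<close> the restriction to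
    \<open>ball \<zeta> e\<close> remains proper, so its mass is constant.\<close>
  have weight_sum: "(\<Sum>\<xi>\<in>ball \<zeta> e \<inter> f -` {w}. weight f \<xi>) = weight f \<zeta>"
    if z: "\<zeta> \<in> ?X w0" and w: "w \<in> G" "dist w0 w < r" for \<zeta> w
  proof -
    have pa: "proper_at (ball \<zeta> e) f w' (r - dist w0 w')" if "w' \<in> ball w0 r" for w'
      by (rule proper_at_mono[OF pa_ball[OF z]]) (use that in auto)
    have "(\<Sum>\<xi>\<in>ball \<zeta> e \<inter> f -` {w}. weight f \<xi>) = mass (ball \<zeta> e) f w"
      by (rule mass_eq_sum[OF subD[OF z] pa w(1), symmetric]) (use w in simp)
    also have "\<dots> = mass (ball \<zeta> e) f w0"
    proof (rule mass_constant[OF open_ball convex_connected[OF convex_ball]])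
      show "\<exists>s. proper_at (ball \<zeta> e) f w' s" if "w' \<in> ball w0 r" for w' using pa[OF that] ..
    qed (use w r in auto)
    also have "\<dots> = weight f \<zeta>" using weight_eq[OF iso[OF z]] z by simp
    finally show ?thesis .
  qed
  show "\<exists>d>0. \<forall>w\<in>Y. dist w w0 < d \<longrightarrow> dist (pushforward g w) (pushforward g w0) < \<epsilon>"
  proof (rule exI[of _ "min r \<delta>"], intro conjI ballI impI)
    fix w assume wY: "w \<in> Y" and wd: "dist w w0 < min r \<delta>"
    have w: "w \<in> G" "dist w0 w < r" "dist w0 w \<le> \<delta>" using wY wd Y by (auto simp: dist_commute)
    have Xw: "?X w = (\<Union>\<zeta>\<in>?X w0. ball \<zeta> e \<inter> f -` {w})"
    proof
      show "?X w \<subseteq> (\<Union>\<zeta>\<in>?X w0. ball \<zeta> e \<inter> f -` {w})"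
      proof
        fix \<xi> assume x: "\<xi> \<in> ?X w"
        then have "\<xi> \<in> (\<Union>\<zeta>\<in>?X w0. ball \<zeta> e)" using d(2)[of \<xi>] w(3) by simp
        then show "\<xi> \<in> (\<Union>\<zeta>\<in>?X w0. ball \<zeta> e \<inter> f -` {w})" using x by blast
      qed
      show "(\<Union>\<zeta>\<in>?X w0. ball \<zeta> e \<inter> f -` {w}) \<subseteq> ?X w" using subD by blast
    qed
    have part: "(\<Sum>\<xi>\<in>?X w. F \<xi>) = (\<Sum>\<zeta>\<in>?X w0. \<Sum>\<xi>\<in>ball \<zeta> e \<inter> f -` {w}. F \<xi>)" for F :: "complex ^ 'n \<Rightarrow> complex"
      unfolding Xw
    proof (rule sum.UNION_disjoint[OF fin0])
      show "\<forall>\<zeta>\<in>?X w0. finite (ball \<zeta> e \<inter> f -` {w})"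
      proof
        fix \<zeta> assume z: "\<zeta> \<in> ?X w0"
        have "ball \<zeta> e \<inter> f -` {w} \<subseteq> ?X w" using subD[OF z] by blast
        then show "finite (ball \<zeta> e \<inter> f -` {w})" by (rule finite_subset[OF _ finite_fibre[OF w(1)]])
      qed
      show "\<forall>\<zeta>\<in>?X w0. \<forall>\<xi>\<in>?X w0. \<zeta> \<noteq> \<xi> \<longrightarrow> (ball \<zeta> e \<inter> f -` {w}) \<inter> (ball \<xi> e \<inter> f -` {w}) = {}"
        using disj by blast
    qed
    have eq: "pushforward g w - pushforward g w0
        = (\<Sum>\<zeta>\<in>?X w0. \<Sum>\<xi>\<in>ball \<zeta> e \<inter> f -` {w}. (g \<xi> - g \<zeta>) * complex_of_real (weight f \<xi>))"
    proof -
      have 0: "pushforward g w0 = (\<Sum>\<zeta>\<in>?X w0. \<Sum>\<xi>\<in>ball \<zeta> e \<inter> f -` {w}. g \<zeta> * complex_of_real (weight f \<xi>))"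
        unfolding pushforward_def
      proof (rule sum.cong[OF refl])
        fix \<zeta> assume z: "\<zeta> \<in> ?X w0"
        show "g \<zeta> * complex_of_real (weight f \<zeta>) = (\<Sum>\<xi>\<in>ball \<zeta> e \<inter> f -` {w}. g \<zeta> * complex_of_real (weight f \<xi>))"
          unfolding weight_sum[OF z w(1,2), symmetric] of_real_sum sum_distrib_left ..
      qed
      have 1: "pushforward g w = (\<Sum>\<zeta>\<in>?X w0. \<Sum>\<xi>\<in>ball \<zeta> e \<inter> f -` {w}. g \<xi> * complex_of_real (weight f \<xi>))"
        unfolding pushforward_def by (rule part)
      show ?thesis unfolding 0 1 left_diff_distrib sum_subtractf ..
    qed
    have "norm (pushforward g w - pushforward g w0)
        \<le> (\<Sum>\<zeta>\<in>?X w0. \<Sum>\<xi>\<in>ball \<zeta> e \<inter> f -` {w}. \<eta> * weight f \<xi>)"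
      unfolding eq
    proof (intro sum_norm_le)
      fix \<zeta> \<xi> assume z: "\<zeta> \<in> ?X w0" and x: "\<xi> \<in> ball \<zeta> e \<inter> f -` {w}"
      have xD: "\<xi> \<in> D" using x subD[OF z] by blast
      have "norm (g \<xi> - g \<zeta>) \<le> \<eta>" using near_g[OF z xD] x wY by (simp add: dist_norm less_imp_le)
      then show "norm ((g \<xi> - g \<zeta>) * complex_of_real (weight f \<xi>)) \<le> \<eta> * weight f \<xi>"
        using weight_nonneg_fibre[OF xD] by (simp add: norm_mult mult_right_mono)
    qed
    also have "\<dots> = \<eta> * m"
    proof -
      have "(\<Sum>\<zeta>\<in>?X w0. \<Sum>\<xi>\<in>ball \<zeta> e \<inter> f -` {w}. \<eta> * weight f \<xi>) = (\<Sum>\<zeta>\<in>?X w0. \<eta> * weight f \<zeta>)"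
      proof (rule sum.cong[OF refl])
        fix \<zeta> assume z: "\<zeta> \<in> ?X w0"
        show "(\<Sum>\<xi>\<in>ball \<zeta> e \<inter> f -` {w}. \<eta> * weight f \<xi>) = \<eta> * weight f \<zeta>"
          unfolding weight_sum[OF z w(1,2), symmetric] by (rule sum_distrib_left[symmetric])
      qed
      also have "\<dots> = \<eta> * m"
        unfolding m_def mass_eq_sum[OF order_refl r0 w0G] by (rule sum_distrib_left[symmetric])
      finally show ?thesis .
    qed
    also have "\<dots> < \<epsilon>" using eps m0 by (simp add: \<eta>_def pos_divide_less_eq distrib_left)
    finally show "dist (pushforward g w) (pushforward g w0) < \<epsilon>" by (simp add: dist_norm)
  qed (use r d in auto)
qed

lemma pushforward_regular:
  fixes g :: "complex ^ 'n \<Rightarrow> complex"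
  assumes "w \<in> G" "w \<notin> crit_values"
  shows "pushforward g w = sheet_weight * (\<Sum>\<zeta>\<in>D \<inter> f -` {w}. g \<zeta>)"
proof -
  have "weight f \<zeta> = sheet_weight" if "\<zeta> \<in> D \<inter> f -` {w}" for \<zeta>
    using that assms(2) by (intro sheet_weight(2)) (auto simp: crit_values_def)
  then show ?thesis unfolding pushforward_def sum_distrib_left by (intro sum.cong) auto
qed

text \<open>The nontrivial inclusion rests on openness of \<open>f\<close> at every point of
  \<open>D\<close>: finite fibres isolate even critical points, so images of small balls contain
  balls and meet \<open>L\<close> whenever their centre is mapped into its closure.\<close>

lemma closure_preimage:
  assumes L: "compact (closure L)" "closure L \<subseteq> G"
  shows "closure (D \<inter> f -` L) = D \<inter> f -` closure L"
proof
  have "closed (D \<inter> f -` closure L)" by (rule compact_imp_closed[OF proper[OF L]])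
  then show "closure (D \<inter> f -` L) \<subseteq> D \<inter> f -` closure L"
    by (intro closure_minimal) (use closure_subset[of L] in auto)
  show "D \<inter> f -` closure L \<subseteq> closure (D \<inter> f -` L)"
  proof
    fix z assume z: "z \<in> D \<inter> f -` closure L"
    have "f z \<in> G" using z L by blast
    then obtain e0 where e0: "isolating f z e0" "cball z e0 \<subseteq> D"
      using finite_fibre_radius[OF oD hol finite_fibre] z by (metis IntD1 IntI vimage_singleton_eq)
    have "\<exists>y\<in>D \<inter> f -` L. dist y z < \<epsilon>" if eps: "\<epsilon> > 0" for \<epsilon>
    proof -
      define e where "e = min e0 \<epsilon>"
      have e: "0 < e" "e \<le> e0" "e \<le> \<epsilon>" using e0(1) eps by (auto simp: e_def isolating_def)
      obtain r where r: "proper_at (ball z e) f (f z) r"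
        using isolating_proper[OF isolating_smaller[OF e0(1) e(1,2)]] ..
      have sub: "ball (f z) (r / 2) \<subseteq> f ` ball z e"
        by (rule proper_at_image_ball[OF r _ refl]) (use e in simp)
      have "r / 2 > 0" using r by (simp add: proper_at_def)
      moreover have "f z \<in> closure L" using z by simp
      ultimately obtain w where w: "w \<in> L" "dist w (f z) < r / 2"
        unfolding closure_approachable by blast
      then have "w \<in> f ` ball z e" using sub by (auto simp: dist_commute)
      then obtain y where y: "y \<in> ball z e" "f y = w" by blast
      have "y \<in> cball z e0" using y(1) e by auto
      then have "y \<in> D" using e0(2) by blast
      then show ?thesis using y w e by (auto simp: dist_commute intro!: bexI[of _ y])
    qed
    then show "z \<in> closure (D \<inter> f -` L)" unfolding closure_approachable by blast
  qed
qed

end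

section \<open>Existence of a smallest boundary\<close>

text \<open>On compact sets the suprema are attained, so their equality is domination by some point
  of \<open>S\<close>. The constants 1 and 2 exclude an empty \<open>S\<close>, for which one and
  the same \<open>Sup {}\<close> would have to equal both.\<close>

lemma boundary_iff:
  assumes X: "compact X" "X \<noteq> {}" and A: "\<And>h. h \<in> A \<Longrightarrow> continuous_on X h"
    and c: "\<And>c. (\<lambda>_. c) \<in> A"
  shows "(closed S \<and> S \<subseteq> X \<and> (\<forall>h\<in>A. (SUP z\<in>X. norm (h z)) = (SUP z\<in>S. norm (h z))))
    \<longleftrightarrow> (closed S \<and> S \<subseteq> X \<and> (\<forall>h\<in>A. \<forall>z\<in>X. \<exists>s\<in>S. norm (h z) \<le> norm (h s :: complex)))"
proof (intro conj_cong refl)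
  assume S: "closed S" "S \<subseteq> X"
  have cS: "compact S" using compact_Int_closed[OF X(1) S(1)] S(2) by (simp add: Int_absorb1)
  have bdd: "bdd_above ((\<lambda>z. norm (h z)) ` T)" if h: "h \<in> A" and T: "T \<subseteq> X" for h T
  proof -
    have "compact ((\<lambda>z. norm (h z)) ` X)"
      by (intro compact_continuous_image continuous_on_norm A h X)
    then have "bdd_above ((\<lambda>z. norm (h z)) ` X)" by (intro bounded_imp_bdd_above compact_imp_bounded)
    then show ?thesis by (rule bdd_above_mono) (use T in blast)
  qed
  show "(\<forall>h\<in>A. (SUP z\<in>X. norm (h z)) = (SUP z\<in>S. norm (h z)))
     \<longleftrightarrow> (\<forall>h\<in>A. \<forall>z\<in>X. \<exists>s\<in>S. norm (h z) \<le> norm (h s))"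
  proof (intro iffI ballI)
    fix h z assume sup: "\<forall>h\<in>A. (SUP z\<in>X. norm (h z)) = (SUP z\<in>S. norm (h z))" and h: "h \<in> A" and z: "z \<in> X"
    have "S \<noteq> {}"
    proof
      assume S0: "S = {}"
      have "(SUP z\<in>X. norm (c :: complex)) = (SUP z\<in>S. norm c)" for c using bspec[OF sup c[of c]] .
      from this[of 1] this[of 2] show False using X(2) S0 by simp
    qed
    moreover have "continuous_on S (\<lambda>z. norm (h z))"
      by (intro continuous_on_norm continuous_on_subset[OF A[OF h] S(2)])
    ultimately obtain s where s: "s \<in> S" "\<And>t. t \<in> S \<Longrightarrow> norm (h t) \<le> norm (h s)"
      using continuous_attains_sup[OF cS] by blast
    have "norm (h z) \<le> (SUP z\<in>X. norm (h z))" by (rule cSUP_upper[OF z bdd[OF h order_refl]])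
    also have "\<dots> = (SUP z\<in>S. norm (h z))" using sup h by blast
    also have "\<dots> \<le> norm (h s)" by (rule cSUP_least) (use s \<open>S \<noteq> {}\<close> in auto)
    finally show "\<exists>s\<in>S. norm (h z) \<le> norm (h s)" using s(1) by blast
  next
    fix h assume all: "\<forall>h\<in>A. \<forall>z\<in>X. \<exists>s\<in>S. norm (h z) \<le> norm (h s)" and h: "h \<in> A"
    have "S \<noteq> {}" using all h X(2) by blast
    show "(SUP z\<in>X. norm (h z)) = (SUP z\<in>S. norm (h z))"
    proof (rule antisym)
      show "(SUP z\<in>X. norm (h z)) \<le> (SUP z\<in>S. norm (h z))"
        by (rule cSUP_mono[OF X(2) bdd[OF h S(2)]]) (use all h in blast)
      show "(SUP z\<in>S. norm (h z)) \<le> (SUP z\<in>X. norm (h z))"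
        by (rule cSUP_subset_mono[OF \<open>S \<noteq> {}\<close> bdd[OF h order_refl] S(2)]) simp
    qed
  qed
qed

text \<open>Coordinates in \<open>A\<close> make the sets \<open>cube x \<epsilon>\<close>
  neighbourhoods cut out by members of \<open>A\<close>, and the products allow powers of a peaking
  function times coordinate differences; the existence of a smallest boundary rests on this.\<close>

locale function_algebra =
  fixes A :: "(complex ^ 'n \<Rightarrow> complex) set" and X :: "(complex ^ 'n) set"
  assumes X: "compact X" "X \<noteq> {}" and cont: "\<And>h. h \<in> A \<Longrightarrow> continuous_on X h"
    and const: "\<And>c. (\<lambda>_. c) \<in> A" and coord: "\<And>j. (\<lambda>z. z $ j) \<in> A"
    and diff: "\<And>g h. g \<in> A \<Longrightarrow> h \<in> A \<Longrightarrow> (\<lambda>z. g z - h z) \<in> A"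
    and mult: "\<And>g h. g \<in> A \<Longrightarrow> h \<in> A \<Longrightarrow> (\<lambda>z. g z * h z) \<in> A"
begin

definition bdry :: "(complex ^ 'n) set \<Rightarrow> bool" where
  "bdry S \<longleftrightarrow> closed S \<and> S \<subseteq> X \<and> (\<forall>h\<in>A. \<forall>z\<in>X. \<exists>s\<in>S. norm (h z) \<le> norm (h s))"

lemma power_in: "h \<in> A \<Longrightarrow> (\<lambda>z. h z ^ m) \<in> A"
  by (induction m) (auto intro: const mult)

lemma exists_max:
  assumes "h \<in> A" obtains x where "x \<in> X" "\<And>y. y \<in> X \<Longrightarrow> norm (h y) \<le> norm (h x)"
  using continuous_attains_sup[OF X continuous_on_norm[OF cont[OF assms]]] by blast

definition cube :: "complex ^ 'n \<Rightarrow> real \<Rightarrow> (complex ^ 'n) set" where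
  "cube x \<epsilon> = {y. \<forall>j. norm (y $ j - x $ j) < \<epsilon>}"

lemma open_cube: "open (cube x \<epsilon>)"
proof -
  have "cube x \<epsilon> = (\<Inter>j. {y. norm (y $ j - x $ j) < \<epsilon>})" by (auto simp: cube_def)
  moreover have "open {y :: complex ^ 'n. norm (y $ j - x $ j) < \<epsilon>}" for j
    by (intro open_Collect_less continuous_intros)
  ultimately show ?thesis by auto
qed

text \<open>
  If \<open>g\<close> peaked inside the cube rather than on \<open>E\<close> minus the cube, then \<open>g\<^sup>k\<close> times the coordinate
  functions would be small on \<open>E\<close>, forcing the peak set of \<open>g\<close> into the cube and away from \<open>E0\<close>.
\<close>

lemma bdry_remove_cube:
  assumes E0: "bdry E0" "cube x \<epsilon> \<inter> E0 = {}" and E: "bdry E" and eps: "\<epsilon> > 0"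
  shows "bdry (E - cube x \<epsilon>)"
proof (rule ccontr)
  assume neg: "\<not> bdry (E - cube x \<epsilon>)"
  have E': "closed E" "E \<subseteq> X" using E by (auto simp: bdry_def)
  have cE: "compact (E - cube x \<epsilon>)"
    using compact_diff[OF compact_Int_closed[OF X(1) E'(1)] open_cube[of x \<epsilon>]] E'(2) by (simp add: Int_absorb1)
  obtain g z where g: "g \<in> A" "z \<in> X" "\<And>s. s \<in> E - cube x \<epsilon> \<Longrightarrow> norm (g s) < norm (g z)"
    using neg compact_imp_closed[OF cE] E'(2) unfolding bdry_def by (meson Diff_subset not_le order_trans)
  obtain x1 where x1: "x1 \<in> X" "\<And>y. y \<in> X \<Longrightarrow> norm (g y) \<le> norm (g x1)" using exists_max[OF g(1)] by blast
  define M where "M = norm (g x1)"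
  have lt: "norm (g s) < M" if "s \<in> E - cube x \<epsilon>" for s
    using g(3)[OF that] x1(2)[OF g(2)] by (simp add: M_def)
  \<comment> \<open>If \<open>g\<close> vanished on \<open>X\<close>, then \<open>E\<close> would
    lie in the cube, so all coordinate differences would be below \<epsilon> on \<open>X\<close>,
    and the nonempty \<open>E0\<close> could not avoid the cube.\<close>
  have M0: "M > 0"
  proof (rule ccontr)
    assume "\<not> M > 0"
    then have gz: "norm (g y) = 0" if "y \<in> X" for y using x1(2)[OF that] by (simp add: M_def)
    have "E - cube x \<epsilon> = {}" using lt \<open>\<not> M > 0\<close> by (meson equals0I le_less_trans norm_ge_zero)
    then have sub: "E \<subseteq> cube x \<epsilon>" by blast
    have one: "\<exists>s\<in>E. norm (h z) \<le> norm (h s)" if "h \<in> A" "z \<in> X" for h z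
      using E that unfolding bdry_def by blast
    have lt_eps: "norm (y $ j - x $ j) < \<epsilon>" if y: "y \<in> X" for y j
    proof -
      obtain s where s: "s \<in> E" "norm (y $ j - x $ j) \<le> norm (s $ j - x $ j)"
        using one[OF diff[OF coord[of j] const[of "x $ j"]] y] by blast
      have "norm (s $ j - x $ j) < \<epsilon>" using sub s(1) unfolding cube_def by blast
      then show ?thesis using s(2) by linarith
    qed
    then have "X \<subseteq> cube x \<epsilon>" by (auto simp: cube_def)
    moreover have "E0 \<subseteq> X" "E0 \<noteq> {}" using E0(1) const X(2) unfolding bdry_def by blast+
    ultimately show False using E0(2) by blast
  qed
  define g1 where "g1 z = inverse (complex_of_real M) * g z" for z
  have g1A: "g1 \<in> A" unfolding g1_def by (rule mult[OF const g(1)])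
  have ng1: "norm (g1 z) = norm (g z) / M" for z using M0 by (simp add: g1_def norm_mult norm_inverse divide_inverse mult.commute)
  have g1_le: "norm (g1 y) \<le> 1" if "y \<in> X" for y using x1(2)[OF that] M0 by (simp add: ng1 M_def)
  obtain q where q: "0 \<le> q" "q < 1" "\<And>s. s \<in> E - cube x \<epsilon> \<Longrightarrow> norm (g1 s) \<le> q"
  proof (cases "E - cube x \<epsilon> = {}")
    case True
    show thesis by (rule that[of 0]) (use True in auto)
  next
    case False
    have "continuous_on (E - cube x \<epsilon>) (\<lambda>z. norm (g1 z))"
      by (rule continuous_on_norm[OF continuous_on_subset[OF cont[OF g1A]]]) (use E' in blast)
    then obtain s where s: "s \<in> E - cube x \<epsilon>" "\<And>t. t \<in> E - cube x \<epsilon> \<Longrightarrow> norm (g1 t) \<le> norm (g1 s)"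
      using continuous_attains_sup[OF cE False] by blast
    show thesis by (rule that[of "norm (g1 s)"]) (use s lt[OF s(1)] M0 in \<open>auto simp: ng1\<close>)
  qed
  obtain B where B: "B > 0" "\<And>y. y \<in> X \<Longrightarrow> norm (y - x) \<le> B"
  proof -
    have "bounded ((\<lambda>y. y - x) ` X)"
      by (intro compact_imp_bounded compact_continuous_image continuous_intros X)
    then show thesis using that unfolding bounded_pos by auto
  qed
  have Bj: "norm (y $ j - x $ j) \<le> B" if "y \<in> X" for y j
    using B(2)[OF that] Finite_Cartesian_Product.norm_nth_le[of "y - x" j] by simp
  \<comment> \<open>On \<open>E\<close> outside the cube the decay of \<open>g1 ^ k\<close> has to
    beat the size \<open>B\<close> of the coordinate differences; inside the cube these are below
    \<epsilon> already.\<close>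
  have "(\<lambda>k. q ^ k * B) \<longlonglongrightarrow> 0 * B"
    by (intro tendsto_intros LIMSEQ_power_zero) (use q in simp)
  then have "(\<lambda>k. q ^ k * B) \<longlonglongrightarrow> 0" by simp
  from order_tendstoD(2)[OF this eps] obtain k where k: "q ^ k * B < \<epsilon>"
    by (metis eventually_happens sequentially_bot)
  define F where "F j z = g1 z ^ k * (z $ j - x $ j)" for j z
  have FA: "F j \<in> A" for j
    unfolding F_def by (intro mult power_in g1A diff coord const)
  have F_E: "norm (F j s) < \<epsilon>" if s: "s \<in> E" for j s
  proof (cases "s \<in> cube x \<epsilon>")
    case True
    have "norm (F j s) = norm (g1 s) ^ k * norm (s $ j - x $ j)" by (simp add: F_def norm_mult norm_power)
    also have "\<dots> \<le> 1 * norm (s $ j - x $ j)"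
      using g1_le[of s] s E' by (intro mult_right_mono power_le_one) auto
    also have "\<dots> < \<epsilon>" using True by (simp add: cube_def)
    finally show ?thesis .
  next
    case False
    have "norm (F j s) = norm (g1 s) ^ k * norm (s $ j - x $ j)" by (simp add: F_def norm_mult norm_power)
    also have "\<dots> \<le> q ^ k * B"
      using q(3)[of s] False s Bj[of s j] E' q(1) by (intro mult_mono power_mono) auto
    finally show ?thesis using k by linarith
  qed
  have F_X: "norm (F j y) < \<epsilon>" if y: "y \<in> X" for j y
  proof -
    obtain s where "s \<in> E" "norm (F j y) \<le> norm (F j s)" using E FA[of j] y unfolding bdry_def by blast
    then show ?thesis using F_E[of s j] by linarith
  qed
  obtain y where y: "y \<in> E0" "norm (g1 x1) \<le> norm (g1 y)" using E0(1) g1A x1(1) unfolding bdry_def by blast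
  have yX: "y \<in> X" using y(1) E0(1) unfolding bdry_def by blast
  have "norm (g1 x1) = 1" using M0 by (simp add: ng1 M_def)
  then have "norm (g1 y) = 1" using y(2) g1_le[OF yX] by linarith
  then have "norm (y $ j - x $ j) < \<epsilon>" for j
    using F_X[OF yX, of j] by (simp add: F_def norm_mult norm_power)
  then have "y \<in> cube x \<epsilon>" by (simp add: cube_def)
  then show False using E0(2) y(1) by blast
qed

lemma bdry_X: "bdry X"
  using X by (auto simp: bdry_def compact_imp_closed)

text \<open>Otherwise some \<open>h\<close> has a peak set \<open>P\<close> disjoint from the
  intersection. By compactness finitely many cubes, each missing some boundary, cover
  \<open>P\<close>; removing them from \<open>X\<close> one at a time leaves a boundary, on which
  \<open>h\<close> would still have to peak.\<close>

lemma bdry_Inter: "bdry (\<Inter>{S. bdry S})"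
  unfolding bdry_def[of "\<Inter>_"]
proof (intro conjI ballI)
  let ?S0 = "\<Inter>{S. bdry S}"
  show cl: "closed ?S0" by (rule closed_Inter) (auto simp: bdry_def)
  show "?S0 \<subseteq> X" using bdry_X by blast
  fix h z assume h: "h \<in> A" and z: "z \<in> X"
  show "\<exists>s\<in>?S0. norm (h z) \<le> norm (h s)"
  proof (rule ccontr)
    assume "\<not> ?thesis"
    then have lt: "norm (h s) < norm (h z)" if "s \<in> ?S0" for s using that by (meson not_le)
    obtain x1 where x1: "x1 \<in> X" "\<And>y. y \<in> X \<Longrightarrow> norm (h y) \<le> norm (h x1)" using exists_max[OF h] by blast
    define P where "P = {y \<in> X. norm (h y) = norm (h x1)}"
    have "closed P"
      unfolding P_def using continuous_closed_preimage_constant[OF continuous_on_norm[OF cont[OF h]] compact_imp_closed[OF X(1)]]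
      by (simp add: conj_commute)
    then have "compact (X \<inter> P)" by (rule compact_Int_closed[OF X(1)])
    moreover have "X \<inter> P = P" by (auto simp: P_def)
    ultimately have cP: "compact P" by simp
    have ex: "\<exists>\<epsilon> E. \<epsilon> > 0 \<and> bdry E \<and> cube x \<epsilon> \<inter> E = {}" if x: "x \<in> P" for x
    proof -
      have "x \<notin> ?S0"
      proof
        assume "x \<in> ?S0"
        then have "norm (h x) < norm (h z)" by (rule lt)
        moreover have "norm (h x) = norm (h x1)" using x by (simp add: P_def)
        ultimately show False using x1(2)[OF z] by linarith
      qed
      then obtain E where E: "bdry E" "x \<notin> E" by blast
      have "open (- E)" using E(1) by (simp add: bdry_def open_Compl)
      then obtain e where e: "e > 0" "ball x e \<subseteq> - E" using E(2) by (meson ComplI openE)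
      \<comment> \<open>The Euclidean norm is at most the sum of the \<open>CARD('n)\<close>
        coordinate norms.\<close>
      have "cube x (e / CARD('n)) \<subseteq> ball x e"
      proof
        fix y assume "y \<in> cube x (e / CARD('n))"
        then have "norm ((y - x) $ j) < e / CARD('n)" for j by (simp add: cube_def)
        then have "(\<Sum>j\<in>UNIV. norm ((y - x) $ j)) < (\<Sum>j\<in>(UNIV :: 'n set). e / CARD('n))"
          by (intro sum_strict_mono) auto
        then have "norm (y - x) < e" using norm_vec_le_sum[of "y - x"] by simp
        then show "y \<in> ball x e" by (simp add: dist_norm norm_minus_commute)
      qed
      then have "e / CARD('n) > 0 \<and> bdry E \<and> cube x (e / CARD('n)) \<inter> E = {}" using e E by auto
      then show ?thesis by blast
    qed
    then obtain \<epsilon> E where eE: "\<And>x. x \<in> P \<Longrightarrow> \<epsilon> x > 0 \<and> bdry (E x) \<and> cube x (\<epsilon> x) \<inter> E x = {}" by metis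
    have "P \<subseteq> (\<Union>x\<in>P. cube x (\<epsilon> x))" using eE by (auto simp: cube_def)
    then obtain C where C: "C \<subseteq> P" "finite C" "P \<subseteq> (\<Union>x\<in>C. cube x (\<epsilon> x))"
      using compactE_image[OF cP, of P "\<lambda>x. cube x (\<epsilon> x)"] open_cube by metis
    have "bdry (X - (\<Union>x\<in>C. cube x (\<epsilon> x)))"
      using C(2,1)
    proof (induction C rule: finite_induct)
      case empty then show ?case using bdry_X by simp
    next
      case (insert x C)
      then have "bdry (X - (\<Union>x\<in>C. cube x (\<epsilon> x)) - cube x (\<epsilon> x))"
        using eE[of x] by (intro bdry_remove_cube[of "E x"]) auto
      moreover have "X - (\<Union>x\<in>C. cube x (\<epsilon> x)) - cube x (\<epsilon> x) = X - (\<Union>x\<in>insert x C. cube x (\<epsilon> x))" by auto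
      ultimately show ?case by simp
    qed
    then obtain s where s: "s \<in> X - (\<Union>x\<in>C. cube x (\<epsilon> x))" "norm (h x1) \<le> norm (h s)"
      using h x1(1) unfolding bdry_def by blast
    then have "s \<in> P" using x1(2)[of s] by (auto simp: P_def)
    then show False using C(3) s(1) by blast
  qed
qed

lemma max_modulus_boundary_eq: "max_modulus_boundary A X = \<Inter>{S. bdry S}"
proof -
  have "(closed S \<and> S \<subseteq> X \<and> (\<forall>h\<in>A. (SUP z\<in>X. norm (h z)) = (SUP z\<in>S. norm (h z)))) \<longleftrightarrow> bdry S" for S
    unfolding bdry_def by (rule boundary_iff[OF X]) (rule cont, assumption, rule const)
  then show ?thesis
    unfolding max_modulus_boundary_def
    by (simp only:) (rule Least_equality[where P = bdry, OF bdry_Inter], blast)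
qed

lemma bdry_max_modulus: "bdry (max_modulus_boundary A X)"
  unfolding max_modulus_boundary_eq by (rule bdry_Inter)

lemma max_modulus_least: "bdry S \<Longrightarrow> max_modulus_boundary A X \<subseteq> S"
  unfolding max_modulus_boundary_eq by blast

end

section \<open>Images of the boundaries\<close>

context proper_map
begin

text \<open>
  The pushforwards of the powers \<open>h\<^sup>m\<close> are controlled by \<open>h\<close> on the fibres, hence by \<open>h\<close> over a
  boundary of \<open>Y\<close>; conversely, bounds on all power sums over a regular fibre bound \<open>h\<close> itself.
\<close>

lemma image_boundary:
  assumes A: "function_algebra A X" and B: "function_algebra B Y"
    and Y: "compact Y" "Y \<subseteq> G" and X: "X = D \<inter> f -` Y"
    and comp: "\<And>h. h \<in> B \<Longrightarrow> (\<lambda>z. h (f z)) \<in> A"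
    and push: "\<And>h. h \<in> A \<Longrightarrow> \<exists>T\<in>B. \<forall>w\<in>Y. T w = pushforward h w"
    and dense: "\<And>z. z \<in> X \<Longrightarrow> z \<in> closure {z \<in> X. f z \<notin> crit_values}"
  shows "f ` max_modulus_boundary A X = max_modulus_boundary B Y"
proof -
  interpret A: function_algebra A X by (rule A)
  interpret B: function_algebra B Y by (rule B)
  let ?S = "max_modulus_boundary A X" and ?T = "max_modulus_boundary B Y"
  have bS: "A.bdry ?S" and bT: "B.bdry ?T" by (rule A.bdry_max_modulus B.bdry_max_modulus)+
  have YX: "f ` X = Y" using X Y(2) image_eq by (force simp: image_iff)
  have contX: "continuous_on X f" by (rule continuous_on_subset[OF cont]) (use X in blast)
  have SX: "closed ?S" "?S \<subseteq> X" and TY: "closed ?T" "?T \<subseteq> Y"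
    using bS bT by (auto simp: A.bdry_def B.bdry_def)
  have "B.bdry (f ` ?S)"
    unfolding B.bdry_def
  proof (intro conjI ballI)
    have "compact ?S" using compact_Int_closed[OF A.X(1) SX(1)] SX(2) by (simp add: Int_absorb1)
    then show "closed (f ` ?S)"
      by (intro compact_imp_closed compact_continuous_image continuous_on_subset[OF contX SX(2)])
    show "f ` ?S \<subseteq> Y" using SX(2) YX by blast
    fix h w assume h: "h \<in> B" and w: "w \<in> Y"
    obtain z where z: "z \<in> X" "f z = w" using w YX by blast
    have "\<forall>g\<in>A. \<forall>z\<in>X. \<exists>s\<in>?S. norm (g z) \<le> norm (g s)" using bS unfolding A.bdry_def by blast
    from bspec[OF bspec[OF this comp[OF h]] z(1)]
    obtain s where s: "s \<in> ?S" "norm (h (f z)) \<le> norm (h (f s))" by blast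
    then show "\<exists>s\<in>f ` ?S. norm (h w) \<le> norm (h s)" using z(2) by blast
  qed
  then have 1: "?T \<subseteq> f ` ?S" by (rule B.max_modulus_least)
  \<comment> \<open>By minimality of \<open>?S\<close> the remaining inclusion follows once the part
    of \<open>X\<close> over \<open>?T\<close> is known to be a boundary.\<close>
  have "A.bdry (X \<inter> f -` ?T)"
    unfolding A.bdry_def
  proof (intro conjI ballI)
    show cl: "closed (X \<inter> f -` ?T)"
      by (rule continuous_closed_preimage[OF contX compact_imp_closed[OF A.X(1)] TY(1)])
    fix h z assume h: "h \<in> A" and z: "z \<in> X"
    have "compact (X \<inter> (X \<inter> f -` ?T))" by (rule compact_Int_closed[OF A.X(1) cl])
    then have cS: "compact (X \<inter> f -` ?T)" by (simp add: Int_absorb1)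
    have "?T \<noteq> {}" using bT B.X(2) B.const unfolding B.bdry_def by blast
    then have ne: "X \<inter> f -` ?T \<noteq> {}" using TY(2) YX by blast
    have "continuous_on (X \<inter> f -` ?T) (\<lambda>z. norm (h z))"
      by (rule continuous_on_norm[OF continuous_on_subset[OF A.cont[OF h]]]) simp
    then obtain s where s: "s \<in> X \<inter> f -` ?T" "\<And>t. t \<in> X \<inter> f -` ?T \<Longrightarrow> norm (h t) \<le> norm (h s)"
      using continuous_attains_sup[OF cS ne] by blast
    define R where "R = norm (h s)"
    obtain w0 where w0: "w0 \<in> Y" using B.X(2) by blast
    then have w0G: "w0 \<in> G" using Y(2) by blast
    \<comment> \<open>The constant does not depend on \<open>m\<close>; the power sum argument needs
      exactly this growth.\<close>
    have T_le: "norm (pushforward (\<lambda>z. h z ^ m) w) \<le> mass D f w0 * R ^ m" if w: "w \<in> Y" for w m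
    proof -
      obtain T where T: "T \<in> B" "\<And>w. w \<in> Y \<Longrightarrow> T w = pushforward (\<lambda>z. h z ^ m) w"
        using push[OF A.power_in[OF h]] by blast
      obtain t where t: "t \<in> ?T" "norm (T w) \<le> norm (T t)" using bT T(1) w unfolding B.bdry_def by blast
      have tY: "t \<in> Y" using t(1) TY(2) by blast
      have "norm (pushforward (\<lambda>z. h z ^ m) t) \<le> mass D f w0 * R ^ m"
      proof (rule pushforward_bound[OF _ w0G])
        show "t \<in> G" using tY Y(2) by blast
        fix \<zeta> assume "\<zeta> \<in> D" "f \<zeta> = t"
        then have "\<zeta> \<in> X \<inter> f -` ?T" using t(1) tY X by auto
        from s(2)[OF this] show "norm (h \<zeta> ^ m) \<le> R ^ m"
          unfolding norm_power R_def by (intro power_mono) auto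
      qed
      then show ?thesis using t(2) T(2)[OF w] T(2)[OF tY] by simp
    qed
    \<comment> \<open>Over a regular value all weights equal \<open>sheet_weight\<close>, so the
      estimate becomes one for plain power sums.\<close>
    have reg: "norm (h \<zeta>) \<le> R" if x: "\<zeta> \<in> X" "f \<zeta> \<notin> crit_values" for \<zeta>
    proof (rule power_sum_bound[where I = "D \<inter> f -` {f \<zeta>}" and a = h and C = "mass D f w0 / sheet_weight"])
      have fY: "f \<zeta> \<in> Y" using x(1) YX by blast
      then have fG: "f \<zeta> \<in> G" using Y(2) by blast
      show "finite (D \<inter> f -` {f \<zeta>})" by (rule finite_fibre[OF fG])
      show "\<zeta> \<in> D \<inter> f -` {f \<zeta>}" using x(1) X by simp
      show "0 \<le> R" by (simp add: R_def)
      fix m :: nat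
      have "norm (complex_of_real sheet_weight * (\<Sum>\<zeta>\<in>D \<inter> f -` {f \<zeta>}. h \<zeta> ^ m)) \<le> mass D f w0 * R ^ m"
        using T_le[OF fY, of m] unfolding pushforward_regular[OF fG x(2)] .
      then show "norm (\<Sum>\<zeta>\<in>D \<inter> f -` {f \<zeta>}. h \<zeta> ^ m) \<le> mass D f w0 / sheet_weight * R ^ m"
        using sheet_weight(1) by (simp add: norm_mult field_simps)
    qed
    \<comment> \<open>Regular values only give the estimate on a subset; it extends to all of
      \<open>X\<close> by density, since it describes a closed set.\<close>
    have "closed (X \<inter> (\<lambda>z. norm (h z)) -` {..R})"
      by (rule continuous_closed_preimage[OF continuous_on_norm[OF A.cont[OF h]] compact_imp_closed[OF A.X(1)]]) simp
    then have "closure {z \<in> X. f z \<notin> crit_values} \<subseteq> X \<inter> (\<lambda>z. norm (h z)) -` {..R}"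
      by (intro closure_minimal) (use reg in auto)
    then have "norm (h z) \<le> R" using dense[OF z] by blast
    then show "\<exists>s\<in>X \<inter> f -` ?T. norm (h z) \<le> norm (h s)" using s(1) by (auto simp: R_def)
  qed simp
  then have "?S \<subseteq> X \<inter> f -` ?T" by (rule A.max_modulus_least)
  with 1 show ?thesis by blast
qed

lemma shilov_algebra:
  assumes "compact (closure \<Omega>)" "\<Omega> \<noteq> {}"
  shows "function_algebra {h. holomorphic_Cn h \<Omega> \<and> continuous_on (closure \<Omega>) h} (closure \<Omega>)"
  by unfold_locales
    (use assms in \<open>auto intro!: holomorphic_Cn_coord holomorphic_Cn_diff holomorphic_Cn_mult continuous_intros\<close>)

lemma bergman_algebra:
  assumes "compact (closure \<Omega>)" "\<Omega> \<noteq> {}"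
  shows "function_algebra {h. \<exists>U. open U \<and> closure \<Omega> \<subseteq> U \<and> holomorphic_Cn h U} (closure \<Omega>)"
proof
  show "compact (closure \<Omega>)" "closure \<Omega> \<noteq> {}" using assms by auto
  let ?A = "{h. \<exists>U. open U \<and> closure \<Omega> \<subseteq> U \<and> holomorphic_Cn h U}"
  show "continuous_on (closure \<Omega>) h" if "h \<in> ?A" for h
    using that holomorphic_Cn_continuous_on continuous_on_subset by blast
  show "(\<lambda>_. c) \<in> ?A" for c by (auto intro!: exI[of _ UNIV])
  show "(\<lambda>z. z $ j) \<in> ?A" for j by (auto intro!: exI[of _ UNIV] holomorphic_Cn_coord)
  fix g h assume "g \<in> ?A" "h \<in> ?A"
  then obtain U V where U: "open U" "closure \<Omega> \<subseteq> U" "holomorphic_Cn g U"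
    and V: "open V" "closure \<Omega> \<subseteq> V" "holomorphic_Cn h V" by blast
  have UV: "open (U \<inter> V)" "closure \<Omega> \<subseteq> U \<inter> V" using U V by auto
  have g: "holomorphic_Cn g (U \<inter> V)" by (rule holomorphic_Cn_subset[OF U(3)]) simp
  have h: "holomorphic_Cn h (U \<inter> V)" by (rule holomorphic_Cn_subset[OF V(3)]) simp
  show "(\<lambda>z. g z - h z) \<in> ?A" using UV holomorphic_Cn_diff[OF g h] by blast
  show "(\<lambda>z. g z * h z) \<in> ?A" using UV holomorphic_Cn_mult[OF g h] by blast
qed

text \<open>A push-forward needs whole fibres, whereas a function holomorphic near the closure of
  \<open>K\<close> comes with an arbitrary open \<open>U\<close>. Properness provides a
  neighbourhood of \<open>Y\<close> whose entire preimage lies in \<open>U\<close>.\<close>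

lemma open_neighbourhood_fibres:
  assumes Y: "Y \<subseteq> G" and U: "open U" "D \<inter> f -` Y \<subseteq> U"
  obtains W where "open W" "Y \<subseteq> W" "W \<subseteq> G" "D \<inter> f -` W \<subseteq> U"
proof -
  have "\<exists>\<delta>>0. ball w \<delta> \<subseteq> G \<and> D \<inter> f -` ball w \<delta> \<subseteq> U" if w: "w \<in> Y" for w
  proof -
    obtain r where r: "r > 0" "cball w r \<subseteq> G" "proper_at D f w r" using proper_at_G w Y by (metis subsetD)
    have "D \<inter> f -` {w} \<subseteq> U" using U(2) w by auto
    then obtain \<delta> where d: "\<delta> > 0" "\<delta> \<le> r" "\<And>z. z \<in> D \<Longrightarrow> dist w (f z) \<le> \<delta> \<Longrightarrow> z \<in> U"
      using fibre_nearby[OF r(3) U(1)] by metis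
    have "ball w \<delta> \<subseteq> cball w r" using d(2) by auto
    then show ?thesis using d r(2) by (intro exI[of _ \<delta>]) auto
  qed
  then obtain \<delta> where d: "\<And>w. w \<in> Y \<Longrightarrow> \<delta> w > 0 \<and> ball w (\<delta> w) \<subseteq> G \<and> D \<inter> f -` ball w (\<delta> w) \<subseteq> U" by metis
  show thesis
  proof (rule that[of "\<Union>w\<in>Y. ball w (\<delta> w)"])
    show "Y \<subseteq> (\<Union>w\<in>Y. ball w (\<delta> w))" using d by force
    show "(\<Union>w\<in>Y. ball w (\<delta> w)) \<subseteq> G" "D \<inter> f -` (\<Union>w\<in>Y. ball w (\<delta> w)) \<subseteq> U" using d by blast+
  qed auto
qed

text \<open>Both cases are instances of \<open>image_boundary\<close>. For the Shilov boundary the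
  push-forward is holomorphic over \<open>L\<close> and continuous up to the closure by separate
  arguments; for the Bergman boundary it is formed over an open neighbourhood of the closure of
  \<open>L\<close>.\<close>

theorem image_shilov_bergman:
  assumes L: "domain_Cn L" "compact (closure L)" "closure L \<subseteq> G" and K: "K = D \<inter> f -` L"
  shows "f ` shilov_boundary K = shilov_boundary L" "f ` bergman_boundary K = bergman_boundary L"
proof -
  have oL: "open L" and neL: "L \<noteq> {}" using L(1) by (auto simp: domain_Cn_def)
  have LG: "L \<subseteq> G" using L(3) closure_subset by blast
  have clK: "closure K = D \<inter> f -` closure L" unfolding K by (rule closure_preimage[OF L(2,3)])
  have cK: "compact (closure K)" unfolding clK by (rule proper[OF L(2,3)])
  have oK: "open K" unfolding K by (rule continuous_open_preimage[OF cont oD oL])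
  have KD: "K \<subseteq> D" and K_maps: "\<And>z. z \<in> K \<Longrightarrow> f z \<in> L" by (auto simp: K)
  have neK: "K \<noteq> {}" using neL LG image_eq unfolding K by blast
  have clKD: "closure K \<subseteq> D" and clK_maps: "\<And>z. z \<in> closure K \<Longrightarrow> f z \<in> closure L" by (auto simp: clK)
  \<comment> \<open>A point of the closure is first approached from the open set \<open>K\<close>,
    in which the points over regular values are dense.\<close>
  have dense: "z \<in> closure {z \<in> closure K. f z \<notin> crit_values}" if z: "z \<in> closure K" for z
    unfolding closure_approachable[of z "{z \<in> closure K. f z \<notin> crit_values}"]
  proof (intro allI impI)
    fix e :: real assume "e > 0"
    then obtain y where "y \<in> K" "dist y z < e" using z unfolding closure_approachable by blast
    then have "K \<inter> ball z e \<noteq> {}" by (auto simp: dist_commute)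
    then obtain x where "x \<in> K \<inter> ball z e" "f x \<notin> crit_values"
      using regular_dense[of "K \<inter> ball z e"] oK KD by (meson IntD1 open_Int open_ball subset_iff)
    then show "\<exists>y\<in>{z \<in> closure K. f z \<notin> crit_values}. dist y z < e"
      using closure_subset[of K] by (auto simp: dist_commute)
  qed
  have contK: "continuous_on (closure K) f" by (rule continuous_on_subset[OF cont clKD])
  have holK: "holomorphic_map_Cn f K" by (rule holomorphic_map_subset[OF hol KD])
  show "f ` shilov_boundary K = shilov_boundary L"
    unfolding shilov_boundary_def
  proof (rule image_boundary[OF shilov_algebra[OF cK neK] shilov_algebra[OF L(2) neL] L(2,3) clK _ _ dense])
    fix h assume "h \<in> {h. holomorphic_Cn h L \<and> continuous_on (closure L) h}"
    then show "(\<lambda>z. h (f z)) \<in> {h. holomorphic_Cn h K \<and> continuous_on (closure K) h}"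
      using holomorphic_Cn_compose[OF _ holK K_maps] continuous_on_compose2[OF _ contK] clK_maps by blast
  next
    fix h assume h: "h \<in> {h. holomorphic_Cn h K \<and> continuous_on (closure K) h}"
    then have "holomorphic_Cn (pushforward h) L"
      by (intro pushforward_holomorphic[OF oL LG]) (simp add: K)
    moreover have "continuous_on (closure L) (pushforward h)"
      by (rule pushforward_continuous[OF L(3)]) (use h in \<open>simp add: clK\<close>)
    ultimately show "\<exists>T\<in>{h. holomorphic_Cn h L \<and> continuous_on (closure L) h}. \<forall>w\<in>closure L. T w = pushforward h w"
      by blast
  qed
  show "f ` bergman_boundary K = bergman_boundary L"
    unfolding bergman_boundary_def
  proof (rule image_boundary[OF bergman_algebra[OF cK neK] bergman_algebra[OF L(2) neL] L(2,3) clK _ _ dense])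
    fix h assume "h \<in> {h. \<exists>U. open U \<and> closure L \<subseteq> U \<and> holomorphic_Cn h U}"
    then obtain U where U: "open U" "closure L \<subseteq> U" "holomorphic_Cn h U" by blast
    have "holomorphic_Cn (\<lambda>z. h (f z)) (D \<inter> f -` U)"
      by (rule holomorphic_Cn_compose[OF U(3) holomorphic_map_subset[OF hol]]) auto
    moreover have "open (D \<inter> f -` U)" by (rule continuous_open_preimage[OF cont oD U(1)])
    moreover have "closure K \<subseteq> D \<inter> f -` U" using U(2) by (auto simp: clK)
    ultimately show "(\<lambda>z. h (f z)) \<in> {h. \<exists>U. open U \<and> closure K \<subseteq> U \<and> holomorphic_Cn h U}" by blast
  next
    fix h assume "h \<in> {h. \<exists>U. open U \<and> closure K \<subseteq> U \<and> holomorphic_Cn h U}"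
    then obtain U where U: "open U" "closure K \<subseteq> U" "holomorphic_Cn h U" by blast
    obtain W where W: "open W" "closure L \<subseteq> W" "W \<subseteq> G" "D \<inter> f -` W \<subseteq> U"
      using open_neighbourhood_fibres[OF L(3) U(1)] U(2) unfolding clK by metis
    have "holomorphic_Cn (pushforward h) W"
      by (rule pushforward_holomorphic[OF W(1,3) holomorphic_Cn_subset[OF U(3) W(4)]])
    then show "\<exists>T\<in>{h. \<exists>U. open U \<and> closure L \<subseteq> U \<and> holomorphic_Cn h U}. \<forall>w\<in>closure L. T w = pushforward h w"
      using W(1,2) by blast
  qed
qed

end

theorem theorem3:
  fixes f :: "complex ^ 'n \<Rightarrow> complex ^ 'n"
    and D G L K :: "(complex ^ 'n) set"
  assumes "domain_Cn D" and "domain_Cn G"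
    and "proper_holomorphic_map f D G"
    and "domain_Cn L" and "compact (closure L)" and "closure L \<subseteq> G"
    and "K = D \<inter> f -` L"
  shows "f ` shilov_boundary K = shilov_boundary L \<and>
         f ` bergman_boundary K = bergman_boundary L"
proof -
  interpret proper_map f D G by unfold_locales (fact assms)+
  show ?thesis using image_shilov_bergman[OF assms(4-7)] by blast
qed

end
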